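(* Let $M$ be Hrushovski's countable non-collapsed structure for a symmetric ternary relation $R$ and let $M_s$ be its $S$-reduct (with multiplicities). Let $T_s$ be the first-order theory stating, about a structure $N$: 1. the finite substructures of $N$ are, up to isomorphism, exactly the members of $\mathcal{C}_s$; 2. for every finite $A\subseteq N$ and every $B\in\mathcal{C}_s$ with $A\leqslant_s B$, there is an embedding $f:B\to N$ with $f\upharpoonright A=\mathrm{id}_A$; 3. for all $n,m\in\mathbb{N}$ there is an embedding of $F_n$ into $N$ whose image is strong in every subset of $N$ of size $m$ containing it. Then $T_s$ is a complete theory and is an axiomatisation of $\mathrm{Th}(M_s)$.
   Context: The structure $M$. An $R$-structure is a set with a symmetric ternary relation $R$ holding only of triples of pairwise distinct elements. For finite $A$, $d_0(A)=|A|-r(A)$ where $r(A)$ is the number of three-element subsets $\{x,y,z\}\subseteq A$ with $R(x,y,z)$. For finite $A\subseteq N$, $A\leqslant N$ means $d_0(B)\ge d_0(A)$ for all finite $B$ with $A\subseteq B\subseteq N$. $\mathcal{C}$ is the class of finite $R$-structures $A$ with $\emptyset\leqslant A$. $M$ is the unique (up to isomorphism) countable $R$-structure all of whose finite substructures lie in $\mathcal{C}$ and such that whenever $A\leqslant M$ is finite and $A\leqslant B\in\mathcal{C}$ there is an embedding $f:B\to M$ over $A$ with $f(B)\leqslant M$. $S$-structures. An $S$-structure is a set $A$ with a family $C(A)$ of subsets of $A$ of size $\ge 3$ (declared maximal cliques) and a function $\mathfrak{m}_A:C(A)\to\{1,2,3\}$ (pre-multiplicity) which is valid: putting $m_A(X)=\sum_{C\in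 C(A),X\subseteq C}\mathfrak{m}_A(C)$ for $X\subseteq A$ with $|X|\ge3$ (and $m_A(X)=0$ if $|X|<3$), one has $m_A(X)\le 1+\frac{2}{|X|-2}$ whenever $|X|\ge 3$. $m_A$ is the multiplicity function of $A$; a finite $S$-structure is determined by it. A subset $A'\subseteq A$ carries the induced structure $C(A')=\{C\cap A':C\in C(A),|C\cap A'|\ge3\}$, $\mathfrak{m}_{A'}(D)=\sum_{C\in C(A),C\cap A'=D}\mathfrak{m}_A(C)$ (equivalently, for finite structures, the multiplicity function is restricted). An embedding is an injection that is an isomorphism onto the induced structure on its image. For finite $A$, $d_{0s}(A)=|A|-\sum_{C\in C(A)}\mathfrak{m}_A(C)(|C|-2)$. For a finite substructure $A\subseteq N$, $A\leqslant_s N$ ("strong") means $d_{0s}(D)\ge d_{0s}(A)$ for every finite $D$ with $A\subseteq D\subseteq N$. $\mathcal{C}_s$ denotes the age of $M_s$, which is the class of all finite $S$-structures $A$ with $\emptyset\leqslant_s A$. $F_n$ is the $S$-structure with $n$ points and $C(F_n)=\emptyset$. $M_s$ is the $S$-structure with universe $M$, $C(M_s)$ the family of sets $\{c\in M:R(c,x,y)\}$ ($x\ne y$ in $M$) with at least $3$ elements, and $\mathfrak{m}(C)$ the number of unordered pairs $\{x,y\}$ with $C=\{c:R(c,x,y)\}$. Language. First-order formulas may use the relation $S$ (where $S(x_1,x_2,x_3)$ holds iff $x_1,x_2,x_3$ are distinct and $m(\{x_1,x_2,x_3\})\ge1$) and the multiplicity function on finite sets; concretely, one has, for every $n\ge 3$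 and $k\in\{0,1,2,3\}$, an $n$-ary predicate expressing that $x_1,\dots,x_n$ are distinct and $m(\{x_1,\dots,x_n\})=k$. In $M_s$ these predicates are definable from $S$ alone. Finite structures in this language arising from an $S$-structure are identified with that (unique) $S$-structure, and $\mathrm{Th}(M_s)$ is the complete theory of $M_s$ in this language. *)

theory Defs
  imports Complex_Main "HOL-Library.Countable_Set" "HOL-Library.Infinite_Typeclass"
begin

section \<open>\<open>R\<close>-structures and the generic structure\<close>

record 'a rstruct =
  rpts :: "'a set"
  rrel :: "'a \<Rightarrow> 'a \<Rightarrow> 'a \<Rightarrow> bool"

definition rstructure :: "'a rstruct \<Rightarrow> bool" where
  "rstructure A \<longleftrightarrow>
     (\<forall>x y z. rrel A x y z \<longrightarrow>
        x \<in> rpts A \<and> y \<in> rpts A \<and> z \<in> rpts A \<and> x \<noteq> y \<and> x \<noteq> z \<and> y \<noteq> z \<and>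
        rrel A y x z \<and> rrel A x z y)"

definition rinduced :: "'a rstruct \<Rightarrow> 'a set \<Rightarrow> 'a rstruct" where
  "rinduced N A =
     \<lparr>rpts = A, rrel = (\<lambda>x y z. x \<in> A \<and> y \<in> A \<and> z \<in> A \<and> rrel N x y z)\<rparr>"

definition rcount :: "'a rstruct \<Rightarrow> nat" where
  "rcount A = card {{x, y, z} | x y z. x \<in> rpts A \<and> y \<in> rpts A \<and> z \<in> rpts A \<and> rrel A x y z}"

definition d0 :: "'a rstruct \<Rightarrow> int" where
  "d0 A = int (card (rpts A)) - int (rcount A)"

definition rstrong :: "'a set \<Rightarrow> 'a rstruct \<Rightarrow> bool" where
  "rstrong A N \<longleftrightarrow> finite A \<and> A \<subseteq> rpts N \<and>
     (\<forall>B. finite B \<and> A \<subseteq> B \<and> B \<subseteq> rpts N \<longrightarrow> d0 (rinduced N B) \<ge> d0 (rinduced N A))"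

definition rclass :: "'a rstruct set" where
  "rclass = {A. rstructure A \<and> finite (rpts A) \<and> rstrong {} A}"

definition rembedding :: "('a \<Rightarrow> 'b) \<Rightarrow> 'a rstruct \<Rightarrow> 'b rstruct \<Rightarrow> bool" where
  "rembedding f A N \<longleftrightarrow> inj_on f (rpts A) \<and> f ` rpts A \<subseteq> rpts N \<and>
     (\<forall>x\<in>rpts A. \<forall>y\<in>rpts A. \<forall>z\<in>rpts A. rrel A x y z \<longleftrightarrow> rrel N (f x) (f y) (f z))"

text \<open>The type of points is required to be infinite so that every finite extension of a finite
  substructure has, up to isomorphism over that substructure, a copy on this type; over a finite
  type the extension property would be too weak.\<close>

definition generic_rstructure :: "'a::infinite rstruct \<Rightarrow> bool" where
  "generic_rstructure M \<longleftrightarrow>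
     rstructure M \<and> countable (rpts M) \<and>
     (\<forall>A. finite A \<and> A \<subseteq> rpts M \<longrightarrow> rinduced M A \<in> rclass) \<and>
     (\<forall>A B. rstrong A M \<and> B \<in> rclass \<and> rstrong A B \<and> rinduced B A = rinduced M A \<longrightarrow>
        (\<exists>f. rembedding f B M \<and> (\<forall>a\<in>A. f a = a) \<and> rstrong (f ` rpts B) M))"


section \<open>\<open>S\<close>-structures\<close>

text \<open>The values of \<open>premult\<close> outside \<open>cliques\<close> are irrelevant.\<close>

record 'a sstruct =
  spts :: "'a set"
  cliques :: "'a set set"
  premult :: "'a set \<Rightarrow> nat"

text \<open>Cliques may be infinite, and \<open>card\<close> is 0 on infinite sets.\<close>

definition at_least_3 :: "'a set \<Rightarrow> bool" where
  "at_least_3 X \<longleftrightarrow> infinite X \<or> 3 \<le> card X"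

definition mult :: "'a sstruct \<Rightarrow> 'a set \<Rightarrow> nat" where
  "mult A X = (if at_least_3 X then \<Sum>C | C \<in> cliques A \<and> X \<subseteq> C. premult A C else 0)"

text \<open>The finiteness clause says that the sum defining the multiplicity is a genuine one. The bound
  is stated for finite \<open>X\<close>; for infinite \<open>X\<close> the corresponding bound 1 follows from it,
  applied to a subset of \<open>X\<close> with five elements.\<close>

definition sstructure :: "'a sstruct \<Rightarrow> bool" where
  "sstructure A \<longleftrightarrow>
     (\<forall>C\<in>cliques A. C \<subseteq> spts A \<and> at_least_3 C \<and> premult A C \<in> {1, 2, 3}) \<and>
     (\<forall>X. X \<subseteq> spts A \<and> finite X \<and> 3 \<le> card X \<longrightarrow>
        finite {C \<in> cliques A. X \<subseteq> C} \<and>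
        real (mult A X) \<le> 1 + 2 / (real (card X) - 2))"

definition sinduced :: "'a sstruct \<Rightarrow> 'a set \<Rightarrow> 'a sstruct" where
  "sinduced N A =
     \<lparr>spts = A,
      cliques = {C \<inter> A | C. C \<in> cliques N \<and> at_least_3 (C \<inter> A)},
      premult = (\<lambda>D. \<Sum>C | C \<in> cliques N \<and> C \<inter> A = D. premult N C)\<rparr>"

definition siso :: "('a \<Rightarrow> 'b) \<Rightarrow> 'a sstruct \<Rightarrow> 'b sstruct \<Rightarrow> bool" where
  "siso f A B \<longleftrightarrow> bij_betw f (spts A) (spts B) \<and>
     (\<lambda>C. f ` C) ` cliques A = cliques B \<and>
     (\<forall>C\<in>cliques A. premult B (f ` C) = premult A C)"

definition sembedding :: "('a \<Rightarrow> 'b) \<Rightarrow> 'a sstruct \<Rightarrow> 'b sstruct \<Rightarrow> bool" where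
  "sembedding f A N \<longleftrightarrow> inj_on f (spts A) \<and> f ` spts A \<subseteq> spts N \<and>
     siso f A (sinduced N (f ` spts A))"

definition d0s :: "'a sstruct \<Rightarrow> int" where
  "d0s A = int (card (spts A)) - (\<Sum>C\<in>cliques A. int (premult A C) * (int (card C) - 2))"

definition sstrong :: "'a set \<Rightarrow> 'a sstruct \<Rightarrow> bool" where
  "sstrong A N \<longleftrightarrow> finite A \<and> A \<subseteq> spts N \<and>
     (\<forall>D. finite D \<and> A \<subseteq> D \<and> D \<subseteq> spts N \<longrightarrow> d0s (sinduced N D) \<ge> d0s (sinduced N A))"

text \<open>The age of \<open>N\<close>, restricted to structures with points in a given type.\<close>

definition age :: "'b sstruct \<Rightarrow> 'a sstruct set" where
  "age N = {A. sstructure A \<and> finite (spts A) \<and> (\<exists>f. sembedding f A N)}"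

definition F_struct :: "nat \<Rightarrow> nat sstruct" where
  "F_struct n = \<lparr>spts = {..<n}, cliques = {}, premult = (\<lambda>_. 0)\<rparr>"

definition common_nbrs :: "'a rstruct \<Rightarrow> 'a \<Rightarrow> 'a \<Rightarrow> 'a set" where
  "common_nbrs M x y = {c \<in> rpts M. rrel M c x y}"

definition s_reduct :: "'a rstruct \<Rightarrow> 'a sstruct" where
  "s_reduct M =
     \<lparr>spts = rpts M,
      cliques = {common_nbrs M x y | x y. x \<in> rpts M \<and> y \<in> rpts M \<and> x \<noteq> y \<and>
                   at_least_3 (common_nbrs M x y)},
      premult = (\<lambda>C. card {{x, y} | x y. x \<in> rpts M \<and> y \<in> rpts M \<and> x \<noteq> y \<and>
                              C = common_nbrs M x y})\<rparr>"


section \<open>First-order logic for the language of multiplicities\<close>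

datatype sym = S | Mult nat nat

fun arity :: "sym \<Rightarrow> nat" where
  "arity S = 3"
| "arity (Mult n k) = n"

definition language :: "sym set" where
  "language = {S} \<union> {Mult n k | n k. 3 \<le> n \<and> k \<le> 3}"

datatype fm =
    Eq nat nat
  | Rel sym "nat list"
  | Neg fm
  | Conj fm fm
  | Ex nat fm

fun wf_fm :: "fm \<Rightarrow> bool" where
  "wf_fm (Eq x y) = True"
| "wf_fm (Rel s xs) = (s \<in> language \<and> length xs = arity s)"
| "wf_fm (Neg \<phi>) = wf_fm \<phi>"
| "wf_fm (Conj \<phi> \<psi>) = (wf_fm \<phi> \<and> wf_fm \<psi>)"
| "wf_fm (Ex x \<phi>) = wf_fm \<phi>"

fun free_vars :: "fm \<Rightarrow> nat set" where
  "free_vars (Eq x y) = {x, y}"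
| "free_vars (Rel s xs) = set xs"
| "free_vars (Neg \<phi>) = free_vars \<phi>"
| "free_vars (Conj \<phi> \<psi>) = free_vars \<phi> \<union> free_vars \<psi>"
| "free_vars (Ex x \<phi>) = free_vars \<phi> - {x}"

definition sentence :: "fm \<Rightarrow> bool" where
  "sentence \<phi> \<longleftrightarrow> wf_fm \<phi> \<and> free_vars \<phi> = {}"

record 'a lstruct =
  lpts :: "'a set"
  linterp :: "sym \<Rightarrow> 'a list \<Rightarrow> bool"

fun sat :: "'a lstruct \<Rightarrow> (nat \<Rightarrow> 'a) \<Rightarrow> fm \<Rightarrow> bool" where
  "sat N v (Eq x y) = (v x = v y)"
| "sat N v (Rel s xs) = linterp N s (map v xs)"
| "sat N v (Neg \<phi>) = (\<not> sat N v \<phi>)"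
| "sat N v (Conj \<phi> \<psi>) = (sat N v \<phi> \<and> sat N v \<psi>)"
| "sat N v (Ex x \<phi>) = (\<exists>a\<in>lpts N. sat N (v(x := a)) \<phi>)"

text \<open>Structures in the sense of first-order logic have a nonempty universe.\<close>

definition holds :: "'a lstruct \<Rightarrow> fm \<Rightarrow> bool" where
  "holds N \<phi> \<longleftrightarrow> (\<forall>v. range v \<subseteq> lpts N \<longrightarrow> sat N v \<phi>)"

definition is_model :: "'a lstruct \<Rightarrow> fm set \<Rightarrow> bool" where
  "is_model N T \<longleftrightarrow> lpts N \<noteq> {} \<and> (\<forall>\<phi>\<in>T. holds N \<phi>)"

definition Th :: "'a lstruct \<Rightarrow> fm set" where
  "Th N = {\<phi>. sentence \<phi> \<and> holds N \<phi>}"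

text \<open>The consequences of \<open>T\<close>, evaluated in the structures whose universe is a subset of
  an infinite type. As the language is countable, by Loewenheim-Skolem it makes no difference
  which infinite type is used.\<close>

definition consequences :: "'a::infinite itself \<Rightarrow> fm set \<Rightarrow> fm set" where
  "consequences _ T =
     {\<phi>. sentence \<phi> \<and> (\<forall>N::'a lstruct. is_model N T \<longrightarrow> holds N \<phi>)}"

definition complete_theory :: "'a::infinite itself \<Rightarrow> fm set \<Rightarrow> bool" where
  "complete_theory t T \<longleftrightarrow>
     (\<forall>\<phi>\<in>T. sentence \<phi>) \<and>
     (\<exists>N::'a lstruct. is_model N T) \<and>
     (\<forall>\<phi>. sentence \<phi> \<longrightarrow> \<phi> \<in> consequences t T \<or> Neg \<phi> \<in> consequences t T)"

text \<open>\<open>T\<close> is a first-order theory stating the property \<open>Q\<close> of structures.\<close>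

definition theory_stating :: "('a::infinite lstruct \<Rightarrow> bool) \<Rightarrow> fm set \<Rightarrow> bool" where
  "theory_stating Q T \<longleftrightarrow>
     (\<forall>\<phi>\<in>T. sentence \<phi>) \<and> (\<forall>N. lpts N \<noteq> {} \<longrightarrow> (is_model N T \<longleftrightarrow> Q N))"

definition linduced :: "'a lstruct \<Rightarrow> 'a set \<Rightarrow> 'a lstruct" where
  "linduced N A = \<lparr>lpts = A, linterp = linterp N\<rparr>"

text \<open>Only the symbols of the language, applied to tuples of the right length from the universe,
  matter.\<close>

definition lembedding :: "('a \<Rightarrow> 'b) \<Rightarrow> 'a lstruct \<Rightarrow> 'b lstruct \<Rightarrow> bool" where
  "lembedding f A N \<longleftrightarrow> inj_on f (lpts A) \<and> f ` lpts A \<subseteq> lpts N \<and>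
     (\<forall>s\<in>language. \<forall>xs. set xs \<subseteq> lpts A \<and> length xs = arity s \<longrightarrow>
        (linterp A s xs \<longleftrightarrow> linterp N s (map f xs)))"

definition liso :: "('a \<Rightarrow> 'b) \<Rightarrow> 'a lstruct \<Rightarrow> 'b lstruct \<Rightarrow> bool" where
  "liso f A B \<longleftrightarrow> lembedding f A B \<and> f ` lpts A = lpts B"

text \<open>The structure in the language of multiplicities arising from an \<open>S\<close>-structure.\<close>

definition lstruct_of :: "'a sstruct \<Rightarrow> 'a lstruct" where
  "lstruct_of A =
     \<lparr>lpts = spts A,
      linterp = (\<lambda>s xs. length xs = arity s \<and> distinct xs \<and>
        (case s of S \<Rightarrow> mult A (set xs) \<ge> 1 | Mult n k \<Rightarrow> mult A (set xs) = k))\<rparr>"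


section \<open>The axioms\<close>

text \<open>In the following, \<open>Cs\<close> is the class of finite \<open>S\<close>-structures \<open>\<C>\<^sub>s\<close>. A finite subset of
  \<open>N\<close> is identified with an \<open>S\<close>-structure when the identity is an isomorphism of the structures
  in the language of multiplicities.\<close>

definition axiom1 :: "'a sstruct set \<Rightarrow> 'a::infinite lstruct \<Rightarrow> bool" where
  "axiom1 Cs N \<longleftrightarrow>
     (\<forall>A. finite A \<and> A \<subseteq> lpts N \<longrightarrow> (\<exists>B\<in>Cs. \<exists>f. liso f (lstruct_of B) (linduced N A))) \<and>
     (\<forall>B\<in>Cs. \<exists>A f. finite A \<and> A \<subseteq> lpts N \<and> liso f (lstruct_of B) (linduced N A))"

definition axiom2 :: "'a sstruct set \<Rightarrow> 'a::infinite lstruct \<Rightarrow> bool" where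
  "axiom2 Cs N \<longleftrightarrow>
     (\<forall>A B. finite A \<and> A \<subseteq> lpts N \<and> B \<in> Cs \<and> A \<subseteq> spts B \<and>
        liso id (lstruct_of (sinduced B A)) (linduced N A) \<and> sstrong A B \<longrightarrow>
        (\<exists>f. lembedding f (lstruct_of B) N \<and> (\<forall>a\<in>A. f a = a)))"

definition axiom3 :: "'a::infinite lstruct \<Rightarrow> bool" where
  "axiom3 N \<longleftrightarrow>
     (\<forall>n m. \<exists>f. lembedding f (lstruct_of (F_struct n)) N \<and>
        (\<forall>D. finite D \<and> card D = m \<and> f ` spts (F_struct n) \<subseteq> D \<and> D \<subseteq> lpts N \<longrightarrow>
           (\<exists>E. sstructure E \<and> spts E = D \<and> liso id (lstruct_of E) (linduced N D) \<and>
                sstrong (f ` spts (F_struct n)) E)))"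

end

theory Submission
  imports Defs
begin

text \<open>The theorem combines three facts.

  \<^item> \<^emph>\<open>The axioms are first-order.\<close> Each of them quantifies over tuples and speaks about such
  a tuple only through finitely many atomic formulas. A property that depends only on the truth
  values of finitely many atomic formulas is a finite disjunction of complete descriptions, hence
  definable (\<open>definable_determined\<close>), and no formula has to be written down
  (\<open>theory_axioms\<close>).

  \<^item> \<^emph>\<open>The reduct is a model.\<close> In a generic structure, Hall's theorem charges every relation to one
  of its points, no point being charged twice. A pair with \<open>d\<close> common neighbours in a finite set
  \<open>D\<close> then charges at least \<open>d - 2\<close> of them, so that the sum of these excesses is at most \<open>|D|\<close>
  (\<open>sum_excess_le\<close>). This inequality gives the validity of the multiplicities, \<open>\<emptyset> \<le>\<^sub>s D\<close> and the
  third axiom. For the second axiom let \<open>A \<le>\<^sub>s B\<close> with \<open>A\<close> in the reduct, and let \<open>A'\<close> be a finite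
  \<open>R\<close>-strong set containing \<open>A\<close>. The pairs responsible for the cliques of \<open>A\<close> lie in \<open>A'\<close>; they
  are matched with the cliques of \<open>B\<close> that meet \<open>A\<close> in at least three points, and every other
  clique of \<open>B\<close> receives a new pair. The resulting \<open>R\<close>-structure \<open>W\<close> on \<open>A'\<close>, \<open>B - A\<close> and the new
  pairs satisfies \<open>A' \<le> W\<close> because \<open>A \<le>\<^sub>s B\<close>, so \<open>W\<close> embeds strongly into the generic structure
  over \<open>A'\<close>, and \<open>B\<close> with it (\<open>s_extension\<close>). In particular the age of the reduct consists of the
  finite \<open>S\<close>-structures in which \<open>\<emptyset>\<close> is strong.

  \<^item> \<^emph>\<open>Any two models are elementarily equivalent.\<close> In a saturated model, finite strong sets
  could be extended back and forth. A finite approximation avoids saturation: a set is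
  \<open>m\<close>-strong if no superset with at most \<open>m\<close> points has smaller predimension. Finite sets
  have closures of bounded size (\<open>closure_bounded\<close>), and strong extensions are realised by
  \<open>m\<close>-strong images (\<open>rich_bound_exists\<close>). The latter is an induction on the codimension of \<open>A\<close> in
  \<open>B\<close>. In codimension zero the second axiom suffices, since the image inherits strongness from
  \<open>A\<close>. Otherwise the third axiom provides a point \<open>b\<close> that is free over \<open>A\<close>, and a gadget of
  dimension one (two new points and one clique of pre-multiplicity two) makes \<open>b\<close> interdependent
  with a point of \<open>B\<close> outside the closure of \<open>A\<close>; over \<open>A \<union> {b}\<close> the codimension has dropped. An
  Ehrenfeucht-Fraisse argument then matches truth values, the required strongness growing
  with the quantifiers of the formula (\<open>transfers_exists\<close>).\<close>

section \<open>Finite \<open>S\<close>-structures are determined by their multiplicities\<close>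

lemma at_least_3_finite: "finite X \<Longrightarrow> at_least_3 X \<longleftrightarrow> 3 \<le> card X"
  by (simp add: at_least_3_def)

lemma at_least_3_mono: "at_least_3 X \<Longrightarrow> X \<subseteq> Y \<Longrightarrow> at_least_3 Y"
  unfolding at_least_3_def by (metis card_mono finite_subset le_trans)

lemma finite_between: "finite V \<Longrightarrow> finite {C. X \<subseteq> C \<and> C \<subseteq> V}"
  by (rule finite_subset[of _ "Pow V"]) auto

text \<open>Moebius inversion on the sets with at least three elements: \<open>F X\<close> is the sum over all supersets
  of \<open>X\<close> minus the values at the proper supersets, which are larger.\<close>

lemma upset_sums_determine:
  fixes F G :: "'a set \<Rightarrow> nat"
  assumes "finite V"
    and eq: "\<And>X. X \<subseteq> V \<Longrightarrow> 3 \<le> card X \<Longrightarrow>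
      (\<Sum>C | X \<subseteq> C \<and> C \<subseteq> V. F C) = (\<Sum>C | X \<subseteq> C \<and> C \<subseteq> V. G C)"
    and "X \<subseteq> V" "3 \<le> card X"
  shows "F X = G X"
  using assms(3,4)
proof (induction "card V - card X" arbitrary: X rule: less_induct)
  case less
  have fin: "finite {C. X \<subset> C \<and> C \<subseteq> V}"
    by (rule finite_subset[of _ "Pow V"]) (use \<open>finite V\<close> in auto)
  have "(\<Sum>C | X \<subset> C \<and> C \<subseteq> V. F C) = (\<Sum>C | X \<subset> C \<and> C \<subseteq> V. G C)"
  proof (rule sum.cong)
    fix C assume "C \<in> {C. X \<subset> C \<and> C \<subseteq> V}"
    hence C: "X \<subset> C" "C \<subseteq> V" by auto
    have "card X < card C" "card C \<le> card V"
      using C \<open>finite V\<close> by (meson psubset_card_mono finite_subset card_mono)+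
    thus "F C = G C" using C less.prems by (intro less.hyps) auto
  qed simp
  moreover have "(\<Sum>C | X \<subseteq> C \<and> C \<subseteq> V. H C) = H X + (\<Sum>C | X \<subset> C \<and> C \<subseteq> V. H C)"
    for H :: "'a set \<Rightarrow> nat"
  proof -
    have "{C. X \<subseteq> C \<and> C \<subseteq> V} = insert X {C. X \<subset> C \<and> C \<subseteq> V}" using less.prems by auto
    thus ?thesis using fin by simp
  qed
  ultimately show ?case using eq[OF less.prems] by simp
qed

lemma sstructure_cliqueD:
  assumes "sstructure N" "C \<in> cliques N"
  shows "C \<subseteq> spts N" "at_least_3 C" "1 \<le> premult N C" "premult N C \<le> 3"
proof -
  have "C \<subseteq> spts N \<and> at_least_3 C \<and> premult N C \<in> {1,2,3}"
    using assms unfolding sstructure_def by blast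
  thus "C \<subseteq> spts N" "at_least_3 C" "1 \<le> premult N C" "premult N C \<le> 3" by auto
qed

lemma sstructure_finite_above:
  assumes "sstructure N" "X \<subseteq> spts N" "finite X" "3 \<le> card X"
  shows "finite {C \<in> cliques N. X \<subseteq> C}"
  using assms unfolding sstructure_def by blast

lemma mult_le_3:
  assumes "sstructure N" "X \<subseteq> spts N" "finite X"
  shows "mult N X \<le> 3"
proof (cases "3 \<le> card X")
  case True
  hence "real (mult N X) \<le> 1 + 2 / (real (card X) - 2)"
    using assms unfolding sstructure_def by blast
  also have "\<dots> \<le> 1 + 2 / 1"
    using True by (intro add_left_mono divide_left_mono) auto
  finally show ?thesis by simp
next
  case False
  thus ?thesis using assms by (simp add: mult_def at_least_3_finite)
qed

text \<open>A clique that meets \<open>X\<close> in three points contains one of the finitely many subsets of \<open>X\<close> with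
  three points, and each of these lies on finitely many cliques.\<close>

lemma finite_cliques_meeting:
  assumes "sstructure N" "finite X" "X \<subseteq> spts N"
  shows "finite {C \<in> cliques N. 3 \<le> card (C \<inter> X)}"
proof (rule finite_subset)
  show "{C \<in> cliques N. 3 \<le> card (C \<inter> X)} \<subseteq>
        (\<Union>Z \<in> {Z. Z \<subseteq> X \<and> 3 \<le> card Z}. {C \<in> cliques N. Z \<subseteq> C})" by blast
  show "finite (\<Union>Z \<in> {Z. Z \<subseteq> X \<and> 3 \<le> card Z}. {C \<in> cliques N. Z \<subseteq> C})"
    using assms by (intro finite_UN_I sstructure_finite_above[OF assms(1)])
      (auto intro: finite_subset)
qed

lemma finite_cliques:
  assumes "sstructure N" "finite (spts N)"
  shows "finite (cliques N)"
  using assms sstructure_cliqueD(1)[OF assms(1)] by (meson PowI finite_Pow_iff finite_subset subsetI)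

lemma spts_sinduced [simp]: "spts (sinduced N A) = A"
  by (simp add: sinduced_def)

lemma cliques_sinduced:
  "finite A \<Longrightarrow> cliques (sinduced N A) = (\<lambda>C. C \<inter> A) ` {C \<in> cliques N. 3 \<le> card (C \<inter> A)}"
  by (auto simp: sinduced_def at_least_3_finite)

lemma premult_sinduced:
  assumes "finite A" "3 \<le> card D"
  shows "premult (sinduced N A) D =
    (\<Sum>C | C \<in> {C \<in> cliques N. 3 \<le> card (C \<inter> A)} \<and> C \<inter> A = D. premult N C)"
  using assms by (auto simp: sinduced_def intro!: sum.cong)

text \<open>Summation over the cliques of an induced structure is summation over the cliques of the
  ambient structure, grouped by their traces.\<close>

lemma sum_cliques_sinduced:
  fixes \<phi> :: "'a set \<Rightarrow> int"
  assumes "sstructure N" "finite A" "A \<subseteq> spts N"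
  shows "(\<Sum>D | D \<in> cliques (sinduced N A) \<and> P D. int (premult (sinduced N A) D) * \<phi> D) =
         (\<Sum>C | C \<in> cliques N \<and> 3 \<le> card (C \<inter> A) \<and> P (C \<inter> A). int (premult N C) * \<phi> (C \<inter> A))"
proof -
  let ?S = "{C \<in> cliques N. 3 \<le> card (C \<inter> A) \<and> P (C \<inter> A)}"
  have fin: "finite ?S"
    by (rule finite_subset[OF _ finite_cliques_meeting[OF assms]]) auto
  have img: "{D. D \<in> cliques (sinduced N A) \<and> P D} = (\<lambda>C. C \<inter> A) ` ?S"
    by (auto simp: cliques_sinduced[OF assms(2)])
  have "(\<Sum>C\<in>?S. int (premult N C) * \<phi> (C \<inter> A)) =
        (\<Sum>D\<in>(\<lambda>C. C \<inter> A) ` ?S. \<Sum>C\<in>{C \<in> ?S. C \<inter> A = D}. int (premult N C) * \<phi> (C \<inter> A))"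
    by (rule sum.image_gen[OF fin])
  also have "\<dots> = (\<Sum>D\<in>(\<lambda>C. C \<inter> A) ` ?S. int (premult (sinduced N A) D) * \<phi> D)"
  proof (rule sum.cong[OF refl])
    fix D assume D: "D \<in> (\<lambda>C. C \<inter> A) ` ?S"
    hence 3: "3 \<le> card D" "P D" by auto
    have "{C \<in> ?S. C \<inter> A = D} = {C \<in> {C \<in> cliques N. 3 \<le> card (C \<inter> A)}. C \<inter> A = D}"
      using 3 by auto
    thus "(\<Sum>C\<in>{C \<in> ?S. C \<inter> A = D}. int (premult N C) * \<phi> (C \<inter> A)) =
          int (premult (sinduced N A) D) * \<phi> D"
      by (simp add: premult_sinduced[OF assms(2) 3(1)] sum_distrib_right)
  qed
  finally show ?thesis by (simp add: img)
qed

lemma mult_sinduced: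
  assumes "sstructure N" "finite A" "A \<subseteq> spts N" "X \<subseteq> A"
  shows "mult (sinduced N A) X = mult N X"
proof (cases "3 \<le> card X")
  case True
  have finX: "finite X" using assms finite_subset by blast
  have le: "card X \<le> card (C \<inter> A)" if "X \<subseteq> C" for C
    using assms that by (intro card_mono) auto
  have S: "{C. C \<in> cliques N \<and> 3 \<le> card (C \<inter> A) \<and> X \<subseteq> C \<inter> A} = {C. C \<in> cliques N \<and> X \<subseteq> C}"
  proof (intro Collect_cong conj_cong refl iffI conjI)
    fix C assume "X \<subseteq> C"
    thus "3 \<le> card (C \<inter> A)" using le True by (meson le_trans)
    show "X \<subseteq> C \<inter> A" using \<open>X \<subseteq> C\<close> \<open>X \<subseteq> A\<close> by blast
  qed auto
  have "int (mult (sinduced N A) X) = int (mult N X)"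
    using sum_cliques_sinduced[OF assms(1-3), where P = "\<lambda>D. X \<subseteq> D" and \<phi> = "\<lambda>_. 1"] S True finX
    by (simp add: mult_def at_least_3_finite)
  thus ?thesis by simp
qed (use assms finite_subset[of X A] in \<open>simp add: mult_def at_least_3_finite\<close>)

lemma sstructure_sinduced:
  assumes "sstructure N" "finite A" "A \<subseteq> spts N"
  shows "sstructure (sinduced N A)"
  unfolding sstructure_def
proof (intro conjI ballI allI impI)
  fix D assume D: "D \<in> cliques (sinduced N A)"
  then obtain C where C: "C \<in> cliques N" "D = C \<inter> A" "3 \<le> card D"
    by (auto simp: cliques_sinduced[OF assms(2)])
  show "D \<subseteq> spts (sinduced N A)" "at_least_3 D"
    using C assms by (auto simp: at_least_3_def)
  have finD: "finite D" using C assms by auto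
  have fin: "finite {C \<in> {C \<in> cliques N. 3 \<le> card (C \<inter> A)}. C \<inter> A = D}"
    by (rule finite_subset[OF _ finite_cliques_meeting[OF assms]]) auto
  have "premult N C \<le> premult (sinduced N A) D"
    unfolding premult_sinduced[OF assms(2) C(3)]
    by (rule member_le_sum[OF _ _ fin]) (use C in auto)
  moreover have "premult (sinduced N A) D \<le> mult N D"
    unfolding premult_sinduced[OF assms(2) C(3)] mult_def
    using C assms finD sstructure_finite_above[OF assms(1), of D]
    by (auto simp: at_least_3_finite intro!: sum_mono2)
  moreover have "mult N D \<le> 3" using C assms finD by (intro mult_le_3) auto
  ultimately show "premult (sinduced N A) D \<in> {1,2,3}"
    using sstructure_cliqueD(3)[OF assms(1) C(1)] by auto
next
  fix X assume X: "X \<subseteq> spts (sinduced N A) \<and> finite X \<and> 3 \<le> card X"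
  show "finite {C \<in> cliques (sinduced N A). X \<subseteq> C}"
    using finite_cliques_meeting[OF assms] by (simp add: cliques_sinduced[OF assms(2)])
  have "real (mult N X) \<le> 1 + 2 / (real (card X) - 2)"
    using X assms unfolding sstructure_def by auto
  thus "real (mult (sinduced N A) X) \<le> 1 + 2 / (real (card X) - 2)"
    using X mult_sinduced[OF assms, of X] by simp
qed

text \<open>The pre-multiplicities are recovered from the multiplicities by Moebius inversion, so a bijection
  that preserves multiplicities is an isomorphism.\<close>

lemma siso_of_mult:
  assumes A: "sstructure A" "finite (spts A)" and B: "sstructure B"
    and f: "bij_betw f (spts A) (spts B)"
    and m: "\<And>X. X \<subseteq> spts A \<Longrightarrow> mult B (f ` X) = mult A X"
  shows "siso f A B"
proof -
  define F where "F C = (if C \<in> cliques A then premult A C else 0)" for C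
  define G where "G C = (if f ` C \<in> cliques B then premult B (f ` C) else 0)" for C
  have inj: "inj_on f (spts A)" and img: "f ` spts A = spts B"
    using f by (auto simp: bij_betw_def)
  have finB: "finite (spts B)" using A(2) by (simp flip: img)
  have FG: "F X = G X" if "X \<subseteq> spts A" "3 \<le> card X" for X
  proof (rule upset_sums_determine[OF A(2) _ that])
    fix X assume X: "X \<subseteq> spts A" "3 \<le> card X"
    have fX: "finite X" using X A finite_subset by blast
    have cf: "card (f ` X) = card X" by (rule card_image[OF inj_on_subset[OF inj X(1)]])
    have up: "{D. f ` X \<subseteq> D \<and> D \<subseteq> spts B} = (`) f ` {C. X \<subseteq> C \<and> C \<subseteq> spts A}"
    proof (intro equalityI subsetI)
      fix D assume "D \<in> {D. f ` X \<subseteq> D \<and> D \<subseteq> spts B}"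
      hence D: "f ` X \<subseteq> D" "D \<subseteq> f ` spts A" using img by simp_all
      have "D = f ` {x \<in> spts A. f x \<in> D}" using D(2) by blast
      moreover have "X \<subseteq> {x \<in> spts A. f x \<in> D}" using D(1) X(1) by blast
      ultimately show "D \<in> (`) f ` {C. X \<subseteq> C \<and> C \<subseteq> spts A}" by blast
    next
      fix D assume "D \<in> (`) f ` {C. X \<subseteq> C \<and> C \<subseteq> spts A}"
      then obtain C where "X \<subseteq> C" "C \<subseteq> spts A" "D = f ` C" by blast
      thus "D \<in> {D. f ` X \<subseteq> D \<and> D \<subseteq> spts B}" unfolding img[symmetric] by blast
    qed
    have "(\<Sum>C | X \<subseteq> C \<and> C \<subseteq> spts A. F C) = (\<Sum>C | C \<in> cliques A \<and> X \<subseteq> C. premult A C)"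
      using sstructure_cliqueD(1)[OF A(1)] finite_between[OF A(2)]
      by (intro sum.mono_neutral_cong_right) (auto simp: F_def)
    also have "\<dots> = mult A X" using X fX by (simp add: mult_def at_least_3_finite)
    also have "\<dots> = mult B (f ` X)" using m X by simp
    also have "\<dots> = (\<Sum>C | C \<in> cliques B \<and> f ` X \<subseteq> C. premult B C)"
      using X fX cf by (simp add: mult_def at_least_3_finite)
    also have "\<dots> = (\<Sum>D | f ` X \<subseteq> D \<and> D \<subseteq> spts B. if D \<in> cliques B then premult B D else 0)"
      using sstructure_cliqueD(1)[OF B(1)] finite_between[OF finB]
      by (intro sum.mono_neutral_cong_left) auto
    also have "\<dots> = (\<Sum>C | X \<subseteq> C \<and> C \<subseteq> spts A. G C)"
      unfolding up
    proof (subst sum.reindex)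
      show "inj_on ((`) f) {C. X \<subseteq> C \<and> C \<subseteq> spts A}"
        using inj_on_image_eq_iff[OF inj] by (intro inj_onI) blast
    qed (simp add: G_def)
    finally show "(\<Sum>C | X \<subseteq> C \<and> C \<subseteq> spts A. F C) = (\<Sum>C | X \<subseteq> C \<and> C \<subseteq> spts A. G C)" .
  qed
  have one: "f ` C \<in> cliques B \<and> premult B (f ` C) = premult A C" if "C \<in> cliques A" for C
  proof -
    note C = sstructure_cliqueD[OF A(1) that]
    have "finite C" using C(1) A(2) by (rule finite_subset)
    hence "3 \<le> card C" using C(2) by (simp add: at_least_3_finite)
    hence "F C = G C" using C(1) FG by blast
    thus ?thesis using that C(3) by (simp add: F_def G_def split: if_splits)
  qed
  moreover have "D \<in> (`) f ` cliques A" if "D \<in> cliques B" for D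
  proof -
    note D = sstructure_cliqueD[OF B that]
    have "finite D" using D(1) finB by (rule finite_subset)
    hence 3: "3 \<le> card D" using D(2) by (simp add: at_least_3_finite)
    obtain C where C: "C \<subseteq> spts A" "D = f ` C" using D(1) img by (metis subset_imageE)
    have "card C = card D" using C inj by (metis card_image inj_on_subset)
    hence "F C = G C" using C(1) FG 3 by simp
    hence "C \<in> cliques A" using C(2) D(3) that by (simp add: F_def G_def split: if_splits)
    thus ?thesis using C by blast
  qed
  ultimately show ?thesis using f unfolding siso_def by blast
qed

lemma siso_d0s:
  assumes "siso f A B" "sstructure A"
  shows "d0s B = d0s A"
proof -
  have inj: "inj_on f (spts A)" using assms by (simp add: siso_def bij_betw_def)
  have sub: "C \<subseteq> spts A" if "C \<in> cliques A" for C
    using sstructure_cliqueD(1)[OF assms(2) that] .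
  have injc: "inj_on ((`) f) (cliques A)"
    using sub inj_on_image_eq_iff[OF inj] by (auto simp: inj_on_def)
  have "(\<Sum>C\<in>cliques B. int (premult B C) * (int (card C) - 2)) =
        (\<Sum>C\<in>(`) f ` cliques A. int (premult B C) * (int (card C) - 2))"
    using assms(1) by (simp add: siso_def)
  also have "\<dots> = (\<Sum>C\<in>cliques A. int (premult B (f ` C)) * (int (card (f ` C)) - 2))"
    using sum.reindex[OF injc] by simp
  also have "\<dots> = (\<Sum>C\<in>cliques A. int (premult A C) * (int (card C) - 2))"
    using assms(1) sub inj
    by (intro sum.cong) (auto simp: siso_def card_image inj_on_subset)
  finally show ?thesis
    using assms(1) by (auto simp: d0s_def siso_def dest: bij_betw_same_card)
qed

lemma siso_mult:
  assumes "siso f A B" "sstructure A" "X \<subseteq> spts A"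
  shows "mult B (f ` X) = mult A X"
proof -
  have inj: "inj_on f (spts A)" using assms by (simp add: siso_def bij_betw_def)
  have sub: "C \<subseteq> spts A" if "C \<in> cliques A" for C
    using sstructure_cliqueD(1)[OF assms(2) that] .
  have injc: "inj_on ((`) f) (cliques A)"
    using sub inj_on_image_eq_iff[OF inj] by (auto simp: inj_on_def)
  have al: "at_least_3 (f ` X) = at_least_3 X"
    using assms(3) inj unfolding at_least_3_def
    by (metis card_image finite_image_iff inj_on_subset)
  have cB: "cliques B = (`) f ` cliques A" using assms(1) by (simp add: siso_def)
  have "{C. C \<in> cliques B \<and> f ` X \<subseteq> C} = (`) f ` {C. C \<in> cliques A \<and> X \<subseteq> C}"
      proof -
    have "f ` X \<subseteq> f ` C \<longleftrightarrow> X \<subseteq> C" if "C \<in> cliques A" for C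
      using inj_on_image_mem_iff[OF inj] sub[OF that] assms(3) by blast
    thus ?thesis unfolding cB by auto
  qed
  moreover have "inj_on ((`) f) {C. C \<in> cliques A \<and> X \<subseteq> C}"
    by (rule inj_on_subset[OF injc]) auto
  ultimately have "(\<Sum>C | C \<in> cliques B \<and> f ` X \<subseteq> C. premult B C) =
      (\<Sum>C | C \<in> cliques A \<and> X \<subseteq> C. premult B (f ` C))"
    by (simp add: sum.reindex)
  also have "\<dots> = (\<Sum>C | C \<in> cliques A \<and> X \<subseteq> C. premult A C)"
    using assms(1) by (intro sum.cong) (auto simp: siso_def)
  finally show ?thesis by (simp add: mult_def al)
qed


section \<open>The predimension of finite subsets\<close>

abbreviation pdim :: "'a sstruct \<Rightarrow> 'a set \<Rightarrow> int" where
  "pdim N X \<equiv> d0s (sinduced N X)"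

lemma pdim_cong_mult:
  assumes "sstructure N" "sstructure N'" "X \<subseteq> spts N" "finite X" "inj_on f X" "f ` X \<subseteq> spts N'"
    and "\<And>Z. Z \<subseteq> X \<Longrightarrow> mult N' (f ` Z) = mult N Z"
  shows "pdim N' (f ` X) = pdim N X"
proof (rule siso_d0s)
  show "siso f (sinduced N X) (sinduced N' (f ` X))"
    by (rule siso_of_mult)
       (use assms in \<open>auto simp: sstructure_sinduced bij_betw_def mult_sinduced image_mono\<close>)
  show "sstructure (sinduced N X)" using assms by (simp add: sstructure_sinduced)
qed

lemma pdim_sinduced:
  assumes "sstructure N" "finite A" "A \<subseteq> spts N" "X \<subseteq> A"
  shows "pdim (sinduced N A) X = pdim N X"
  using pdim_cong_mult[of N "sinduced N A" X id] assms
  by (auto simp: sstructure_sinduced finite_subset mult_sinduced)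

text \<open>Truncated subtraction makes cliques with at most two points in \<open>X\<close> contribute nothing, so
  that the sum may be extended to any convenient finite set of cliques.\<close>

lemma pdim_eq:
  assumes "sstructure N" "finite V" "V \<subseteq> spts N" "X \<subseteq> V"
  shows "pdim N X = int (card X) -
    (\<Sum>C | C \<in> cliques N \<and> 3 \<le> card (C \<inter> V). int (premult N C * (card (C \<inter> X) - 2)))"
proof -
  have X: "finite X" "X \<subseteq> spts N" using assms finite_subset by auto
  have le: "card (C \<inter> X) \<le> card (C \<inter> V)" for C
    using assms by (intro card_mono) auto
  have "(\<Sum>D | D \<in> cliques (sinduced N X). int (premult (sinduced N X) D) * (int (card D) - 2)) =
    (\<Sum>C | C \<in> cliques N \<and> 3 \<le> card (C \<inter> X). int (premult N C) * (int (card (C \<inter> X)) - 2))"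
    using sum_cliques_sinduced[OF assms(1) X, where P = "\<lambda>_. True" and \<phi> = "\<lambda>D. int (card D) - 2"] by simp
  also have "\<dots> = (\<Sum>C | C \<in> cliques N \<and> 3 \<le> card (C \<inter> V). int (premult N C * (card (C \<inter> X) - 2)))"
    using finite_cliques_meeting[OF assms(1-3)] le
    by (intro sum.mono_neutral_cong_left) (auto simp: of_nat_diff intro: le_trans)
  finally show ?thesis by (simp add: d0s_def)
qed

lemma pdim_empty [simp]: "pdim N {} = 0"
  by (simp add: d0s_def cliques_sinduced)

lemma pdim_le_card:
  assumes "sstructure N" "finite X" "X \<subseteq> spts N"
  shows "pdim N X \<le> int (card X)"
proof -
  have "0 \<le> (\<Sum>C | C \<in> cliques N \<and> 3 \<le> card (C \<inter> X). int (premult N C * (card (C \<inter> X) - 2)))"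
    by (rule sum_nonneg) (rule of_nat_0_le_iff)
  thus ?thesis using pdim_eq[OF assms subset_refl] by linarith
qed

text \<open>Convexity of truncated subtraction is what makes the predimension submodular.\<close>

lemma trunc_convex:
  fixes a b u i :: nat
  assumes "u + i = a + b" "i \<le> a" "i \<le> b"
  shows "(a - 2) + (b - 2) \<le> (u - 2) + (i - 2)"
  using assms by arith

lemma pdim_submodular:
  assumes "sstructure N" "finite A" "finite B" "A \<subseteq> spts N" "B \<subseteq> spts N"
  shows "pdim N (A \<union> B) + pdim N (A \<inter> B) \<le> pdim N A + pdim N B"
proof -
  let ?V = "A \<union> B" 
  let ?S = "{C. C \<in> cliques N \<and> 3 \<le> card (C \<inter> ?V)}"
  let ?l = "\<lambda>X. \<Sum>C\<in>?S. int (premult N C * (card (C \<inter> X) - 2))"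
  have V: "finite ?V" "?V \<subseteq> spts N" using assms by auto
  note eq = pdim_eq[OF assms(1) V]
  have "?l A + ?l B \<le> ?l (A \<union> B) + ?l (A \<inter> B)"
    unfolding sum.distrib[symmetric]
  proof (rule sum_mono)
    fix C
    have "card (C \<inter> (A \<union> B)) + card (C \<inter> (A \<inter> B)) = card (C \<inter> A) + card (C \<inter> B)"
      using card_Un_Int[of "C \<inter> A" "C \<inter> B"] assms
      by (simp add: Int_Un_distrib Int_assoc Int_left_commute Int_commute)
    moreover have "card (C \<inter> (A \<inter> B)) \<le> card (C \<inter> A)" "card (C \<inter> (A \<inter> B)) \<le> card (C \<inter> B)"
      using assms by (auto intro!: card_mono)
    ultimately have "(card (C \<inter> A) - 2) + (card (C \<inter> B) - 2)
        \<le> (card (C \<inter> (A \<union> B)) - 2) + (card (C \<inter> (A \<inter> B)) - 2)"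
      by (rule trunc_convex)
    hence "premult N C * ((card (C \<inter> A) - 2) + (card (C \<inter> B) - 2))
        \<le> premult N C * ((card (C \<inter> (A \<union> B)) - 2) + (card (C \<inter> (A \<inter> B)) - 2))"
      by (rule mult_le_mono2)
    thus "int (premult N C * (card (C \<inter> A) - 2)) + int (premult N C * (card (C \<inter> B) - 2))
        \<le> int (premult N C * (card (C \<inter> (A \<union> B)) - 2)) + int (premult N C * (card (C \<inter> (A \<inter> B)) - 2))"
      unfolding of_nat_add[symmetric] of_nat_le_iff by (simp add: distrib_left)
  qed
  moreover have "card (A \<union> B) + card (A \<inter> B) = card A + card B"
    using card_Un_Int[OF assms(2,3)] by simp
  moreover have "A \<inter> B \<subseteq> ?V" by blast
  ultimately show ?thesis
    using eq[of A, OF Un_upper1] eq[of B, OF Un_upper2] eq[of ?V, OF subset_refl] eq[of "A \<inter> B"]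
    by linarith
qed

lemma sstrong_iff:
  "sstrong A N \<longleftrightarrow> finite A \<and> A \<subseteq> spts N \<and>
     (\<forall>D. finite D \<and> A \<subseteq> D \<and> D \<subseteq> spts N \<longrightarrow> pdim N D \<ge> pdim N A)"
  by (simp add: sstrong_def)

text \<open>Sets over \<open>B\<close> of dimension at most \<open>d B\<close> may be united one at a time: the intersection of the
  union so far with the next set contains \<open>B\<close>, so its dimension is at least \<open>d B\<close>, and submodularity
  bounds the dimension of the new union.\<close>

lemma submodular_union_le:
  fixes d :: "'a set \<Rightarrow> int"
  assumes "finite G"
    and submod: "\<And>X Y. X \<subseteq> V \<Longrightarrow> Y \<subseteq> V \<Longrightarrow> d (X \<union> Y) + d (X \<inter> Y) \<le> d X + d Y"
    and "B \<subseteq> V"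
    and D: "\<And>x. x \<in> G \<Longrightarrow> B \<subseteq> D x \<and> D x \<subseteq> V \<and> d (D x) \<le> d B"
    and ge: "\<And>Z. B \<subseteq> Z \<Longrightarrow> Z \<subseteq> B \<union> \<Union>(D ` G) \<Longrightarrow> d B \<le> d Z"
  shows "d (B \<union> \<Union>(D ` G)) \<le> d B"
  using assms(1) D ge
proof (induction G rule: finite_induct)
  case (insert x G)
  let ?U = "B \<union> \<Union>(D ` G)"
  have U: "?U \<subseteq> V" using insert.prems(1) \<open>B \<subseteq> V\<close> by fastforce
  have x: "B \<subseteq> D x" "D x \<subseteq> V" "d (D x) \<le> d B" using insert.prems(1) by blast+
  have "d ?U \<le> d B"
  proof (rule insert.IH)
    fix y assume "y \<in> G" thus "B \<subseteq> D y \<and> D y \<subseteq> V \<and> d (D y) \<le> d B"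
      using insert.prems(1) by blast
  next
    fix Z assume "B \<subseteq> Z" "Z \<subseteq> ?U" thus "d B \<le> d Z" by (intro insert.prems(2)) auto
  qed
  moreover have "d B \<le> d (?U \<inter> D x)"
    by (rule insert.prems(2)) (use x in auto)
  moreover have "d (?U \<union> D x) + d (?U \<inter> D x) \<le> d ?U + d (D x)"
    by (rule submod[OF U x(2)])
  moreover have "B \<union> \<Union>(D ` insert x G) = ?U \<union> D x" by auto
  ultimately show ?case using x(3) by simp
qed simp


section \<open>Embeddings\<close>

lemma lpts_lstruct_of [simp]: "lpts (lstruct_of A) = spts A"
  by (simp add: lstruct_of_def)

lemma lpts_linduced [simp]: "lpts (linduced N X) = X"
  by (simp add: linduced_def)

lemma linterp_linduced [simp]: "linterp (linduced N X) = linterp N"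
  by (simp add: linduced_def)

lemma linterp_Mult_lstruct_of:
  "linterp (lstruct_of A) (Mult n k) xs \<longleftrightarrow> length xs = n \<and> distinct xs \<and> mult A (set xs) = k"
  by (simp add: lstruct_of_def)

lemma linterp_S_lstruct_of:
  "linterp (lstruct_of A) S xs \<longleftrightarrow> length xs = 3 \<and> distinct xs \<and> mult A (set xs) \<ge> 1"
  by (simp add: lstruct_of_def)

lemma lembedding_of_mult:
  assumes "inj_on f (spts A)" "f ` spts A \<subseteq> spts N"
    and m: "\<And>X. X \<subseteq> spts A \<Longrightarrow> finite X \<Longrightarrow> mult N (f ` X) = mult A X"
  shows "lembedding f (lstruct_of A) (lstruct_of N)"
  unfolding lembedding_def
proof (intro conjI ballI allI impI)
  fix s xs assume "s \<in> language" and xs: "set xs \<subseteq> lpts (lstruct_of A) \<and> length xs = arity s"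
  have "distinct (map f xs) = distinct xs"
    using assms(1) xs by (auto simp: distinct_map intro: inj_on_subset)
  moreover have "mult N (set (map f xs)) = mult A (set xs)"
    using m[of "set xs"] xs by simp
  ultimately show "linterp (lstruct_of A) s xs = linterp (lstruct_of N) s (map f xs)"
    by (cases s) (simp_all add: linterp_Mult_lstruct_of linterp_S_lstruct_of)
qed (use assms in auto)

text \<open>Multiplicities are at most three, so the predicates of the language determine them.\<close>

lemma lembedding_mult:
  assumes A: "sstructure A" and f: "lembedding f (lstruct_of A) (lstruct_of N)"
    and X: "X \<subseteq> spts A" "finite X"
  shows "mult N (f ` X) = mult A X"
proof (cases "3 \<le> card X")
  case True
  obtain xs where xs: "set xs = X" "distinct xs" using finite_distinct_list[OF X(2)] by blast
  hence len: "length xs = card X" by (metis distinct_card)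
  let ?s = "Mult (card X) (mult A X)"
  have "?s \<in> language" using True mult_le_3[OF A X] by (auto simp: language_def)
  moreover have "linterp (lstruct_of A) ?s xs" using xs len by (simp add: linterp_Mult_lstruct_of)
  ultimately have "linterp (lstruct_of N) ?s (map f xs)"
    using f xs len X unfolding lembedding_def by auto
  thus ?thesis using xs by (simp add: linterp_Mult_lstruct_of)
next
  case False
  have "inj_on f X" using f X unfolding lembedding_def by (auto intro: inj_on_subset)
  thus ?thesis using False X by (simp add: mult_def at_least_3_finite card_image)
qed

lemma lembedding_inj: "lembedding f A N \<Longrightarrow> inj_on f (lpts A)"
  and lembedding_into: "lembedding f A N \<Longrightarrow> f ` lpts A \<subseteq> lpts N"
  by (simp_all add: lembedding_def)

lemma lembedding_compose:
  assumes f: "lembedding f A B" and g: "lembedding g B C"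
  shows "lembedding (g \<circ> f) A C"
  unfolding lembedding_def
proof (intro conjI ballI allI impI)
  have fB: "f ` lpts A \<subseteq> lpts B" using f by (rule lembedding_into)
  show "inj_on (g \<circ> f) (lpts A)"
    using lembedding_inj[OF f] lembedding_inj[OF g] fB by (auto intro: comp_inj_on inj_on_subset)
  show "(g \<circ> f) ` lpts A \<subseteq> lpts C"
    using fB lembedding_into[OF g] by auto
  fix s xs assume s: "s \<in> language" and xs: "set xs \<subseteq> lpts A \<and> length xs = arity s"
  have "linterp A s xs = linterp B s (map f xs)" using f s xs unfolding lembedding_def by blast
  also have "\<dots> = linterp C s (map g (map f xs))"
    using g s xs fB unfolding lembedding_def
    by (metis image_mono length_map set_map subset_trans)
  finally show "linterp A s xs = linterp C s (map (g \<circ> f) xs)" by simp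
qed

lemma lembedding_cong:
  assumes "\<And>x. x \<in> lpts A \<Longrightarrow> f x = g x" "lembedding f A N"
  shows "lembedding g A N"
proof -
  have "map f xs = map g xs" if "set xs \<subseteq> lpts A" for xs using that assms(1) by auto
  moreover have "inj_on g (lpts A)" using assms by (metis inj_on_cong lembedding_inj)
  moreover have "g ` lpts A \<subseteq> lpts N" using assms lembedding_into by fastforce
  ultimately show ?thesis using assms(2) unfolding lembedding_def by metis
qed

lemma lembedding_linduced_iff:
  "Z \<subseteq> lpts N \<Longrightarrow> lembedding f A (linduced N Z) \<longleftrightarrow> lembedding f A N \<and> f ` lpts A \<subseteq> Z"
  unfolding lembedding_def by auto

lemma lembedding_inv:
  assumes "lembedding f A N"
  shows "lembedding (inv_into (lpts A) f) (linduced N (f ` lpts A)) A"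
  unfolding lembedding_def
proof (intro conjI ballI allI impI)
  fix s xs assume s: "s \<in> language"
    and xs: "set xs \<subseteq> lpts (linduced N (f ` lpts A)) \<and> length xs = arity s"
  let ?ys = "map (inv_into (lpts A) f) xs"
  have "map f ?ys = xs" using xs by (auto simp: f_inv_into_f intro!: map_idI)
  moreover have "set ?ys \<subseteq> lpts A" using xs by (auto simp: inv_into_into)
  ultimately show "linterp (linduced N (f ` lpts A)) s xs = linterp A s ?ys"
    using assms s xs unfolding lembedding_def by (metis length_map linterp_linduced)
qed (auto simp: inj_on_inv_into inv_into_into)

lemma liso_linduced_iff:
  "X \<subseteq> lpts N \<Longrightarrow> liso f A (linduced N X) \<longleftrightarrow> lembedding f A N \<and> f ` lpts A = X"
  by (auto simp: liso_def lembedding_linduced_iff)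

definition simage :: "('a \<Rightarrow> 'b) \<Rightarrow> 'a sstruct \<Rightarrow> 'b sstruct" where
  "simage e A = \<lparr>spts = e ` spts A, cliques = (`) e ` cliques A,
     premult = (\<lambda>D. premult A (inv_into (spts A) e ` D))\<rparr>"

lemma spts_simage [simp]: "spts (simage e A) = e ` spts A"
  by (simp add: simage_def)

lemma siso_simage:
  assumes "sstructure A" "inj_on e (spts A)"
  shows "siso e A (simage e A)"
proof -
  have "inv_into (spts A) e ` e ` C = C" if "C \<in> cliques A" for C
    using sstructure_cliqueD(1)[OF assms(1) that] assms(2) by (rule inv_into_image_cancel[rotated])
  thus ?thesis using assms by (simp add: siso_def simage_def bij_betw_def)
qed

lemma sstructure_siso:
  assumes f: "siso f A B" and A: "sstructure A"
  shows "sstructure B"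
  unfolding sstructure_def
proof (intro conjI ballI allI impI)
  have inj: "inj_on f (spts A)" and img: "f ` spts A = spts B"
    using f by (auto simp: siso_def bij_betw_def)
  have cB: "cliques B = (`) f ` cliques A" using f by (simp add: siso_def)
  {
    fix D assume "D \<in> cliques B"
    then obtain C where C: "C \<in> cliques A" "D = f ` C" using cB by auto
    note c = sstructure_cliqueD[OF A C(1)]
    show "D \<subseteq> spts B" using C c(1) img by blast
    have injC: "inj_on f C" using inj_on_subset[OF inj c(1)] .
    show "at_least_3 D"
      using c(2) injC C(2) unfolding at_least_3_def
      by (simp add: card_image finite_image_iff)
    have "premult B D = premult A C" using f C unfolding siso_def by blast
    thus "premult B D \<in> {1,2,3}" using c(3,4) by auto
  next
    fix X assume X: "X \<subseteq> spts B \<and> finite X \<and> 3 \<le> card X"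
    then obtain Y where Y: "Y \<subseteq> spts A" "X = f ` Y" using img by (metis subset_imageE)
    have injY: "inj_on f Y" using inj_on_subset[OF inj Y(1)] .
    have Y3: "finite Y" "card Y = card X" using X Y(2) injY
      by (auto simp: card_image finite_image_iff)
    have fin: "finite {C \<in> cliques A. Y \<subseteq> C}"
      using sstructure_finite_above[OF A Y(1)] Y3 X by simp
    have "{D \<in> cliques B. X \<subseteq> D} \<subseteq> (`) f ` {C \<in> cliques A. Y \<subseteq> C}"
    proof
      fix D assume D: "D \<in> {D \<in> cliques B. X \<subseteq> D}"
      then obtain C where C: "C \<in> cliques A" "D = f ` C" using cB by auto
      have "y \<in> C" if "y \<in> Y" for y
        using D C(2) Y that inj_on_image_mem_iff[OF inj _ sstructure_cliqueD(1)[OF A C(1)], of y]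
        by auto
      hence "Y \<subseteq> C" by blast
      thus "D \<in> (`) f ` {C \<in> cliques A. Y \<subseteq> C}" using C by blast
    qed
    thus "finite {D \<in> cliques B. X \<subseteq> D}" using fin finite_surj by blast
    have "real (mult A Y) \<le> 1 + 2 / (real (card Y) - 2)"
      using A Y(1) Y3 X unfolding sstructure_def by auto
    thus "real (mult B X) \<le> 1 + 2 / (real (card X) - 2)"
      using siso_mult[OF f A Y(1)] Y Y3 by simp
  }
qed

lemma sstructure_simage:
  "sstructure A \<Longrightarrow> inj_on e (spts A) \<Longrightarrow> sstructure (simage e A)"
  using siso_simage sstructure_siso by blast

lemma lembedding_simage:
  assumes "sstructure A" "inj_on e (spts A)"
  shows "lembedding e (lstruct_of A) (lstruct_of (simage e A))"
  using siso_mult[OF siso_simage[OF assms] assms(1)] assms(2) by (intro lembedding_of_mult) auto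

lemma pdim_lembedding:
  assumes "sstructure A" "sstructure N" "lembedding f (lstruct_of A) (lstruct_of N)"
    and "X \<subseteq> spts A" "finite X"
  shows "pdim N (f ` X) = pdim A X"
proof (rule pdim_cong_mult)
  show "inj_on f X" using lembedding_inj[OF assms(3)] assms(4) by (auto intro: inj_on_subset)
  show "f ` X \<subseteq> spts N" using lembedding_into[OF assms(3)] assms(4) by auto
  show "mult N (f ` Z) = mult A Z" if "Z \<subseteq> X" for Z
    by (rule lembedding_mult[OF assms(1,3) subset_trans[OF that assms(4)] finite_subset[OF that assms(5)]])
qed (use assms in auto)

lemma lembedding_sinduced:
  assumes "sstructure N" "finite A" "A \<subseteq> spts N"
  shows "lembedding id (lstruct_of (sinduced N A)) (lstruct_of N)"
  using assms by (intro lembedding_of_mult) (auto simp: mult_sinduced)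

lemma sstrong_lembedding:
  assumes "sstructure A" "sstructure N" and f: "lembedding f (lstruct_of A) (lstruct_of N)"
    and onto: "f ` spts A = spts N" and strong: "sstrong X A"
  shows "sstrong (f ` X) N"
proof -
  have inj: "inj_on f (spts A)" using lembedding_inj[OF f] unfolding lpts_lstruct_of .
  have X: "finite X" "X \<subseteq> spts A" using strong unfolding sstrong_def by blast+
  have fX: "finite (f ` X)" using X(1) by (rule finite_imageI)
  have fX': "f ` X \<subseteq> spts N" using image_mono[OF X(2), of f] onto by simp
  have "pdim N (f ` X) \<le> pdim N D" if D: "finite D \<and> f ` X \<subseteq> D \<and> D \<subseteq> spts N" for D
  proof -
    define Y where "Y = {y \<in> spts A. f y \<in> D}"
    have Y: "Y \<subseteq> spts A" unfolding Y_def by blast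
    have fY: "f ` Y = D"
    proof (intro equalityI subsetI)
      fix d assume "d \<in> D"
      hence "d \<in> f ` spts A" using D onto by blast
      thus "d \<in> f ` Y" using \<open>d \<in> D\<close> unfolding Y_def by blast
    qed (auto simp: Y_def)
    have finY: "finite Y"
      by (rule finite_imageD[of f]) (use D fY inj_on_subset[OF inj Y] in simp_all)
    have "X \<subseteq> Y" using D X(2) unfolding Y_def by blast
    hence "pdim A X \<le> pdim A Y" using strong finY Y unfolding sstrong_iff by blast
    thus ?thesis
      using pdim_lembedding[OF assms(1,2) f Y finY] pdim_lembedding[OF assms(1,2) f X(2,1)]
      unfolding fY by linarith
  qed
  thus ?thesis using fX fX' unfolding sstrong_iff by blast
qed

text \<open>This describes \<open>\<C>\<^sub>s\<close> by the predimension alone, on points of any type; it is identified with the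
  age of the reduct in \<open>age_s_reduct\<close>.\<close>

definition sclass :: "'a sstruct set" where
  "sclass = {A. sstructure A \<and> finite (spts A) \<and> sstrong {} A}"

lemma sclass_simage:
  assumes "A \<in> sclass" "inj_on e (spts A)"
  shows "simage e A \<in> sclass"
proof -
  have A: "sstructure A" "finite (spts A)" "sstrong {} A" using assms(1) by (auto simp: sclass_def)
  have "sstructure (simage e A)" using A(1) assms(2) by (rule sstructure_simage)
  moreover from A(1) this lembedding_simage[OF A(1) assms(2)] have "sstrong (e ` {}) (simage e A)"
    by (rule sstrong_lembedding) (use A(3) in auto)
  ultimately show ?thesis using A(2) by (simp add: sclass_def)
qed

section \<open>Systems of distinct representatives\<close>

text \<open>Hall's theorem by the argument of Halmos and Vaughan. If some proper subfamily is tight, it and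
  the remaining sets without its union are treated separately; otherwise
  any representative of any one set may be chosen.\<close>

lemma hall:
  fixes A :: "'i \<Rightarrow> 'a set"
  assumes "finite I" "\<And>i. i \<in> I \<Longrightarrow> finite (A i)"
    and "\<And>J. J \<subseteq> I \<Longrightarrow> card J \<le> card (\<Union>(A ` J))"
  shows "\<exists>h. inj_on h I \<and> (\<forall>i\<in>I. h i \<in> A i)"
  using assms
proof (induction "card I" arbitrary: I A rule: less_induct)
  case less
  note fI = less.prems(1) and fA = less.prems(2) and hc = less.prems(3)
  have fU: "finite (\<Union>(A ` J))" if "J \<subseteq> I" for J
    using that fI fA by (meson finite_UN finite_subset subsetD)
  show ?case
  proof (cases "I = {}")
    case False
    show ?thesis
    proof (cases "\<exists>J. J \<noteq> {} \<and> J \<subset> I \<and> card (\<Union>(A ` J)) = card J")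
      case True
      then obtain J where J: "J \<noteq> {}" "J \<subset> I" "card (\<Union>(A ` J)) = card J" by blast
      let ?U = "\<Union>(A ` J)"
      have fJ: "finite J" using J(2) fI finite_subset by blast
      have cJ: "card J < card I" using J(2) fI by (simp add: psubset_card_mono)
      have cIJ: "card (I - J) < card I"
        by (rule psubset_card_mono[OF fI]) (use J(1,2) in blast)
      have JI: "J \<subseteq> I" using J(2) by blast
      have "\<exists>h. inj_on h J \<and> (\<forall>i\<in>J. h i \<in> A i)"
      proof (rule less.hyps[OF cJ fJ])
        show "finite (A i)" if "i \<in> J" for i using that JI fA by blast
        show "card K \<le> card (\<Union>(A ` K))" if "K \<subseteq> J" for K using that JI hc by blast
      qed
      then obtain h where h: "inj_on h J" "\<And>i. i \<in> J \<Longrightarrow> h i \<in> A i" by blast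
      have "\<exists>g. inj_on g (I - J) \<and> (\<forall>i\<in>I - J. g i \<in> A i - ?U)"
      proof (rule less.hyps[OF cIJ])
        show "finite (I - J)" using fI by simp
        show "finite (A i - ?U)" if "i \<in> I - J" for i using that fA by simp
        fix K assume K: "K \<subseteq> I - J"
        have fK: "finite K" using K fI finite_subset by blast
        have KI: "K \<union> J \<subseteq> I" using K JI by blast
        have "card K + card J = card (K \<union> J)" using K fK fJ by (subst card_Un_disjoint) auto
        also have "\<dots> \<le> card (\<Union>(A ` (K \<union> J)))" using KI by (rule hc)
        also have "\<Union>(A ` (K \<union> J)) = (\<Union>((\<lambda>i. A i - ?U) ` K)) \<union> ?U" by blast
        also have "card \<dots> \<le> card (\<Union>((\<lambda>i. A i - ?U) ` K)) + card ?U" by (rule card_Un_le)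
        finally show "card K \<le> card (\<Union>((\<lambda>i. A i - ?U) ` K))" using J(3) by simp
      qed
      then obtain g where g: "inj_on g (I - J)" "\<And>i. i \<in> I - J \<Longrightarrow> g i \<in> A i - ?U" by blast
      let ?f = "\<lambda>i. if i \<in> J then h i else g i"
      have "inj_on ?f I"
      proof (rule inj_onI)
        fix i j assume ij: "i \<in> I" "j \<in> I" "?f i = ?f j"
        show "i = j"
        proof (cases "i \<in> J"; cases "j \<in> J")
          assume "i \<in> J" "j \<in> J" thus ?thesis using ij h(1) by (auto dest: inj_onD)
        next
          assume a: "i \<in> J" "j \<notin> J"
          hence "h i = g j" "h i \<in> ?U" "g j \<notin> ?U" using ij h(2)[of i] g(2)[of j] by auto
          thus ?thesis by simp
        next
          assume a: "i \<notin> J" "j \<in> J"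
          hence "h j = g i" "h j \<in> ?U" "g i \<notin> ?U" using ij h(2)[of j] g(2)[of i] by auto
          thus ?thesis by simp
        next
          assume "i \<notin> J" "j \<notin> J" thus ?thesis using ij g(1) by (auto dest: inj_onD)
        qed
      qed
      moreover have "\<forall>i\<in>I. ?f i \<in> A i" using h(2) g(2) by auto
      ultimately show ?thesis by blast
    next
      case nt: False
      \<comment> \<open>No proper subfamily is tight, so removing one element keeps the condition.\<close>
      obtain i0 where i0: "i0 \<in> I" using False by blast
      have "card {i0} \<le> card (\<Union>(A ` {i0}))" by (rule hc) (use i0 in simp)
      then obtain x where x: "x \<in> A i0" by fastforce
      have cI: "card (I - {i0}) < card I" using i0 fI by (rule card_Diff1_less[rotated])
      have "\<exists>g. inj_on g (I - {i0}) \<and> (\<forall>i\<in>I - {i0}. g i \<in> A i - {x})"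
      proof (rule less.hyps[OF cI])
        show "finite (I - {i0})" using fI by simp
        show "finite (A i - {x})" if "i \<in> I - {i0}" for i using that fA by simp
        fix K assume K: "K \<subseteq> I - {i0}"
        show "card K \<le> card (\<Union>((\<lambda>i. A i - {x}) ` K))"
        proof (cases "K = {}")
          case ne: False
          have KI: "K \<subset> I" using K i0 by blast
          hence "card (\<Union>(A ` K)) \<noteq> card K" using nt ne by blast
          hence "card K < card (\<Union>(A ` K))" using hc[OF psubset_imp_subset[OF KI]] by linarith
          moreover have "\<Union>((\<lambda>i. A i - {x}) ` K) = \<Union>(A ` K) - {x}" by blast
          moreover have "card (\<Union>(A ` K)) - 1 \<le> card (\<Union>(A ` K) - {x})"
            using diff_card_le_card_Diff[of "{x}" "\<Union>(A ` K)"] by simp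
          ultimately show ?thesis by simp
        qed simp
      qed
      then obtain g where g: "inj_on g (I - {i0})" "\<And>i. i \<in> I - {i0} \<Longrightarrow> g i \<in> A i - {x}" by blast
      have "inj_on (g(i0 := x)) I"
      proof (rule inj_onI)
        fix i j assume ij: "i \<in> I" "j \<in> I" "(g(i0 := x)) i = (g(i0 := x)) j"
        show "i = j"
          using ij g(2)[of i] g(2)[of j] inj_onD[OF g(1), of i j] by (auto split: if_splits)
      qed
      moreover have "\<forall>i\<in>I. (g(i0 := x)) i \<in> A i" using g(2) x by auto
      ultimately show ?thesis by blast
    qed
  qed simp
qed


section \<open>\<open>R\<close>-structures as hypergraphs\<close>

definition triples :: "'a rstruct \<Rightarrow> 'a set set" where
  "triples M = {{x, y, z} | x y z. rrel M x y z}"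

definition pairs :: "'a rstruct \<Rightarrow> 'a set set" where
  "pairs M = {p. p \<subseteq> rpts M \<and> card p = 2}"

definition nb :: "'a rstruct \<Rightarrow> 'a set \<Rightarrow> 'a set" where
  "nb M p = {c. insert c p \<in> triples M}"

definition rdim :: "'a rstruct \<Rightarrow> 'a set \<Rightarrow> int" where
  "rdim M A = int (card A) - int (card {t \<in> triples M. t \<subseteq> A})"

definition hypergraph :: "'a set \<Rightarrow> 'a set set \<Rightarrow> 'a rstruct" where
  "hypergraph V T = \<lparr>rpts = V, rrel = (\<lambda>x y z. {x, y, z} \<in> T)\<rparr>"

lemma tripleD:
  assumes "rstructure M" "t \<in> triples M"
  shows "t \<subseteq> rpts M" "card t = 3"
proof -
  obtain x y z where t: "t = {x,y,z}" "rrel M x y z" using assms(2) unfolding triples_def by blast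
  hence "x \<in> rpts M \<and> y \<in> rpts M \<and> z \<in> rpts M \<and> x \<noteq> y \<and> x \<noteq> z \<and> y \<noteq> z"
    using assms(1) unfolding rstructure_def by blast
  thus "t \<subseteq> rpts M" "card t = 3" using t(1) by auto
qed

text \<open>By symmetry a relation is determined by the set of its points, so that a structure is the
  hypergraph of its triples.\<close>

lemma rrel_iff_triple:
  assumes "rstructure M"
  shows "rrel M x y z \<longleftrightarrow> {x, y, z} \<in> triples M"
proof
  assume "{x,y,z} \<in> triples M"
  then obtain a b c where abc: "{x,y,z} = {a,b,c}" "rrel M a b c" unfolding triples_def by blast
  have sym: "rrel M y x z" "rrel M x z y" if "rrel M x y z" for x y z
    using assms that unfolding rstructure_def by blast+
  have all: "rrel M a b c" "rrel M b a c" "rrel M a c b" "rrel M c a b" "rrel M b c a" "rrel M c b a"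
    using abc(2) sym by blast+
  have "a \<noteq> b" "a \<noteq> c" "b \<noteq> c"
    using abc(2) assms unfolding rstructure_def by blast+
  hence "(x = a \<and> y = b \<and> z = c) \<or> (x = a \<and> y = c \<and> z = b) \<or> (x = b \<and> y = a \<and> z = c) \<or>
    (x = b \<and> y = c \<and> z = a) \<or> (x = c \<and> y = a \<and> z = b) \<or> (x = c \<and> y = b \<and> z = a)"
    using abc(1) by (metis insertCI insertE singletonD)
  thus "rrel M x y z" using all by metis
qed (auto simp: triples_def)

lemma d0_rinduced: "d0 (rinduced M A) = rdim M A"
proof -
  have "{{x, y, z} | x y z. x \<in> A \<and> y \<in> A \<and> z \<in> A \<and> x \<in> A \<and> y \<in> A \<and> z \<in> A \<and> rrel M x y z} =
        {t \<in> triples M. t \<subseteq> A}"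
    unfolding triples_def by blast
  thus ?thesis by (simp add: d0_def rcount_def rinduced_def rdim_def)
qed

lemma rstrong_iff:
  "rstrong A N \<longleftrightarrow> finite A \<and> A \<subseteq> rpts N \<and>
     (\<forall>B. finite B \<and> A \<subseteq> B \<and> B \<subseteq> rpts N \<longrightarrow> rdim N B \<ge> rdim N A)"
  by (simp add: rstrong_def d0_rinduced)

lemma finite_triples_within: "finite A \<Longrightarrow> finite {t \<in> T. t \<subseteq> A}"
  by (rule finite_subset[of _ "Pow A"]) auto

lemma rdim_submodular:
  assumes "finite A" "finite B"
  shows "rdim M (A \<union> B) + rdim M (A \<inter> B) \<le> rdim M A + rdim M B"
proof -
  let ?T = "\<lambda>A. {t \<in> triples M. t \<subseteq> A}"
  have "card (?T A) + card (?T B) = card (?T A \<union> ?T B) + card (?T A \<inter> ?T B)"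
    using assms by (intro card_Un_Int finite_triples_within)
  also have "?T A \<inter> ?T B = ?T (A \<inter> B)" by blast
  also have "card (?T A \<union> ?T B) \<le> card (?T (A \<union> B))"
    using assms by (intro card_mono finite_triples_within) auto
  finally have "card (?T A) + card (?T B) \<le> card (?T (A \<union> B)) + card (?T (A \<inter> B))" by simp
  moreover have "card A + card B = card (A \<union> B) + card (A \<inter> B)" using assms by (rule card_Un_Int)
  ultimately show ?thesis unfolding rdim_def by linarith
qed

lemma rdim_empty: "rstructure M \<Longrightarrow> rdim M {} = 0"
  using tripleD(2)[of M "{}"] by (auto simp: rdim_def)

lemma rpts_hypergraph [simp]: "rpts (hypergraph V T) = V"
  by (simp add: hypergraph_def)

lemma hypergraph_rstructure:
  assumes "\<And>t. t \<in> T \<Longrightarrow> t \<subseteq> V \<and> card t = 3"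
  shows "rstructure (hypergraph V T)" "triples (hypergraph V T) = T"
proof -
  have d: "x \<in> V \<and> y \<in> V \<and> z \<in> V \<and> x \<noteq> y \<and> x \<noteq> z \<and> y \<noteq> z" if "{x,y,z} \<in> T" for x y z
  proof -
    have "card {x,y,z} = 3" "{x,y,z} \<subseteq> V" using assms[OF that] by auto
    thus ?thesis by (auto simp: card_insert_if split: if_splits)
  qed
  have "{y,x,z} = {x,y,z}" "{x,z,y} = {x,y,z}" for x y z :: 'a by auto
  thus "rstructure (hypergraph V T)"
    unfolding rstructure_def hypergraph_def using d by simp blast
  show "triples (hypergraph V T) = T"
  proof (intro equalityI subsetI)
    fix t assume "t \<in> T"
    hence "card t = 3" using assms by blast
    then obtain x y z where "t = {x,y,z}" by (auto simp: card_3_iff)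
    thus "t \<in> triples (hypergraph V T)" using \<open>t \<in> T\<close> by (auto simp: triples_def hypergraph_def)
  qed (auto simp: triples_def hypergraph_def)
qed

lemma rdim_image:
  assumes "inj_on f V" "Y \<subseteq> V"
    and tr: "\<And>t. t \<subseteq> V \<Longrightarrow> f ` t \<in> triples N \<longleftrightarrow> t \<in> triples M"
  shows "rdim N (f ` Y) = rdim M Y"
proof -
  have "{t \<in> triples N. t \<subseteq> f ` Y} = (`) f ` {t \<in> triples M. t \<subseteq> Y}"
  proof (intro equalityI subsetI)
    fix t assume "t \<in> {t \<in> triples N. t \<subseteq> f ` Y}"
    hence t: "t \<in> triples N" "t \<subseteq> f ` Y" by auto
    then obtain s where s: "s \<subseteq> Y" "t = f ` s" by (metis subset_imageE)
    thus "t \<in> (`) f ` {t \<in> triples M. t \<subseteq> Y}" using t(1) tr[of s] assms(2) by auto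
  next
    fix t assume "t \<in> (`) f ` {t \<in> triples M. t \<subseteq> Y}"
    then obtain s where s: "s \<in> triples M" "s \<subseteq> Y" "t = f ` s" by blast
    thus "t \<in> {t \<in> triples N. t \<subseteq> f ` Y}" using tr[of s] assms(2) by auto
  qed
  moreover have "inj_on ((`) f) {t \<in> triples M. t \<subseteq> Y}"
    using inj_on_subset[OF assms(1,2)] by (auto intro!: inj_onI simp: inj_on_image_eq_iff)
  moreover have "card (f ` Y) = card Y"
    by (rule card_image[OF inj_on_subset[OF assms(1,2)]])
  ultimately show ?thesis by (simp add: rdim_def card_image)
qed

lemma nb_not_in_pair:
  assumes "rstructure M" "card p = 2" "c \<in> nb M p"
  shows "c \<notin> p" "c \<in> rpts M"
  using tripleD[OF assms(1), of "insert c p"] assms(2,3) by (auto simp: nb_def insert_absorb)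

lemma inj_insert_nb:
  assumes "rstructure M" "card p = 2"
  shows "inj_on (\<lambda>c. insert c p) (nb M p)"
  using nb_not_in_pair(1)[OF assms] by (auto intro!: inj_onI)

lemma common_nbrs_eq_nb: "rstructure M \<Longrightarrow> common_nbrs M x y = nb M {x, y}"
  using tripleD(1)[of M] by (auto simp: common_nbrs_def nb_def rrel_iff_triple)

text \<open>A pair outside a strong set has at most two common neighbours in it: adding the pair costs
  at most two points and would otherwise create three relations.\<close>

lemma pair_in_strong:
  assumes M: "rstructure M" and V: "rstrong V M" and p: "p \<in> pairs M" and nb: "3 \<le> card (nb M p \<inter> V)"
  shows "p \<subseteq> V"
proof (rule ccontr)
  assume np: "\<not> p \<subseteq> V"
  have fV: "finite V" "V \<subseteq> rpts M" using V by (auto simp: rstrong_def)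
  have p2: "card p = 2" "p \<subseteq> rpts M" using p by (auto simp: pairs_def)
  hence fp: "finite p" by (metis card.infinite zero_neq_numeral)
  let ?N = "(\<lambda>c. insert c p) ` (nb M p \<inter> V)"
  let ?T = "\<lambda>A. {t \<in> triples M. t \<subseteq> A}"
  have "card ?N = card (nb M p \<inter> V)"
    by (rule card_image[OF inj_on_subset[OF inj_insert_nb[OF M p2(1)]]]) auto
  moreover have "card (?T V) + card ?N = card (?T V \<union> ?N)"
    using np fV by (intro card_Un_disjoint[symmetric] finite_triples_within) auto
  moreover have "card (?T V \<union> ?N) \<le> card (?T (V \<union> p))"
    using fV fp by (intro card_mono finite_triples_within) (auto simp: nb_def)
  moreover have "card (V \<union> p) \<le> card V + 2" using card_Un_le[of V p] p2 by simp
  moreover have "rdim M (V \<union> p) \<ge> rdim M V"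
    using V fV fp p2 unfolding rstrong_iff by (metis Un_upper1 finite_UnI le_sup_iff)
  ultimately show False using nb unfolding rdim_def by linarith
qed

text \<open>If \<open>X\<close> is strong and carries no relation, then Hall's condition holds for the sets
  \<open>t - X\<close>, so that every relation can be charged to one of its points outside \<open>X\<close>, no point
  being charged twice. Of the relations of a pair \<open>p\<close> with the points of \<open>D\<close>, at most two are
  charged to a point of \<open>p\<close>; hence the others are charged to points of \<open>D - X\<close>.\<close>

lemma sum_excess_le:
  assumes M: "rstructure M" and X: "rstrong X M" and nt: "\<And>t. t \<in> triples M \<Longrightarrow> \<not> t \<subseteq> X"
    and D: "finite D" and P: "finite P" "P \<subseteq> pairs M"
  shows "(\<Sum>p\<in>P. card (nb M p \<inter> D) - 2) \<le> card (D - X)"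
proof -
  define Ts where "Ts = (\<Union>p\<in>P. (\<lambda>c. insert c p) ` (nb M p \<inter> D))"
  have Ts: "finite Ts" "Ts \<subseteq> triples M"
    using P(1) D unfolding Ts_def by (auto simp: nb_def)
  have fX: "finite X" "X \<subseteq> rpts M" using X by (auto simp: rstrong_def)
  have ft: "finite t" if "t \<in> triples M" for t
    using tripleD(2)[OF M that] by (metis card.infinite zero_neq_numeral)
  have "\<exists>h. inj_on h Ts \<and> (\<forall>t\<in>Ts. h t \<in> t - X)"
  proof (rule hall[OF Ts(1)])
    show "finite (t - X)" if "t \<in> Ts" for t using ft that Ts(2) by auto
    fix J assume J: "J \<subseteq> Ts"
    have fJ: "finite J" using J Ts(1) by (rule finite_subset)
    have JT: "J \<subseteq> triples M" using J Ts(2) by blast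
    let ?Y = "X \<union> \<Union>J"
    have fY: "finite ?Y" using fX(1) fJ ft JT by blast
    have YM: "?Y \<subseteq> rpts M" using fX(2) JT tripleD(1)[OF M] by blast
    have "rdim M X = int (card X)" using nt unfolding rdim_def by (metis (no_types, lifting) card.empty Collect_empty_eq diff_zero of_nat_0)
    moreover have "rdim M X \<le> rdim M ?Y" using X fY YM unfolding rstrong_iff by blast
    moreover have "card J \<le> card {t \<in> triples M. t \<subseteq> ?Y}"
      using fY JT by (intro card_mono finite_triples_within) auto
    moreover have "?Y - X = \<Union>((\<lambda>t. t - X) ` J)" by blast
    moreover have "card (?Y - X) = card ?Y - card X" using fX(1) by (intro card_Diff_subset) auto
    moreover have "card X \<le> card ?Y" using fY by (intro card_mono) auto
    ultimately show "card J \<le> card (\<Union>((\<lambda>t. t - X) ` J))" unfolding rdim_def by simp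
  qed
  then obtain h where h: "inj_on h Ts" "\<And>t. t \<in> Ts \<Longrightarrow> h t \<in> t - X" by blast
  \<comment> \<open>the points to which the relations of \<open>p\<close> with these points are charged\<close>
  define S where "S p = {c \<in> nb M p \<inter> D. h (insert c p) = c}" for p
  have inTs: "insert c p \<in> Ts" if "p \<in> P" "c \<in> nb M p \<inter> D" for c p
    using that unfolding Ts_def by blast
  have le: "card (nb M p \<inter> D) - 2 \<le> card (S p)" if p: "p \<in> P" for p
  proof -
    have p2: "card p = 2" using p P(2) by (auto simp: pairs_def)
    hence fp: "finite p" by (metis card.infinite zero_neq_numeral)
    let ?R = "{c \<in> nb M p \<inter> D. h (insert c p) \<in> p}"
    have sub: "nb M p \<inter> D \<subseteq> S p \<union> ?R"
    proof
      fix c assume c: "c \<in> nb M p \<inter> D"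
      have "h (insert c p) \<in> insert c p" using h(2)[OF inTs[OF p c]] by blast
      thus "c \<in> S p \<union> ?R" using c unfolding S_def by blast
    qed
    have "inj_on (\<lambda>c. h (insert c p)) ?R"
    proof (rule inj_onI)
      fix c d assume cd: "c \<in> ?R" "d \<in> ?R" "h (insert c p) = h (insert d p)"
      have "insert c p = insert d p"
        by (rule inj_onD[OF h(1) cd(3)]) (use cd inTs[OF p] in auto)
      thus "c = d" using inj_onD[OF inj_insert_nb[OF M p2]] cd by blast
    qed
    hence "card ?R \<le> card p" by (rule card_inj_on_le) (use fp in auto)
    moreover have "card (nb M p \<inter> D) \<le> card (S p \<union> ?R)"
      using sub D by (intro card_mono) (auto simp: S_def)
    moreover have "card (S p \<union> ?R) \<le> card (S p) + card ?R" by (rule card_Un_le)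
    ultimately show ?thesis using p2 by linarith
  qed
  have "(\<Sum>p\<in>P. card (nb M p \<inter> D) - 2) \<le> (\<Sum>p\<in>P. card (S p))" using le by (rule sum_mono)
  also have "\<dots> = card (\<Union>p\<in>P. S p)"
  proof (rule card_UN_disjoint[symmetric, OF P(1)])
    show "\<forall>p\<in>P. finite (S p)" using D by (simp add: S_def)
    show "\<forall>p\<in>P. \<forall>q\<in>P. p \<noteq> q \<longrightarrow> S p \<inter> S q = {}"
    proof (intro ballI impI, rule ccontr)
      fix p q assume pq: "p \<in> P" "q \<in> P" "p \<noteq> q" "S p \<inter> S q \<noteq> {}"
      then obtain c where c: "c \<in> S p" "c \<in> S q" by blast
      have eq: "h (insert c p) = h (insert c q)" using c by (simp add: S_def)
      have "insert c p = insert c q"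
        by (rule inj_onD[OF h(1) eq]) (use c pq inTs in \<open>auto simp: S_def\<close>)
      moreover have "c \<notin> p" "c \<notin> q"
        using c pq P(2) nb_not_in_pair(1)[OF M] by (auto simp: S_def pairs_def)
      ultimately show False using pq(3) by (metis Diff_insert_absorb)
    qed
  qed
  also have "\<dots> \<le> card (D - X)"
  proof (rule card_mono)
    show "(\<Union>p\<in>P. S p) \<subseteq> D - X"
    proof
      fix c assume "c \<in> (\<Union>p\<in>P. S p)"
      then obtain p where p: "p \<in> P" "c \<in> nb M p \<inter> D" "h (insert c p) = c" unfolding S_def by blast
      thus "c \<in> D - X" using h(2)[OF inTs[OF p(1,2)]] by auto
    qed
  qed (use D in simp)
  finally show ?thesis .
qed


section \<open>The \<open>S\<close>-reduct of a generic structure\<close>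

lemma obtain_card_3_subset:
  assumes "at_least_3 C"
  obtains X where "X \<subseteq> C" "finite X" "card X = 3"
proof (cases "finite C")
  case True
  hence "3 \<le> card C" using assms by (simp add: at_least_3_def)
  thus ?thesis using obtain_subset_with_card_n that by metis
next
  case False
  thus ?thesis using infinite_arbitrarily_large that by metis
qed

lemma pairs_rewrite:
  assumes "rstructure M"
  shows "{{x, y} | x y. x \<in> rpts M \<and> y \<in> rpts M \<and> x \<noteq> y \<and> Q (common_nbrs M x y)} =
         {p \<in> pairs M. Q (nb M p)}"
proof (intro equalityI subsetI)
  fix p assume "p \<in> {p \<in> pairs M. Q (nb M p)}"
  hence p: "p \<subseteq> rpts M" "card p = 2" "Q (nb M p)" by (auto simp: pairs_def)
  then obtain x y where "p = {x,y}" "x \<noteq> y" by (auto simp: card_2_iff)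
  thus "p \<in> {{x, y} | x y. x \<in> rpts M \<and> y \<in> rpts M \<and> x \<noteq> y \<and> Q (common_nbrs M x y)}"
    using p by (auto simp: common_nbrs_eq_nb[OF assms])
qed (auto simp: pairs_def common_nbrs_eq_nb[OF assms])

lemma cliques_s_reduct:
  assumes "rstructure M"
  shows "cliques (s_reduct M) = nb M ` {p \<in> pairs M. at_least_3 (nb M p)}"
proof -
  have "cliques (s_reduct M) =
    {nb M {x,y} | x y. x \<in> rpts M \<and> y \<in> rpts M \<and> x \<noteq> y \<and> at_least_3 (common_nbrs M x y)}"
    by (simp add: s_reduct_def common_nbrs_eq_nb[OF assms])
  also have "\<dots> = nb M ` {{x,y} | x y. x \<in> rpts M \<and> y \<in> rpts M \<and> x \<noteq> y \<and> at_least_3 (common_nbrs M x y)}"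
    by blast
  finally show ?thesis using pairs_rewrite[OF assms, of at_least_3] by simp
qed

lemma premult_s_reduct:
  "rstructure M \<Longrightarrow> premult (s_reduct M) C = card {p \<in> pairs M. nb M p = C}"
  using pairs_rewrite[of M "\<lambda>D. C = D"] by (simp add: s_reduct_def eq_commute)

lemma spts_s_reduct [simp]: "spts (s_reduct M) = rpts M"
  by (simp add: s_reduct_def)

text \<open>The pre-multiplicity of a clique counts the pairs with this common neighbourhood; grouping the pairs
  by neighbourhood gives the sum over the cliques.\<close>

lemma sum_cliques_s_reduct:
  fixes \<phi> :: "'a set \<Rightarrow> nat"
  assumes M: "rstructure M" and fin: "finite {p \<in> pairs M. Q (nb M p)}"
    and Q: "\<And>C. Q C \<Longrightarrow> at_least_3 C"
  shows "(\<Sum>C | C \<in> cliques (s_reduct M) \<and> Q C. premult (s_reduct M) C * \<phi> C) =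
         (\<Sum>p | p \<in> pairs M \<and> Q (nb M p). \<phi> (nb M p))"
proof -
  let ?P = "{p \<in> pairs M. Q (nb M p)}"
  have img: "{C. C \<in> cliques (s_reduct M) \<and> Q C} = nb M ` ?P"
    using Q by (auto simp: cliques_s_reduct[OF M])
  have "(\<Sum>p\<in>?P. \<phi> (nb M p)) = (\<Sum>C\<in>nb M ` ?P. \<Sum>p\<in>{p \<in> ?P. nb M p = C}. \<phi> (nb M p))"
    by (rule sum.image_gen[OF fin])
  also have "\<dots> = (\<Sum>C\<in>nb M ` ?P. premult (s_reduct M) C * \<phi> C)"
  proof (rule sum.cong[OF refl])
    fix C assume C: "C \<in> nb M ` ?P"
    hence "{p \<in> ?P. nb M p = C} = {p \<in> pairs M. nb M p = C}" by auto
    thus "(\<Sum>p\<in>{p \<in> ?P. nb M p = C}. \<phi> (nb M p)) = premult (s_reduct M) C * \<phi> C"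
      by (simp add: premult_s_reduct[OF M])
  qed
  finally show ?thesis by (simp add: img)
qed

locale generic =
  fixes M :: "'m::infinite rstruct"
  assumes generic: "generic_rstructure M"
begin

lemma rstructure: "rstructure M"
  using generic by (simp add: generic_rstructure_def)

lemma rdim_nonneg: "finite A \<Longrightarrow> A \<subseteq> rpts M \<Longrightarrow> 0 \<le> rdim M A"
proof -
  assume A: "finite A" "A \<subseteq> rpts M"
  hence "rstrong {} (rinduced M A)"
    using generic by (simp add: generic_rstructure_def rclass_def)
  hence "d0 (rinduced (rinduced M A) {}) \<le> d0 (rinduced (rinduced M A) A)"
    using A by (simp add: rstrong_def rinduced_def)
  moreover have "rinduced (rinduced M A) A = rinduced M A" "rinduced (rinduced M A) {} = rinduced M {}"
    by (auto simp: rinduced_def)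
  ultimately show ?thesis by (simp add: d0_rinduced rdim_empty[OF rstructure])
qed

lemma empty_rstrong: "rstrong {} M"
  using rdim_nonneg by (simp add: rstrong_iff rdim_empty[OF rstructure])

lemma rclosure_exists:
  assumes "finite X" "X \<subseteq> rpts M"
  obtains Y where "X \<subseteq> Y" "rstrong Y M"
proof -
  let ?P = "\<lambda>Y. finite Y \<and> X \<subseteq> Y \<and> Y \<subseteq> rpts M"
  obtain Y where Y: "?P Y" "\<And>Z. ?P Z \<Longrightarrow> nat (rdim M Y) \<le> nat (rdim M Z)"
    using ex_has_least_nat[of ?P X "\<lambda>Y. nat (rdim M Y)"] assms by auto
  have "rdim M Y \<le> rdim M Z" if "finite Z" "Y \<subseteq> Z" "Z \<subseteq> rpts M" for Z
  proof -
    have "nat (rdim M Y) \<le> nat (rdim M Z)" by (rule Y(2)) (use that Y(1) in auto)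
    thus ?thesis using rdim_nonneg[of Z] that by linarith
  qed
  hence "rstrong Y M" using Y(1) by (simp add: rstrong_iff)
  thus ?thesis using that Y(1) by blast
qed

lemma no_triple_in_empty: "t \<in> triples M \<Longrightarrow> \<not> t \<subseteq> {}"
  using tripleD(2)[OF rstructure] by fastforce

text \<open>This is the validity bound \<open>k \<le> 1 + 2 / (n - 2)\<close> for the number \<open>k\<close> of pairs above a set of \<open>n\<close>
  points, cleared of denominators. As \<open>P\<close> is an arbitrary finite set of such pairs, it also shows
  that there are only finitely many.\<close>

lemma pairs_above_bound:
  assumes X: "finite X" "3 \<le> card X" and P: "P \<subseteq> {p \<in> pairs M. X \<subseteq> nb M p}" "finite P"
  shows "card P * (card X - 2) \<le> card X"
proof -
  have "card P * (card X - 2) = (\<Sum>p\<in>P. card (nb M p \<inter> X) - 2)"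
    using P(1) by (subst sum.cong[OF refl, of P _ "\<lambda>_. card X - 2"]) (auto simp: Int_absorb1)
  also have "\<dots> \<le> card (X - {})"
    by (rule sum_excess_le[OF rstructure empty_rstrong no_triple_in_empty X(1)]) (use P in auto)
  finally show ?thesis by simp
qed

lemma finite_pairs_above:
  assumes X: "finite X" "3 \<le> card X"
  shows "finite {p \<in> pairs M. X \<subseteq> nb M p}"
proof (rule ccontr)
  assume "infinite {p \<in> pairs M. X \<subseteq> nb M p}"
  then obtain P where P: "finite P" "card P = 4" "P \<subseteq> {p \<in> pairs M. X \<subseteq> nb M p}"
    using infinite_arbitrarily_large[of _ 4] by meson
  have "4 * (card X - 2) \<le> card X" using pairs_above_bound[OF X P(3,1)] P(2) by simp
  thus False using X(2) by linarith
qed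

lemma mult_s_reduct:
  assumes X: "finite X" "3 \<le> card X"
  shows "mult (s_reduct M) X = card {p \<in> pairs M. X \<subseteq> nb M p}"
proof -
  have Q: "at_least_3 C" if "X \<subseteq> C" for C
    using X that by (intro at_least_3_mono[OF _ that]) (simp add: at_least_3_def)
  show ?thesis
    using sum_cliques_s_reduct[OF rstructure finite_pairs_above[OF X] Q, of "\<lambda>_. 1"] X
    by (simp add: mult_def at_least_3_finite)
qed

lemma sstructure_s_reduct: "sstructure (s_reduct M)"
  unfolding sstructure_def
proof (intro conjI ballI allI impI)
  fix C assume "C \<in> cliques (s_reduct M)"
  then obtain p where p: "p \<in> pairs M" "C = nb M p" "at_least_3 C"
    by (auto simp: cliques_s_reduct[OF rstructure])
  show "C \<subseteq> spts (s_reduct M)"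
    using p nb_not_in_pair(2)[OF rstructure] by (auto simp: pairs_def)
  show "at_least_3 C" by fact
  obtain X where X: "X \<subseteq> C" "finite X" "card X = 3" using obtain_card_3_subset[OF p(3)] .
  have fin: "finite {p \<in> pairs M. X \<subseteq> nb M p}" using finite_pairs_above X by simp
  have "{p \<in> pairs M. nb M p = C} \<subseteq> {p \<in> pairs M. X \<subseteq> nb M p}" using X(1) by auto
  hence "card {p \<in> pairs M. nb M p = C} \<le> card {p \<in> pairs M. X \<subseteq> nb M p}"
    and f2: "finite {p \<in> pairs M. nb M p = C}"
    using fin by (auto intro: card_mono finite_subset)
  moreover have "card {p \<in> pairs M. X \<subseteq> nb M p} \<le> 3"
    using pairs_above_bound[OF X(2) _ subset_refl fin] X(3) by simp
  moreover have "card {p \<in> pairs M. nb M p = C} \<noteq> 0" using p f2 by auto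
  ultimately have "1 \<le> premult (s_reduct M) C" "premult (s_reduct M) C \<le> 3"
    unfolding premult_s_reduct[OF rstructure] by linarith+
  thus "premult (s_reduct M) C \<in> {1,2,3}" by auto
next
  fix X assume X: "X \<subseteq> spts (s_reduct M) \<and> finite X \<and> 3 \<le> card X"
  let ?P = "{p \<in> pairs M. X \<subseteq> nb M p}"
  have fin: "finite ?P" using finite_pairs_above X by simp
  have "{C \<in> cliques (s_reduct M). X \<subseteq> C} \<subseteq> nb M ` ?P"
    by (auto simp: cliques_s_reduct[OF rstructure])
  thus "finite {C \<in> cliques (s_reduct M). X \<subseteq> C}" using fin finite_surj by blast
  have "card ?P * (card X - 2) \<le> card X"
    by (rule pairs_above_bound) (use X fin in auto)
  hence "real (card ?P * (card X - 2)) \<le> real (card X)" by (rule of_nat_mono)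
  hence "real (card ?P) * (real (card X) - 2) \<le> real (card X)" using X by (simp add: of_nat_diff)
  hence "real (card ?P) \<le> real (card X) / (real (card X) - 2)" using X by (simp add: pos_le_divide_eq)
  also have "\<dots> = 1 + 2 / (real (card X) - 2)" using X by (simp add: field_simps)
  finally show "real (mult (s_reduct M) X) \<le> 1 + 2 / (real (card X) - 2)"
    using X by (simp add: mult_s_reduct)
qed

text \<open>An \<open>R\<close>-strong set without relations is strong in the reduct: the excesses
  subtracted in the predimension of \<open>D\<close> amount to at most \<open>|D - X|\<close>.\<close>

lemma pdim_s_reduct_ge:
  assumes X: "rstrong X M" and nt: "\<And>t. t \<in> triples M \<Longrightarrow> \<not> t \<subseteq> X"
    and D: "finite D" "X \<subseteq> D" "D \<subseteq> rpts M"
  shows "int (card X) \<le> pdim (s_reduct M) D"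
proof -
  let ?P = "{p \<in> pairs M. 3 \<le> card (nb M p \<inter> D)}"
  have "?P \<subseteq> (\<Union>Z\<in>{Z. Z \<subseteq> D \<and> 3 \<le> card Z}. {p \<in> pairs M. Z \<subseteq> nb M p})" by blast
  moreover have "finite (\<Union>Z\<in>{Z. Z \<subseteq> D \<and> 3 \<le> card Z}. {p \<in> pairs M. Z \<subseteq> nb M p})"
    using D(1) by (intro finite_UN_I finite_pairs_above) (auto intro: finite_subset)
  ultimately have fin: "finite ?P" by (rule finite_subset)
  have Q: "at_least_3 C" if "3 \<le> card (C \<inter> D)" for C
    by (rule at_least_3_mono[of "C \<inter> D"]) (use that D(1) in \<open>auto simp: at_least_3_def\<close>)
  have "pdim (s_reduct M) D = int (card D) - int (\<Sum>C | C \<in> cliques (s_reduct M) \<and> 3 \<le> card (C \<inter> D).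
      premult (s_reduct M) C * (card (C \<inter> D) - 2))"
    using pdim_eq[OF sstructure_s_reduct D(1) _ subset_refl] D(3) by simp
  also have "(\<Sum>C | C \<in> cliques (s_reduct M) \<and> 3 \<le> card (C \<inter> D).
      premult (s_reduct M) C * (card (C \<inter> D) - 2)) = (\<Sum>p\<in>?P. card (nb M p \<inter> D) - 2)"
    by (rule sum_cliques_s_reduct[OF rstructure fin Q])
  finally have "pdim (s_reduct M) D = int (card D) - int (\<Sum>p\<in>?P. card (nb M p \<inter> D) - 2)" .
  moreover have "(\<Sum>p\<in>?P. card (nb M p \<inter> D) - 2) \<le> card (D - X)"
    by (rule sum_excess_le[OF rstructure X nt D(1) fin]) auto
  moreover have "card X \<le> card D" "card (D - X) = card D - card X"
    using D X by (auto simp: rstrong_def card_Diff_subset card_mono)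
  ultimately show ?thesis by linarith
qed

end

text \<open>Room for copies of finite structures over a given part: the remaining points are sent to fresh
  points of the infinite type.\<close>

lemma extend_injection:
  fixes g :: "'a \<Rightarrow> 'b::infinite"
  assumes "finite B" "A \<subseteq> B" "inj_on g A"
  obtains e where "inj_on e B" "\<And>a. a \<in> A \<Longrightarrow> e a = g a"
proof -
  have fA: "finite (g ` A)" using assms finite_subset by blast
  hence "infinite (UNIV - g ` A)" by (simp add: infinite_UNIV)
  then obtain Y where Y: "Y \<subseteq> UNIV - g ` A" "finite Y" "card Y = card (B - A)"
    using infinite_arbitrarily_large[of _ "card (B - A)"] by meson
  have "finite (B - A)" using assms(1) by simp
  then obtain k where k: "bij_betw k (B - A) Y" using Y(2,3) finite_same_card_bij by metis
  let ?e = "\<lambda>x. if x \<in> A then g x else k x"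
  have kY: "k x \<in> Y" if "x \<in> B" "x \<notin> A" for x using k that by (auto simp: bij_betw_def)
  show ?thesis
  proof (rule that[of ?e])
    show "inj_on ?e B"
    proof (rule inj_onI)
      fix x y assume xy: "x \<in> B" "y \<in> B" "?e x = ?e y"
      show "x = y"
      proof (cases "x \<in> A"; cases "y \<in> A")
        assume "x \<in> A" "y \<in> A" thus ?thesis using xy assms(3) by (auto dest: inj_onD)
      next
        assume a: "x \<in> A" "y \<notin> A"
        hence "k y = g x" "k y \<in> Y" using xy kY[of y] by auto
        hence "g x \<in> Y \<inter> g ` A" using a by auto
        thus ?thesis using Y(1) by auto
      next
        assume a: "x \<notin> A" "y \<in> A"
        hence "k x = g y" "k x \<in> Y" using xy kY[of x] by auto
        hence "g y \<in> Y \<inter> g ` A" using a by auto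
        thus ?thesis using Y(1) by auto
      next
        assume "x \<notin> A" "y \<notin> A"
        thus ?thesis using xy k by (auto simp: bij_betw_def dest: inj_onD)
      qed
    qed
  qed auto
qed

section \<open>Amalgamation over a strong set\<close>

lemma (in generic) generic_extension:
  "rstrong A M \<and> B \<in> rclass \<and> rstrong A B \<and> rinduced B A = rinduced M A \<Longrightarrow>
    \<exists>f. rembedding f B M \<and> (\<forall>a\<in>A. f a = a) \<and> rstrong (f ` rpts B) M"
proof -
  assume a: "rstrong A M \<and> B \<in> rclass \<and> rstrong A B \<and> rinduced B A = rinduced M A"
  have "\<forall>A B. rstrong A M \<and> B \<in> rclass \<and> rstrong A B \<and> rinduced B A = rinduced M A \<longrightarrow>
      (\<exists>f. rembedding f B M \<and> (\<forall>a\<in>A. f a = a) \<and> rstrong (f ` rpts B) M)"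
    using generic unfolding generic_rstructure_def by (elim conjE)
  from this[THEN spec, THEN spec, THEN mp, OF a] show ?thesis .
qed

text \<open>The extension property of a generic structure speaks of extensions whose points have the same type and
  which literally contain the given strong set. Here the extension \<open>W\<close> has points of any
  type, and \<open>i\<close> identifies \<open>A\<close> with a part of it.\<close>

lemma (in generic) embed_strong_extension:
  fixes W :: "'c rstruct" and i :: "'m \<Rightarrow> 'c"
  assumes A: "rstrong A M"
    and W: "rstructure W" "finite (rpts W)" "\<And>Y. Y \<subseteq> rpts W \<Longrightarrow> 0 \<le> rdim W Y"
    and i: "inj_on i A" "i ` A \<subseteq> rpts W"
    and it: "\<And>t. t \<subseteq> A \<Longrightarrow> i ` t \<in> triples W \<longleftrightarrow> t \<in> triples M"
    and iA: "rstrong (i ` A) W"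
  obtains f where "inj_on f (rpts W)" "f ` rpts W \<subseteq> rpts M" "\<And>a. a \<in> A \<Longrightarrow> f (i a) = a"
    "rstrong (f ` rpts W) M" "\<And>t. t \<subseteq> rpts W \<Longrightarrow> f ` t \<in> triples M \<longleftrightarrow> t \<in> triples W"
proof -
  have fA: "finite A" "A \<subseteq> rpts M" using A by (auto simp: rstrong_def)
  obtain e where e: "inj_on e (rpts W)" "\<And>a. a \<in> i ` A \<Longrightarrow> e a = inv_into A i a"
    using extend_injection[OF W(2) i(2) inj_on_inv_into[OF subset_refl]] by metis
  have ei: "e (i a) = a" if "a \<in> A" for a using e(2)[of "i a"] that i(1) by simp
  let ?T = "(`) e ` triples W" and ?V = "e ` rpts W"
  let ?B = "hypergraph ?V ?T"
  have injt: "inj_on e t" if "t \<subseteq> rpts W" for t using e(1) that by (rule inj_on_subset)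
  have T: "t \<subseteq> ?V \<and> card t = 3" if "t \<in> ?T" for t
  proof -
    obtain s where s: "s \<in> triples W" "t = e ` s" using \<open>t \<in> ?T\<close> by blast
    show ?thesis using tripleD[OF W(1) s(1)] s(2) card_image[OF injt] by auto
  qed
  have rB: "rstructure ?B" and tB: "triples ?B = ?T"
    using hypergraph_rstructure[of ?T ?V] T by blast+
  have et: "e ` t \<in> triples ?B \<longleftrightarrow> t \<in> triples W" if t: "t \<subseteq> rpts W" for t
  proof
    assume "e ` t \<in> triples ?B"
    then obtain s where s: "s \<in> triples W" "e ` t = e ` s" unfolding tB by blast
    have "t = s" using inj_on_image_eq_iff[OF e(1) t tripleD(1)[OF W(1) s(1)]] s(2) by blast
    thus "t \<in> triples W" using s(1) by simp
  qed (simp add: tB)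
  have dB: "rdim ?B (e ` Y) = rdim W Y" if "Y \<subseteq> rpts W" for Y
    by (rule rdim_image[OF e(1) that et])
  have eiA: "e ` i ` A = A" using ei by (force simp: image_image)
  have sB: "rstrong (e ` X) ?B" if X: "rstrong X W" for X
    unfolding rstrong_iff
  proof (intro conjI allI impI)
    have X': "finite X" "X \<subseteq> rpts W" using X by (auto simp: rstrong_def)
    show "finite (e ` X)" "e ` X \<subseteq> rpts ?B" using X' by auto
    fix D assume D: "finite D \<and> e ` X \<subseteq> D \<and> D \<subseteq> rpts ?B"
    hence "D \<subseteq> e ` rpts W" by simp
    then obtain Y where Y: "Y \<subseteq> rpts W" "D = e ` Y" by (metis subset_imageE)
    have "X \<subseteq> Y"
    proof
      fix x assume x: "x \<in> X"
      hence "e x \<in> e ` Y" using D Y(2) by blast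
      thus "x \<in> Y" using inj_on_image_mem_iff[OF e(1) _ Y(1), of x] x X'(2) by blast
    qed
    moreover have "finite Y" using Y(1) W(2) by (rule finite_subset)
    ultimately have "rdim W X \<le> rdim W Y" using X Y(1) unfolding rstrong_iff by blast
    thus "rdim ?B (e ` X) \<le> rdim ?B D" using dB[OF Y(1)] dB[OF X'(2)] Y(2) by simp
  qed
  have "rstrong {} W" using W rdim_empty[OF W(1)] by (simp add: rstrong_iff)
  hence "rstrong {} ?B" using sB[of "{}"] by simp
  hence cB: "?B \<in> rclass" using rB W(2) by (simp add: rclass_def)
  have AB: "rstrong A ?B" using sB[OF iA] eiA by simp
  have "rrel ?B x y z \<longleftrightarrow> rrel M x y z" if "x \<in> A" "y \<in> A" "z \<in> A" for x y z
  proof -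
    have "e ` i ` {x,y,z} = {x,y,z}" using ei that by simp
    moreover have "i ` {x,y,z} \<subseteq> rpts W" using i(2) that by blast
    ultimately have "{x,y,z} \<in> triples ?B \<longleftrightarrow> {x,y,z} \<in> triples M"
      using et[of "i ` {x,y,z}"] it[of "{x,y,z}"] that by simp
    thus ?thesis by (simp only: rrel_iff_triple[OF rB] rrel_iff_triple[OF rstructure])
  qed
  hence "rinduced ?B A = rinduced M A" unfolding rinduced_def by (auto intro!: ext)
  with A cB AB have "rstrong A M \<and> ?B \<in> rclass \<and> rstrong A ?B \<and> rinduced ?B A = rinduced M A"
    by (intro conjI)
  from generic_extension[OF this] obtain f0 where f0: "rembedding f0 ?B M" "\<And>a. a \<in> A \<Longrightarrow> f0 a = a" "rstrong (f0 ` rpts ?B) M"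
    by blast
  have f0': "inj_on f0 ?V" "f0 ` ?V \<subseteq> rpts M"
    "\<And>x y z. x \<in> ?V \<Longrightarrow> y \<in> ?V \<Longrightarrow> z \<in> ?V \<Longrightarrow> rrel ?B x y z \<longleftrightarrow> rrel M (f0 x) (f0 y) (f0 z)"
    using f0(1) unfolding rembedding_def rpts_hypergraph by blast+
  show ?thesis
  proof (rule that[of "f0 \<circ> e"])
    show inj: "inj_on (f0 \<circ> e) (rpts W)" using e(1) f0'(1) by (rule comp_inj_on)
    show "(f0 \<circ> e) ` rpts W \<subseteq> rpts M" using f0'(2) by (simp add: image_comp)
    show "(f0 \<circ> e) (i a) = a" if "a \<in> A" for a using that ei f0(2) by simp
    show "rstrong ((f0 \<circ> e) ` rpts W) M" using f0(3) by (simp add: image_comp)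
    fix t assume t: "t \<subseteq> rpts W"
    have ct: "card ((f0 \<circ> e) ` t) = card t" by (rule card_image[OF inj_on_subset[OF inj t]])
    show "(f0 \<circ> e) ` t \<in> triples M \<longleftrightarrow> t \<in> triples W"
    proof (cases "card t = 3")
      case True
      then obtain x y z where xyz: "t = {x,y,z}" by (auto simp: card_3_iff)
      have "rrel ?B (e x) (e y) (e z) \<longleftrightarrow> rrel M (f0 (e x)) (f0 (e y)) (f0 (e z))"
        using t xyz by (intro f0'(3)) auto
      hence "e ` t \<in> triples ?B \<longleftrightarrow> (f0 \<circ> e) ` t \<in> triples M"
        unfolding rrel_iff_triple[OF rB] rrel_iff_triple[OF rstructure] by (simp add: xyz)
      thus ?thesis using et[OF t] by simp
    next
      case False
      thus ?thesis using tripleD(2)[OF rstructure] tripleD(2)[OF W(1)] ct by metis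
    qed
  qed
qed

text \<open>By Moebius inversion, families that contain each set equally often from below have fibres of
  equal size. This will match the cliques of \<open>B\<close> with the pairs that produce their traces on \<open>A\<close>.\<close>

lemma fibrewise_bijection:
  fixes u :: "'i \<Rightarrow> 'a set" and v :: "'j \<Rightarrow> 'a set"
  assumes V: "finite V" and u: "\<And>i. u i \<subseteq> V" and v: "\<And>j. v j \<subseteq> V"
    and fin: "\<And>X. X \<subseteq> V \<Longrightarrow> 3 \<le> card X \<Longrightarrow> finite {i \<in> I. X \<subseteq> u i} \<and> finite {j \<in> J. X \<subseteq> v j}"
    and eq: "\<And>X. X \<subseteq> V \<Longrightarrow> 3 \<le> card X \<Longrightarrow> card {i \<in> I. X \<subseteq> u i} = card {j \<in> J. X \<subseteq> v j}"
  obtains \<pi> where "bij_betw \<pi> {i \<in> I. 3 \<le> card (u i)} {j \<in> J. 3 \<le> card (v j)}"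
    "\<And>i. i \<in> I \<Longrightarrow> 3 \<le> card (u i) \<Longrightarrow> v (\<pi> i) = u i"
proof -
  have group: "(\<Sum>C | X \<subseteq> C \<and> C \<subseteq> V. card {k \<in> K. w k = C}) = card {k \<in> K. X \<subseteq> w k}"
    if "finite {k \<in> K. X \<subseteq> w k}" "\<And>k. w k \<subseteq> V" for w :: "'k \<Rightarrow> 'a set" and K X
  proof -
    have "(\<Sum>C | X \<subseteq> C \<and> C \<subseteq> V. card {k \<in> K. w k = C}) =
          (\<Sum>C | X \<subseteq> C \<and> C \<subseteq> V. \<Sum>k | k \<in> {k \<in> K. X \<subseteq> w k} \<and> w k = C. 1)"
    proof (rule sum.cong[OF refl])
      fix C assume "C \<in> {C. X \<subseteq> C \<and> C \<subseteq> V}"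
      hence "{k. k \<in> {k \<in> K. X \<subseteq> w k} \<and> w k = C} = {k \<in> K. w k = C}" by auto
      thus "card {k \<in> K. w k = C} = (\<Sum>k | k \<in> {k \<in> K. X \<subseteq> w k} \<and> w k = C. 1)" by simp
    qed
    also have "\<dots> = (\<Sum>k\<in>{k \<in> K. X \<subseteq> w k}. 1)"
      by (rule sum.group[OF that(1) finite_between[OF V]]) (use that(2) in auto)
    finally show ?thesis by simp
  qed
  have "card {i \<in> I. u i = X} = card {j \<in> J. v j = X}" if "X \<subseteq> V" "3 \<le> card X" for X
    by (rule upset_sums_determine[OF V _ that]) (simp add: group fin u v eq)
  moreover have "finite {i \<in> I. u i = X}" "finite {j \<in> J. v j = X}" if "X \<subseteq> V" "3 \<le> card X" for X
    using fin[OF that] by (auto elim!: rev_finite_subset)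
  ultimately have "\<exists>k. bij_betw k {i \<in> I. u i = X} {j \<in> J. v j = X}" if "X \<subseteq> V" "3 \<le> card X" for X
    using finite_same_card_bij that by blast
  then obtain k where k: "\<And>X. X \<subseteq> V \<Longrightarrow> 3 \<le> card X \<Longrightarrow> bij_betw (k X) {i \<in> I. u i = X} {j \<in> J. v j = X}"
    by metis
  have kk: "k (u i) i \<in> J \<and> v (k (u i) i) = u i" if "i \<in> I" "3 \<le> card (u i)" for i
    using bij_betwE[OF k[OF u that(2)]] that by auto
  show ?thesis
  proof (rule that[of "\<lambda>i. k (u i) i"])
    show "v (k (u i) i) = u i" if "i \<in> I" "3 \<le> card (u i)" for i using kk[OF that] by simp
    show "bij_betw (\<lambda>i. k (u i) i) {i \<in> I. 3 \<le> card (u i)} {j \<in> J. 3 \<le> card (v j)}"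
    proof (rule bij_betw_imageI)
      show "inj_on (\<lambda>i. k (u i) i) {i \<in> I. 3 \<le> card (u i)}"
      proof (rule inj_onI)
        fix i i' assume a: "i \<in> {i \<in> I. 3 \<le> card (u i)}" "i' \<in> {i \<in> I. 3 \<le> card (u i)}"
          "k (u i) i = k (u i') i'"
        hence e: "u i = u i'" using kk[of i] kk[of i'] by auto
        have "inj_on (k (u i)) {j \<in> I. u j = u i}" using k[OF u] a(1) by (auto simp: bij_betw_def)
        thus "i = i'" by (rule inj_onD) (use a e in auto)
      qed
      show "(\<lambda>i. k (u i) i) ` {i \<in> I. 3 \<le> card (u i)} = {j \<in> J. 3 \<le> card (v j)}"
      proof (intro equalityI subsetI)
        fix j assume j: "j \<in> {j \<in> J. 3 \<le> card (v j)}"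
        hence "j \<in> k (v j) ` {i \<in> I. u i = v j}" using k[OF v] by (auto simp: bij_betw_def)
        then obtain i where i: "i \<in> I" "u i = v j" "j = k (v j) i" by blast
        show "j \<in> (\<lambda>i. k (u i) i) ` {i \<in> I. 3 \<le> card (u i)}"
          by (rule image_eqI[of _ _ i]) (use i j in simp_all)
      qed (use kk in auto)
    qed
  qed
qed

text \<open>The points of the amalgam: the given strong set, the points of \<open>B - A\<close>, and two points (the
  apexes) for each clique of \<open>B\<close>, counted with pre-multiplicity, that is not yet present over
  \<open>A\<close>. Using a sum type keeps the three kinds disjoint.\<close>

datatype ('m, 'b) amalg = Old 'm | New 'b | Apex "'b set \<times> nat" bool

locale amalgamation = generic M for M :: "'m::infinite rstruct" +
  fixes B :: "'b sstruct" and A :: "'b set" and g :: "'b \<Rightarrow> 'm" and Abar :: "'m set"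
  assumes B: "sstructure B" "finite (spts B)" and AB: "sstrong A B"
    and g: "inj_on g A" "g ` A \<subseteq> Abar"
    and gm: "\<And>X. X \<subseteq> A \<Longrightarrow> mult (s_reduct M) (g ` X) = mult B X"
    and Abar: "rstrong Abar M"
begin

text \<open>A clique \<open>K\<close> counted \<open>premult B K\<close> times; each copy will be the common neighbourhood of its own
  pair.\<close>

definition copies :: "('b set \<times> nat) set" where
  "copies = (SIGMA K:cliques B. {..<premult B K})"

abbreviation "trace i \<equiv> fst i \<inter> A"

definition old_copies where "old_copies = {i \<in> copies. 3 \<le> card (trace i)}"

definition new_copies where "new_copies = {i \<in> copies. card (trace i) < 3}"

lemma finA: "finite A" "A \<subseteq> spts B"
  using AB by (auto simp: sstrong_def)

lemma finite_copies: "finite copies"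
  unfolding copies_def using finite_cliques[OF B] by simp

lemma copies_fst: "i \<in> copies \<Longrightarrow> fst i \<subseteq> spts B"
  using sstructure_cliqueD(1)[OF B(1)] by (fastforce simp: copies_def)

lemma copies_split: "copies = old_copies \<union> new_copies" "old_copies \<inter> new_copies = {}"
  "finite old_copies" "finite new_copies"
  using finite_copies by (auto simp: old_copies_def new_copies_def)

lemma mult_copies:
  assumes "X \<subseteq> spts B" "3 \<le> card X"
  shows "mult B X = card {i \<in> copies. X \<subseteq> fst i}"
proof -
  have "{i \<in> copies. X \<subseteq> fst i} = (SIGMA K:{K \<in> cliques B. X \<subseteq> K}. {..<premult B K})"
    by (auto simp: copies_def)
  hence "card {i \<in> copies. X \<subseteq> fst i} = (\<Sum>K | K \<in> cliques B \<and> X \<subseteq> K. premult B K)"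
    using finite_cliques[OF B] by (simp add: card_SigmaI)
  thus ?thesis
    using assms finite_subset[OF assms(1) B(2)] by (simp add: mult_def at_least_3_finite)
qed

lemma pdim_copies:
  assumes "X \<subseteq> spts B"
  shows "pdim B X = int (card X) - (\<Sum>i\<in>copies. int (card (fst i \<inter> X) - 2))"
proof -
  have "{C. C \<in> cliques B \<and> 3 \<le> card (C \<inter> spts B)} = cliques B"
  proof -
    have "3 \<le> card (C \<inter> spts B)" if "C \<in> cliques B" for C
      using sstructure_cliqueD(1,2)[OF B(1) that] finite_subset[OF _ B(2)]
      by (simp add: Int_absorb2 at_least_3_finite)
    thus ?thesis by blast
  qed
  hence "pdim B X = int (card X) - (\<Sum>C\<in>cliques B. int (premult B C * (card (C \<inter> X) - 2)))"
    using pdim_eq[OF B subset_refl assms] by simp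
  also have "(\<Sum>C\<in>cliques B. int (premult B C * (card (C \<inter> X) - 2))) =
             (\<Sum>C\<in>cliques B. \<Sum>j\<in>{..<premult B C}. int (card (C \<inter> X) - 2))"
    by (simp only: sum_constant card_lessThan of_nat_mult)
  also have "\<dots> = (\<Sum>i\<in>copies. int (card (fst i \<inter> X) - 2))"
    unfolding copies_def using finite_cliques[OF B]
    by (subst sum.Sigma) (auto simp: case_prod_beta)
  finally show ?thesis .
qed

text \<open>The inequality \<open>d(A) \<le> d(A \<union> Z)\<close> written out: each point of \<open>Z\<close> on an old copy costs one, and a
  new copy costs its excess over two, which is zero if it meets \<open>A \<union> Z\<close> in at most two points.\<close>

lemma strong_count:
  assumes Z: "Z \<subseteq> spts B - A"
  shows "(\<Sum>i\<in>old_copies. card (fst i \<inter> Z)) + (\<Sum>i\<in>new_copies. card (fst i \<inter> (A \<union> Z)) - 2) \<le> card Z"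
proof -
  have fZ: "finite Z" using Z B(2) by (meson finite_Diff finite_subset)
  have AZ: "A \<union> Z \<subseteq> spts B" using Z finA by auto
  have "pdim B A \<le> pdim B (A \<union> Z)"
    using AB AZ finA(1) fZ unfolding sstrong_iff by blast
  moreover have "card (A \<union> Z) = card A + card Z"
    using Z finA(1) fZ by (intro card_Un_disjoint) auto
  ultimately have "(\<Sum>i\<in>copies. int (card (fst i \<inter> (A \<union> Z)) - 2)) \<le>
      int (card Z) + (\<Sum>i\<in>copies. int (card (trace i) - 2))"
    using pdim_copies[OF AZ] pdim_copies[OF finA(2)] by simp
  hence "(\<Sum>i\<in>copies. card (fst i \<inter> (A \<union> Z)) - 2) \<le> card Z + (\<Sum>i\<in>copies. card (trace i) - 2)"
    unfolding of_nat_sum[symmetric] by linarith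
  moreover have "(\<Sum>i\<in>copies. F i) = (\<Sum>i\<in>old_copies. F i) + (\<Sum>i\<in>new_copies. F i)"
    for F :: "'b set \<times> nat \<Rightarrow> nat"
    unfolding copies_split(1) using copies_split by (intro sum.union_disjoint) auto
  moreover have "(\<Sum>i\<in>new_copies. card (trace i) - 2) = 0"
    by (auto simp: new_copies_def)
  moreover have "(\<Sum>i\<in>old_copies. card (fst i \<inter> (A \<union> Z)) - 2) =
      (\<Sum>i\<in>old_copies. card (fst i \<inter> Z)) + (\<Sum>i\<in>old_copies. card (trace i) - 2)"
    unfolding sum.distrib[symmetric]
  proof (rule sum.cong[OF refl])
    fix i assume i: "i \<in> old_copies"
    have "card (fst i \<inter> (A \<union> Z)) = card (trace i) + card (fst i \<inter> Z)"
      unfolding Int_Un_distrib using Z finA(1) fZ by (intro card_Un_disjoint) auto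
    moreover have "3 \<le> card (trace i)" using i by (simp add: old_copies_def)
    ultimately show "card (fst i \<inter> (A \<union> Z)) - 2 = card (fst i \<inter> Z) + (card (trace i) - 2)" by simp
  qed
  ultimately show ?thesis by simp
qed

text \<open>The trace on \<open>A\<close> of the clique defined by the pair \<open>p\<close>, pulled back along \<open>g\<close>.\<close>

definition base_trace :: "'m set \<Rightarrow> 'b set" where
  "base_trace p = {a \<in> A. g a \<in> nb M p}"

lemma old_bijection:
  obtains \<pi> where "bij_betw \<pi> old_copies {p \<in> pairs M. 3 \<le> card (base_trace p)}"
    "\<And>i. i \<in> old_copies \<Longrightarrow> base_trace (\<pi> i) = trace i"
proof -
  have P: "{p \<in> pairs M. X \<subseteq> base_trace p} = {p \<in> pairs M. g ` X \<subseteq> nb M p}" if "X \<subseteq> A" for X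
    using that by (auto simp: base_trace_def)
  have fX: "finite (g ` X)" "card (g ` X) = card X" if "X \<subseteq> A" for X
    using that finA(1) g(1) by (auto intro: finite_subset simp: card_image inj_on_subset)
  obtain \<pi> where \<pi>: "bij_betw \<pi> {i \<in> copies. 3 \<le> card (trace i)} {p \<in> pairs M. 3 \<le> card (base_trace p)}"
    "\<And>i. i \<in> copies \<Longrightarrow> 3 \<le> card (trace i) \<Longrightarrow> base_trace (\<pi> i) = trace i"
  proof (rule fibrewise_bijection[OF finA(1), of "\<lambda>i. fst i \<inter> A" base_trace copies "pairs M"])
    fix X assume X: "X \<subseteq> A" "3 \<le> card X"
    show "finite {i \<in> copies. X \<subseteq> trace i} \<and> finite {j \<in> pairs M. X \<subseteq> base_trace j}"
      using finite_copies finite_pairs_above[OF fX(1)[OF X(1)]] fX(2) X by (simp add: P)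
    have "{i \<in> copies. X \<subseteq> trace i} = {i \<in> copies. X \<subseteq> fst i}" using X(1) by auto
    hence "card {i \<in> copies. X \<subseteq> trace i} = mult B X"
      using mult_copies[of X] X finA by simp
    also have "\<dots> = mult (s_reduct M) (g ` X)" using gm X(1) by simp
    also have "\<dots> = card {j \<in> pairs M. X \<subseteq> base_trace j}"
      using mult_s_reduct[OF fX(1)[OF X(1)]] fX(2) X by (simp add: P)
    finally show "card {i \<in> copies. X \<subseteq> trace i} = card {j \<in> pairs M. X \<subseteq> base_trace j}" .
  qed (auto simp: base_trace_def)
  thus ?thesis using that unfolding old_copies_def by simp
qed

end

locale amalgam = amalgamation M B A g Abar
  for M :: "'m::infinite rstruct" and B :: "'b sstruct" and A g Abar +
  fixes \<pi> :: "'b set \<times> nat \<Rightarrow> 'm set"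
  assumes \<pi>: "bij_betw \<pi> old_copies {p \<in> pairs M. 3 \<le> card (base_trace p)}"
    and \<pi>_trace: "\<And>i. i \<in> old_copies \<Longrightarrow> base_trace (\<pi> i) = trace i"
begin

text \<open>The pair whose common neighbours will form the given copy: an existing pair of the strong set for an old
  copy, and two new points for a new one.\<close>

definition apexes :: "'b set \<times> nat \<Rightarrow> ('m, 'b) amalg set" where
  "apexes i = (if i \<in> old_copies then Old ` \<pi> i else {Apex i True, Apex i False})"

definition emb :: "'b \<Rightarrow> ('m, 'b) amalg" where
  "emb c = (if c \<in> A then Old (g c) else New c)"

definition cone :: "'b set \<times> nat \<Rightarrow> 'b \<Rightarrow> ('m, 'b) amalg set" where
  "cone i c = insert (emb c) (apexes i)"

definition T :: "('m, 'b) amalg set set" where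
  "T = (`) Old ` {t \<in> triples M. t \<subseteq> Abar} \<union> {cone i c | i c. i \<in> copies \<and> c \<in> fst i}"

definition V :: "('m, 'b) amalg set" where
  "V = Old ` Abar \<union> New ` (spts B - A) \<union> (\<lambda>(i, b). Apex i b) ` (new_copies \<times> UNIV)"

abbreviation W :: "('m, 'b) amalg rstruct" where "W \<equiv> hypergraph V T"

lemma finAbar: "finite Abar" "Abar \<subseteq> rpts M"
  using Abar by (auto simp: rstrong_def)

lemma inj_Old: "inj_on Old X"
  by (auto intro: inj_onI)

text \<open>Pairs with three common neighbours in the strong set lie inside it; this is why \<open>A\<close> has to be
  enlarged to a strong set before amalgamating.\<close>

lemma \<pi>_pair:
  assumes i: "i \<in> old_copies"
  shows "card (\<pi> i) = 2" "\<pi> i \<subseteq> Abar"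
proof -
  have p: "\<pi> i \<in> pairs M" "3 \<le> card (base_trace (\<pi> i))" using bij_betwE[OF \<pi>] i by blast+
  show "card (\<pi> i) = 2" using p(1) by (simp add: pairs_def)
  have "card (base_trace (\<pi> i)) = card (g ` base_trace (\<pi> i))"
    using g(1) by (intro card_image[symmetric] inj_on_subset[OF g(1)]) (auto simp: base_trace_def)
  also have "\<dots> \<le> card (nb M (\<pi> i) \<inter> Abar)"
    using g(2) finAbar(1) by (intro card_mono) (auto simp: base_trace_def)
  finally show "\<pi> i \<subseteq> Abar"
    using p pair_in_strong[OF rstructure Abar] by simp
qed

lemma apexes_old: "i \<in> old_copies \<Longrightarrow> apexes i = Old ` \<pi> i"
  by (simp add: apexes_def)

lemma apexes_new: "i \<in> new_copies \<Longrightarrow> apexes i = {Apex i True, Apex i False}"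
  using copies_split(2) by (auto simp: apexes_def)

lemma copies_cases:
  assumes "i \<in> copies"
  obtains (old) "i \<in> old_copies" "apexes i = Old ` \<pi> i"
  | (new) "i \<in> new_copies" "apexes i = {Apex i True, Apex i False}"
  using assms apexes_old apexes_new copies_split(1) by blast

lemma card_apexes: "i \<in> copies \<Longrightarrow> card (apexes i) = 2"
  by (erule copies_cases) (simp_all add: card_image[OF inj_Old] \<pi>_pair)

lemma apexes_V: "i \<in> copies \<Longrightarrow> apexes i \<subseteq> V"
  by (erule copies_cases) (auto simp: V_def dest: subsetD[OF \<pi>_pair(2)])

lemma New_notin_apexes: "i \<in> copies \<Longrightarrow> New c \<notin> apexes i"
  by (erule copies_cases) auto

lemma emb_not_Apex: "emb c \<noteq> Apex i b"
  by (simp add: emb_def)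

lemma emb_V: "c \<in> spts B \<Longrightarrow> emb c \<in> V"
  using g(2) by (auto simp: emb_def V_def)

lemma inj_emb: "inj_on emb (spts B)"
  using g(1) by (auto intro!: inj_onI simp: emb_def dest: inj_onD split: if_splits)

lemma emb_eq_New: "emb c = New d \<longleftrightarrow> c \<notin> A \<and> c = d"
  by (auto simp: emb_def)

lemma old_base:
  assumes "i \<in> old_copies" "c \<in> fst i" "c \<in> A"
  shows "insert (g c) (\<pi> i) \<in> triples M"
proof -
  have "c \<in> base_trace (\<pi> i)" using \<pi>_trace[OF assms(1)] assms by blast
  thus ?thesis by (simp add: base_trace_def nb_def)
qed

lemma emb_notin_apexes:
  assumes "i \<in> copies" "c \<in> fst i"
  shows "emb c \<notin> apexes i"
  using assms(1)
proof (cases rule: copies_cases)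
  case old
  show ?thesis
  proof (cases "c \<in> A")
    case True
    have "g c \<notin> \<pi> i"
      using nb_not_in_pair(1)[OF rstructure \<pi>_pair(1)[OF old(1)], of "g c"]
        old_base[OF old(1) assms(2) True] by (simp add: nb_def)
    thus ?thesis using old True by (auto simp: emb_def)
  qed (use old in \<open>auto simp: emb_def\<close>)
qed (simp add: emb_not_Apex)

lemma T_cases:
  assumes "t \<in> T"
  obtains (base) s where "s \<in> triples M" "s \<subseteq> Abar" "t = Old ` s"
  | (cone) i c where "i \<in> copies" "c \<in> fst i" "t = insert (emb c) (apexes i)"
  using assms unfolding T_def cone_def by blast

lemma T_triples: "t \<in> T \<Longrightarrow> t \<subseteq> V \<and> card t = 3"
proof -
  assume "t \<in> T"
  thus ?thesis
  proof (cases rule: T_cases)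
    case base
    thus ?thesis using tripleD(2)[OF rstructure] by (auto simp: V_def card_image[OF inj_Old])
  next
    case 2: (cone i c)
    have "finite (apexes i)" using card_apexes[OF 2(1)] by (metis card.infinite zero_neq_numeral)
    hence "card t = 3"
      using 2 card_apexes emb_notin_apexes by simp
    moreover have "emb c \<in> V" using emb_V copies_fst[OF 2(1)] 2(2) by blast
    ultimately show ?thesis using 2(3) apexes_V[OF 2(1)] by simp
  qed
qed

lemma W_rstructure: "rstructure W" and W_triples: "triples W = T"
  using hypergraph_rstructure[of T V] T_triples by blast+

lemma inj_apexes: "inj_on apexes copies"
proof (rule inj_onI)
  fix i j assume ij: "i \<in> copies" "j \<in> copies" "apexes i = apexes j"
  show "i = j"
    using ij(1)
  proof (cases rule: copies_cases)
    case i: old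
    show ?thesis using ij(2)
    proof (cases rule: copies_cases)
      case j: old
      have "\<pi> i = \<pi> j" using i j ij(3) by (simp add: inj_image_eq_iff[OF inj_Old])
      thus ?thesis using \<pi> i(1) j(1) by (auto simp: bij_betw_def dest: inj_onD)
    next
      case new
      hence "Apex j True \<in> Old ` \<pi> i" using i ij(3) by auto
      thus ?thesis by auto
    qed
  next
    case i: new
    hence "Apex i True \<in> apexes j" using ij(3) by simp
    with ij(2) show ?thesis by (elim copies_cases) auto
  qed
qed

lemma cone_in_T: "i \<in> copies \<Longrightarrow> c \<in> fst i \<Longrightarrow> insert (emb c) (apexes i) \<in> T"
  unfolding T_def cone_def by blast

lemma old_triple_iff:
  assumes "t \<subseteq> Abar"
  shows "Old ` t \<in> T \<longleftrightarrow> t \<in> triples M"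
proof
  assume "Old ` t \<in> T"
  thus "t \<in> triples M"
  proof (cases rule: T_cases)
    case (base s)
    have "t = s" using base(3) by (simp only: inj_image_eq_iff[OF inj_Old])
    thus ?thesis using base(1) by simp
  next
    case 2: (cone i c)
    from 2(1) show ?thesis
    proof (cases rule: copies_cases)
      case old
      have "emb c \<in> Old ` t" using 2(3) by blast
      hence c: "c \<in> A" by (auto simp: emb_def split: if_splits)
      have "(Old ` t :: ('m, 'b) amalg set) = Old ` insert (g c) (\<pi> i)" using 2(3) old(2) c by (simp add: emb_def)
      hence "t = insert (g c) (\<pi> i)" by (simp only: inj_image_eq_iff[OF inj_Old])
      thus ?thesis using old_base[OF old(1) 2(2) c] by simp
    next
      case new
      hence "Apex i True \<in> Old ` t" using 2(3) by simp
      thus ?thesis by auto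
    qed
  qed
next
  assume "t \<in> triples M"
  thus "Old ` t \<in> T" unfolding T_def using assms by blast
qed

lemma New_triple:
  assumes "New c \<in> t" "t \<in> T"
  obtains i where "i \<in> copies" "c \<in> fst i" "t = insert (New c) (apexes i)" "c \<notin> A"
proof -
  obtain i d where i: "i \<in> copies" "d \<in> fst i" "t = insert (emb d) (apexes i)"
    using assms(2) by (rule T_cases) (use assms(1) in auto)
  have d: "emb d = New c" using i(3) assms(1) New_notin_apexes[OF i(1), of c] by auto
  hence "d = c" "c \<notin> A" by (auto simp: emb_eq_New)
  thus ?thesis using that[OF i(1)] i(2,3) d by simp
qed

lemma Apex_triple:
  assumes "Apex i b \<in> t" "t \<in> T"
  obtains c where "i \<in> new_copies" "c \<in> fst i" "t = {emb c, Apex i True, Apex i False}"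
proof -
  obtain j c where j: "j \<in> copies" "c \<in> fst j" "t = insert (emb c) (apexes j)"
    using assms(2) by (rule T_cases) (use assms(1) in auto)
  have "Apex i b \<in> apexes j" using assms(1) j(3) emb_not_Apex by (metis insertE)
  with j(1) have "j \<in> new_copies \<and> j = i" by (elim copies_cases) auto
  hence i: "i \<in> new_copies" "j = i" by blast+
  show ?thesis
    by (rule that[OF i(1)]) (use j i(2) apexes_new[OF i(1)] in simp_all)
qed

text \<open>The apexes of a copy have no neighbour in \<open>B\<close> off the clique. Through a point of \<open>B - A\<close>, or if the
  copy is new, the triple determines the copy it was made for; over \<open>A\<close>, old copies have the right trace by
  the choice of \<open>\<pi>\<close>.\<close>

lemma nb_apexes:
  assumes i: "i \<in> copies" and c: "c \<in> spts B" and t: "insert (emb c) (apexes i) \<in> T"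
  shows "c \<in> fst i"
proof (cases "c \<in> A")
  case False
  hence "New c \<in> insert (emb c) (apexes i)" by (simp add: emb_def)
  then obtain j where j: "j \<in> copies" "c \<in> fst j" "insert (New c) (apexes i) = insert (New c) (apexes j)"
    using New_triple[OF _ t] False by (metis emb_eq_New)
  have "apexes i = apexes j"
    using j New_notin_apexes[OF i, of c] New_notin_apexes[OF j(1), of c] by (metis Diff_insert_absorb)
  hence "i = j" using inj_onD[OF inj_apexes] i j(1) by blast
  thus ?thesis using j by simp
next
  case True
  from i show ?thesis
  proof (cases rule: copies_cases)
    case old
    have "insert (emb c) (apexes i) = Old ` insert (g c) (\<pi> i)"
      using old True by (simp add: emb_def)
    moreover have "insert (g c) (\<pi> i) \<subseteq> Abar" using True g(2) \<pi>_pair(2)[OF old(1)] by auto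
    ultimately have "insert (g c) (\<pi> i) \<in> triples M" using t old_triple_iff by metis
    hence "c \<in> base_trace (\<pi> i)" using True by (simp add: base_trace_def nb_def)
    thus ?thesis using \<pi>_trace[OF old(1)] by simp
  next
    case new
    hence "Apex i True \<in> insert (emb c) (apexes i)" by simp
    then obtain d where d: "d \<in> fst i" "insert (emb c) (apexes i) = insert (emb d) (apexes i)"
      using Apex_triple[OF _ t] new(2) by metis
    have "emb c \<notin> apexes i" using new(2) by (simp add: emb_not_Apex)
    moreover have "emb d \<notin> apexes i" using new(2) by (simp add: emb_not_Apex)
    ultimately have "emb c = emb d" using d(2) by blast
    thus ?thesis using inj_onD[OF inj_emb, of c d] c d(1) copies_fst[OF i] by blast
  qed
qed

text \<open>A new point lying on two old copies would cost two relations over \<open>A\<close> and so contradict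
  \<open>A \<le>\<^sub>s B\<close>.\<close>

lemma apexes_unique_at_new:
  assumes "c \<in> spts B - A" "i \<in> old_copies" "j \<in> old_copies" "c \<in> fst i" "c \<in> fst j"
  shows "i = j"
proof (rule ccontr)
  assume "i \<noteq> j"
  hence "2 = (\<Sum>k\<in>{i,j}. card (fst k \<inter> {c}))" using assms by simp
  also have "\<dots> \<le> (\<Sum>k\<in>old_copies. card (fst k \<inter> {c}))"
    by (rule sum_mono2) (use assms copies_split in auto)
  also have "\<dots> \<le> card {c}" using strong_count[of "{c}"] assms(1) by simp
  finally show False by simp
qed

text \<open>No other pair has three common neighbours in the copy of \<open>B\<close>. A pair containing a
  new point \<open>c\<close> and a point \<open>y\<close> could have them only if \<open>c\<close> lay on several old
  cliques, which \<open>A \<le> B\<close> forbids.\<close>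

lemma pair_with_three_nbrs:
  assumes p: "p \<subseteq> V" "card p = 2" and X: "X \<subseteq> spts B" "3 \<le> card X"
    and nb: "\<And>c. c \<in> X \<Longrightarrow> insert (emb c) p \<in> T"
  obtains i where "i \<in> copies" "p = apexes i" "X \<subseteq> fst i"
proof -
  have fp: "finite p" using p(2) by (metis card.infinite zero_neq_numeral)
  have fX: "finite X" using X by (metis card.infinite not_numeral_le_zero)
  have np: "emb c \<notin> p" if "c \<in> X" for c
    using T_triples[OF nb[OF that]] p(2) by (auto simp: insert_absorb)
  have "\<exists>i\<in>copies. p = apexes i"
  proof -
    have "x \<in> Old ` Abar" if "x \<in> p" "\<forall>c. New c \<notin> p" "\<forall>i b. Apex i b \<notin> p" for x
      using that p(1) unfolding V_def by (cases x) auto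
    then consider (new) c0 where "New c0 \<in> p" | (apex) i b where "Apex i b \<in> p"
      | (old) "p \<subseteq> Old ` Abar"
      by blast
    thus ?thesis
    proof cases
      case (new c0)
      then obtain y where y: "p = {New c0, y}" "y \<noteq> New c0"
        using p(2) by (metis card_2_iff doubleton_eq_iff insertE singletonD)
      have each: "\<exists>i\<in>old_copies. c0 \<in> fst i \<and> apexes i = {emb c, y}" if c: "c \<in> X" for c
      proof -
        have "New c0 \<in> insert (emb c) p" using new by simp
        from this nb[OF c] obtain i where i: "i \<in> copies" "c0 \<in> fst i"
          "insert (emb c) p = insert (New c0) (apexes i)" "c0 \<notin> A" by (rule New_triple)
        have eq: "apexes i = {emb c, y}"
        proof -
          have "insert (New c0) (apexes i) = insert (New c0) {emb c, y}" using i(3) y(1) by auto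
          moreover have "New c0 \<notin> {emb c, y}" using np[OF c] y by auto
          ultimately show ?thesis using New_notin_apexes[OF i(1)] by (metis Diff_insert_absorb)
        qed
        from i(1) have "i \<in> old_copies"
        proof (cases rule: copies_cases)
          case new
          have "emb c \<in> apexes i" using eq by simp
          thus ?thesis using new(2) emb_not_Apex by auto
        qed
        thus ?thesis using i(2) eq by blast
      qed
      \<comment> \<open>Already two elements of \<open>X\<close> yield two old copies through \<open>c0\<close>.\<close>
      have c0: "c0 \<in> spts B - A"
        using new p(1) unfolding V_def by auto
      obtain c d where cd: "c \<in> X" "d \<in> X" "c \<noteq> d"
      proof -
        have "2 \<le> card X" using X(2) by simp
        thus ?thesis using that by (metis card_le_Suc0_iff_eq[OF fX] not_less_eq_eq numeral_2_eq_2)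
      qed
      obtain i j where ij: "i \<in> old_copies" "c0 \<in> fst i" "apexes i = {emb c, y}"
        "j \<in> old_copies" "c0 \<in> fst j" "apexes j = {emb d, y}"
        using each[OF cd(1)] each[OF cd(2)] by blast
      have "i = j" using apexes_unique_at_new[OF c0 ij(1,4,2,5)] .
      hence "{emb c, y} = {emb d, y}" using ij by simp
      hence "emb c = emb d" by (metis doubleton_eq_iff)
      thus ?thesis using inj_onD[OF inj_emb] cd X(1) by blast
    next
      case (apex i b)
      have "X \<noteq> {}" using X(2) by auto
      then obtain c where c: "c \<in> X" by blast
      have "Apex i b \<in> insert (emb c) p" using apex by simp
      from this nb[OF c] obtain d where d: "i \<in> new_copies" 
        "insert (emb c) p = {emb d, Apex i True, Apex i False}" by (rule Apex_triple)
      have "{Apex i True, Apex i False} \<subseteq> p"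
        using d(2) emb_not_Apex[of c i] by (metis insertE insert_subset empty_subsetI insertI1 insertI2)
      moreover have "card {Apex i True, Apex i False :: ('m, 'b) amalg} = 2" by simp
      ultimately have "p = {Apex i True, Apex i False}"
        using card_subset_eq[OF fp] p(2) by metis
      thus ?thesis using d(1) apexes_new copies_split(1) by blast
    next
      case old
      then obtain p' where p': "p' \<subseteq> Abar" "p = Old ` p'" by (metis subset_imageE)
      show ?thesis
      proof (cases "X \<subseteq> A")
        case True
        have "c \<in> base_trace p'" if c: "c \<in> X" for c
        proof -
          have "Old ` insert (g c) p' \<in> T" using nb[OF c] True c p'(2) by (auto simp: emb_def)
          moreover have "insert (g c) p' \<subseteq> Abar" using True c g(2) p'(1) by blast
          ultimately have "insert (g c) p' \<in> triples M" using old_triple_iff by blast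
          thus ?thesis using c True by (auto simp: base_trace_def nb_def)
        qed
        hence "card X \<le> card (base_trace p')"
          using finA(1) by (intro card_mono) (auto simp: base_trace_def)
        moreover have "p' \<in> pairs M"
          using p' p(2) finAbar(2) by (auto simp: pairs_def card_image[OF inj_Old])
        ultimately have "p' \<in> \<pi> ` old_copies" using \<pi> X(2) by (auto simp: bij_betw_def)
        thus ?thesis using p'(2) apexes_old copies_split(1) by fastforce
      next
        case False
        then obtain c where c: "c \<in> X" "c \<notin> A" by blast
        have "New c \<in> insert (emb c) p" using c(2) by (simp add: emb_def)
        from this nb[OF c(1)] obtain i where i: "i \<in> copies"
          "insert (emb c) p = insert (New c) (apexes i)" by (rule New_triple)
        have "emb c = New c" using c(2) by (simp add: emb_def)
        hence "p = apexes i"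
          using i(2) np[OF c(1)] New_notin_apexes[OF i(1), of c] by (metis Diff_insert_absorb)
        thus ?thesis using i(1) by blast
      qed
    qed
  qed
  then obtain i where i: "i \<in> copies" "p = apexes i" by blast
  moreover have "X \<subseteq> fst i" using nb_apexes[OF i(1)] nb X(1) i(2) by blast
  ultimately show ?thesis using that by blast
qed

end

context amalgam begin

lemma rdim_old: "Y \<subseteq> Abar \<Longrightarrow> rdim W (Old ` Y) = rdim M Y"
  using old_triple_iff by (intro rdim_image[OF inj_Old]) (auto simp: W_triples)

lemma finite_V: "finite V"
  using finAbar(1) B(2) copies_split(4) unfolding V_def by simp

text \<open>A set \<open>Y\<close> over the strong set contains some points \<open>Z\<close> of \<open>B - A\<close> and both apexes of some new
  copies \<open>J\<close>. The two apexes of a copy in \<open>J\<close> pay for two of its relations; what remains is bounded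
  by \<open>card Z\<close> according to \<open>strong_count\<close>.\<close>

lemma old_strong: "rstrong (Old ` Abar) W"
  unfolding rstrong_iff
proof (intro conjI allI impI)
  show "finite (Old ` Abar)" "Old ` Abar \<subseteq> rpts W" using finAbar(1) by (auto simp: V_def)
  fix Y assume Y: "finite Y \<and> Old ` Abar \<subseteq> Y \<and> Y \<subseteq> rpts W"
  define Z where "Z = {c \<in> spts B - A. New c \<in> Y}"
  define J where "J = {i \<in> new_copies. apexes i \<subseteq> Y}"
  define T0 where "T0 = {t \<in> triples M. t \<subseteq> Abar}"
  have fin: "finite Z" "finite J" "finite T0"
    using B(2) copies_split(4) finAbar(1) finite_triples_within
    unfolding Z_def J_def T0_def by auto
  have fAZ: "finite (A \<union> Z)" using finA(1) fin(1) by simp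
  let ?R0 = "(`) Old ` T0 :: ('m, 'b) amalg set set"
  let ?R1 = "\<Union>i\<in>old_copies. cone i ` (fst i \<inter> Z)"
  let ?R2 = "\<Union>i\<in>J. cone i ` (fst i \<inter> (A \<union> Z))"
  have "{t \<in> triples W. t \<subseteq> Y} \<subseteq> ?R0 \<union> (?R1 \<union> ?R2)"
  proof
    fix t assume "t \<in> {t \<in> triples W. t \<subseteq> Y}"
    hence t: "t \<in> T" "t \<subseteq> Y" by (auto simp: W_triples)
    show "t \<in> ?R0 \<union> (?R1 \<union> ?R2)"
    proof (cases "t \<subseteq> Old ` Abar")
      case True
      then obtain s where s: "s \<subseteq> Abar" "t = Old ` s" by (metis subset_imageE)
      have "s \<in> triples M" using old_triple_iff[OF s(1)] t(1) s(2) by simp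
      thus ?thesis using s unfolding T0_def by simp
    next
      case False
      then obtain i c where i: "i \<in> copies" "c \<in> fst i" "t = cone i c"
        using t(1) unfolding T_def by blast
      have cZ: "c \<in> A \<union> Z"
        using i t(2) copies_fst[OF i(1)] by (auto simp: Z_def emb_def cone_def)
      from i(1) show ?thesis
      proof (cases rule: copies_cases)
        case old
        have "c \<notin> A"
        proof
          assume "c \<in> A"
          hence "emb c \<in> Old ` Abar" "apexes i \<subseteq> Old ` Abar"
            using g(2) \<pi>_pair(2)[OF old(1)] old(2) by (auto simp: emb_def)
          thus False using False i(3) by (auto simp: cone_def)
        qed
        thus ?thesis using cZ i old(1) by blast
      next
        case new
        hence "i \<in> J" using t(2) i(3) by (simp add: J_def cone_def)
        thus ?thesis using cZ i by blast
      qed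
    qed
  qed
  moreover have fR: "finite ?R1" "finite ?R2"
    using copies_split(3) fin fAZ by auto
  ultimately have "card {t \<in> triples W. t \<subseteq> Y} \<le> card (?R0 \<union> (?R1 \<union> ?R2))"
    using fin(3) by (intro card_mono) auto
  also have "\<dots> \<le> card ?R0 + (card ?R1 + card ?R2)"
    by (rule order_trans[OF card_Un_le add_left_mono[OF card_Un_le]])
  also have "\<dots> \<le> card T0 + ((\<Sum>i\<in>old_copies. card (fst i \<inter> Z)) + (\<Sum>i\<in>J. card (fst i \<inter> (A \<union> Z))))"
  proof (intro add_mono card_image_le fin(3))
    show "card ?R1 \<le> (\<Sum>i\<in>old_copies. card (fst i \<inter> Z))"
      by (rule order_trans[OF card_UN_le[OF copies_split(3)] sum_mono[OF card_image_le]]) (use fin in auto)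
    show "card ?R2 \<le> (\<Sum>i\<in>J. card (fst i \<inter> (A \<union> Z)))"
      by (rule order_trans[OF card_UN_le[OF fin(2)] sum_mono[OF card_image_le]]) (use fAZ in auto)
  qed
  finally have cT: "card {t \<in> triples W. t \<subseteq> Y} \<le> card T0 +
      ((\<Sum>i\<in>old_copies. card (fst i \<inter> Z)) + (\<Sum>i\<in>J. card (fst i \<inter> (A \<union> Z))))" .
  have "(\<Sum>i\<in>J. card (fst i \<inter> (A \<union> Z))) \<le> (\<Sum>i\<in>J. card (fst i \<inter> (A \<union> Z)) - 2) + 2 * card J"
  proof -
    have "(\<Sum>i\<in>J. card (fst i \<inter> (A \<union> Z))) \<le> (\<Sum>i\<in>J. (card (fst i \<inter> (A \<union> Z)) - 2) + 2)"
      by (rule sum_mono) simp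
    also have "\<dots> = (\<Sum>i\<in>J. card (fst i \<inter> (A \<union> Z)) - 2) + (\<Sum>i\<in>J. 2)"
      by (rule sum.distrib)
    finally show ?thesis by simp
  qed
  moreover have "(\<Sum>i\<in>J. card (fst i \<inter> (A \<union> Z)) - 2) \<le> (\<Sum>i\<in>new_copies. card (fst i \<inter> (A \<union> Z)) - 2)"
    using copies_split(4) by (intro sum_mono2) (auto simp: J_def)
  moreover have "(\<Sum>i\<in>old_copies. card (fst i \<inter> Z)) +
      (\<Sum>i\<in>new_copies. card (fst i \<inter> (A \<union> Z)) - 2) \<le> card Z"
    by (rule strong_count) (auto simp: Z_def)
  ultimately have cT': "card {t \<in> triples W. t \<subseteq> Y} \<le> card T0 + card Z + 2 * card J"
    using cT by linarith
  have "card Abar + (card Z + 2 * card J) \<le> card Y"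
  proof -
    let ?P = "(\<lambda>(i, b). Apex i b) ` (J \<times> (UNIV :: bool set)) :: ('m, 'b) amalg set"
    let ?O = "Old ` Abar :: ('m, 'b) amalg set" and ?N = "New ` Z :: ('m, 'b) amalg set"
    have "card (?O \<union> (?N \<union> ?P)) = card ?O + card (?N \<union> ?P)"
      using fin finAbar(1) by (intro card_Un_disjoint) auto
    moreover have "card (?N \<union> ?P) = card ?N + card ?P"
      using fin by (intro card_Un_disjoint) auto
    moreover have "card ?O = card Abar" by (rule card_image[OF inj_Old])
    moreover have "card ?N = card Z" by (rule card_image) (auto intro: inj_onI)
    moreover have "card ?P = card (J \<times> (UNIV :: bool set))" by (rule card_image) (auto intro: inj_onI)
    moreover have "card (J \<times> (UNIV :: bool set)) = 2 * card J" by (simp add: card_cartesian_product)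
    moreover have "?O \<union> (?N \<union> ?P) \<subseteq> Y"
    proof -
      have "Apex i b \<in> Y" if i: "i \<in> J" for i b
      proof -
        have "i \<in> new_copies" "apexes i \<subseteq> Y" using i unfolding J_def by simp_all
        hence "Apex i True \<in> Y \<and> Apex i False \<in> Y" by (simp only: apexes_new insert_subset)
        thus ?thesis by (cases b) (simp_all only:)
      qed
      hence "?P \<subseteq> Y" by (intro image_subsetI) auto
      moreover have "?N \<subseteq> Y" unfolding Z_def by blast
      ultimately show ?thesis using Y by simp
    qed
    ultimately show ?thesis using Y card_mono[of Y "?O \<union> (?N \<union> ?P)"] by simp
  qed
  moreover have "rdim W (Old ` Abar) = int (card Abar) - int (card T0)"
    unfolding rdim_old[OF subset_refl] by (simp add: rdim_def T0_def)
  ultimately show "rdim W (Old ` Abar) \<le> rdim W Y"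
    using cT' unfolding rdim_def[of W Y] by linarith
qed

text \<open>Submodularity reduces this to supersets and to subsets of the strong set.\<close>

lemma rdim_W_nonneg: "Y \<subseteq> V \<Longrightarrow> 0 \<le> rdim W Y"
proof -
  assume Y: "Y \<subseteq> V"
  have fY: "finite Y" using Y finite_V by (rule finite_subset)
  have OV: "Old ` Abar \<subseteq> V" by (auto simp: V_def)
  have "finite (Y \<union> Old ` Abar) \<and> Old ` Abar \<subseteq> Y \<union> Old ` Abar \<and> Y \<union> Old ` Abar \<subseteq> rpts W"
    using fY finAbar(1) Y OV by simp
  hence "rdim W (Old ` Abar) \<le> rdim W (Y \<union> Old ` Abar)"
    using old_strong unfolding rstrong_iff by metis
  moreover obtain Y' where Y': "Y' \<subseteq> Abar" "Y \<inter> Old ` Abar = Old ` Y'"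
    by (metis inf_le2 subset_imageE)
  moreover have "0 \<le> rdim M Y'"
    using Y'(1) finAbar by (intro rdim_nonneg) (auto intro: finite_subset)
  moreover have "rdim W (Y \<union> Old ` Abar) + rdim W (Y \<inter> Old ` Abar) \<le> rdim W Y + rdim W (Old ` Abar)"
    using fY finAbar(1) by (intro rdim_submodular) auto
  ultimately show ?thesis using rdim_old[OF Y'(1)] by simp
qed

text \<open>As the image of \<open>W\<close> is strong, all pairs of \<open>M\<close> that have three common neighbours in the copy of
  \<open>B\<close> come from \<open>W\<close>, where they are the apexes of the copies of the cliques.\<close>

lemma embedding_exists:
  obtains h where "inj_on h (spts B)" "h ` spts B \<subseteq> rpts M" "\<And>a. a \<in> A \<Longrightarrow> h a = g a"
    "\<And>X. X \<subseteq> spts B \<Longrightarrow> mult (s_reduct M) (h ` X) = mult B X"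
proof -
  obtain f where f: "inj_on f V" "f ` V \<subseteq> rpts M" "\<And>a. a \<in> Abar \<Longrightarrow> f (Old a) = a"
    "rstrong (f ` V) M" "\<And>t. t \<subseteq> V \<Longrightarrow> f ` t \<in> triples M \<longleftrightarrow> t \<in> T"
  proof -
    have "Old ` Abar \<subseteq> V" by (auto simp: V_def)
    thus thesis
      using embed_strong_extension[OF Abar W_rstructure, of Old, unfolded W_triples rpts_hypergraph,
          OF finite_V rdim_W_nonneg inj_Old _ old_triple_iff old_strong] that by metis
  qed
  have embV: "emb ` spts B \<subseteq> V" using emb_V by blast
  have inj: "inj_on (f \<circ> emb) (spts B)"
    by (rule comp_inj_on[OF inj_emb inj_on_subset[OF f(1) embV]])
  have ic: "insert (emb c) q \<subseteq> V" if "c \<in> spts B" "q \<subseteq> V" for c q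
    using that emb_V by blast
  have m: "mult (s_reduct M) ((f \<circ> emb) ` X) = mult B X" if X: "X \<subseteq> spts B" for X
  proof -
    have fX: "finite X" using X B(2) by (rule finite_subset)
    have cX: "card ((f \<circ> emb) ` X) = card X" by (rule card_image[OF inj_on_subset[OF inj X]])
    show ?thesis
    proof (cases "3 \<le> card X")
      case False
      thus ?thesis using fX cX by (simp add: mult_def at_least_3_finite)
    next
      case 3: True
      have "{p \<in> pairs M. (f \<circ> emb) ` X \<subseteq> nb M p} = (\<lambda>i. f ` apexes i) ` {i \<in> copies. X \<subseteq> fst i}"
      proof (intro equalityI subsetI)
        fix p assume "p \<in> {p \<in> pairs M. (f \<circ> emb) ` X \<subseteq> nb M p}"
        hence p: "p \<in> pairs M" "(f \<circ> emb) ` X \<subseteq> nb M p" by auto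
        have "(f \<circ> emb) ` X \<subseteq> f ` V"
          unfolding image_comp[symmetric] using subset_trans[OF image_mono[OF X] embV] by (rule image_mono)
        hence "(f \<circ> emb) ` X \<subseteq> nb M p \<inter> f ` V" using p(2) by blast
        moreover have "finite (nb M p \<inter> f ` V)" using finite_V by simp
        ultimately have "card ((f \<circ> emb) ` X) \<le> card (nb M p \<inter> f ` V)" by (intro card_mono)
        hence "3 \<le> card (nb M p \<inter> f ` V)" using 3 cX by linarith
        hence "p \<subseteq> f ` V" using pair_in_strong[OF rstructure f(4) p(1)] by blast
        then obtain q where q: "q \<subseteq> V" "p = f ` q" by (metis subset_imageE)
        have q2: "card q = 2"
          using p(1) q card_image[OF inj_on_subset[OF f(1) q(1)]] by (simp add: pairs_def)
        have "insert (emb c) q \<in> T" if c: "c \<in> X" for c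
        proof -
          have "f (emb c) \<in> nb M p" using p(2) c by auto
          hence "f ` insert (emb c) q \<in> triples M" using q(2) by (simp add: nb_def)
          thus ?thesis using f(5)[OF ic[OF _ q(1)]] c X by blast
        qed
        then obtain i where "i \<in> copies" "q = apexes i" "X \<subseteq> fst i"
          using pair_with_three_nbrs[OF q(1) q2 X 3] by metis
        thus "p \<in> (\<lambda>i. f ` apexes i) ` {i \<in> copies. X \<subseteq> fst i}" using q(2) by blast
      next
        fix p assume "p \<in> (\<lambda>i. f ` apexes i) ` {i \<in> copies. X \<subseteq> fst i}"
        then obtain i where i: "i \<in> copies" "X \<subseteq> fst i" "p = f ` apexes i" by blast
        have "card p = 2"
          using i(3) card_apexes[OF i(1)] card_image[OF inj_on_subset[OF f(1) apexes_V[OF i(1)]]] by simp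
        moreover have "p \<subseteq> rpts M" using i(3) apexes_V[OF i(1)] f(2) by blast
        moreover have "f (emb c) \<in> nb M p" if c: "c \<in> X" for c
        proof -
          have "insert (emb c) (apexes i) \<in> T" using cone_in_T[OF i(1)] i(2) c by blast
          hence "f ` insert (emb c) (apexes i) \<in> triples M"
            using f(5)[OF ic[OF _ apexes_V[OF i(1)]]] c X by blast
          thus ?thesis using i(3) by (simp add: nb_def)
        qed
        ultimately show "p \<in> {p \<in> pairs M. (f \<circ> emb) ` X \<subseteq> nb M p}" by (auto simp: pairs_def)
      qed
      moreover have "inj_on (\<lambda>i. f ` apexes i) {i \<in> copies. X \<subseteq> fst i}"
      proof (rule inj_onI)
        fix i j assume ij: "i \<in> {i \<in> copies. X \<subseteq> fst i}" "j \<in> {i \<in> copies. X \<subseteq> fst i}"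
          "f ` apexes i = f ` apexes j"
        hence "apexes i = apexes j"
          using inj_on_image_eq_iff[OF f(1) apexes_V apexes_V] by blast
        thus "i = j" using ij inj_onD[OF inj_apexes] by blast
      qed
      moreover have "mult (s_reduct M) ((f \<circ> emb) ` X) = card {p \<in> pairs M. (f \<circ> emb) ` X \<subseteq> nb M p}"
        by (rule mult_s_reduct) (use fX cX 3 in auto)
      ultimately show ?thesis using mult_copies[OF X 3] by (simp add: card_image)
    qed
  qed
  show ?thesis
  proof (rule that[OF inj _ _ m])
    show "(f \<circ> emb) ` spts B \<subseteq> rpts M" using f(2) embV by auto
    show "(f \<circ> emb) a = g a" if "a \<in> A" for a
      using that f(3) g(2) by (auto simp: emb_def)
  qed
qed

end

text \<open>The copy of \<open>A\<close> is enlarged to an \<open>R\<close>-strong set, over which \<open>B\<close> is amalgamated.\<close>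

lemma (in generic) s_extension:
  fixes B :: "'b sstruct"
  assumes "sstructure B" "finite (spts B)" "sstrong A B" "inj_on g A" "g ` A \<subseteq> rpts M"
    and "\<And>X. X \<subseteq> A \<Longrightarrow> mult (s_reduct M) (g ` X) = mult B X"
  obtains h where "inj_on h (spts B)" "h ` spts B \<subseteq> rpts M" "\<And>a. a \<in> A \<Longrightarrow> h a = g a"
    "\<And>X. X \<subseteq> spts B \<Longrightarrow> mult (s_reduct M) (h ` X) = mult B X"
proof -
  have "finite (g ` A)" using assms(3) by (simp add: sstrong_def)
  then obtain Abar where Abar: "g ` A \<subseteq> Abar" "rstrong Abar M"
    using rclosure_exists assms(5) by metis
  interpret amalgamation M B A g Abar
    by unfold_locales (use assms Abar in auto)
  obtain \<pi> where "bij_betw \<pi> old_copies {p \<in> pairs M. 3 \<le> card (base_trace p)}"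
    "\<And>i. i \<in> old_copies \<Longrightarrow> base_trace (\<pi> i) = trace i"
    using old_bijection by metis
  then interpret amalgam M B A g Abar \<pi> by unfold_locales
  show ?thesis using embedding_exists that by blast
qed

section \<open>The reduct satisfies the axioms\<close>

lemma mult_empty [simp]: "mult A {} = 0"
  by (simp add: mult_def at_least_3_def)

lemma spts_F_struct [simp]: "spts (F_struct n) = {..<n}"
  by (simp add: F_struct_def)

lemma mult_F_struct [simp]: "mult (F_struct n) X = 0"
  by (simp add: mult_def F_struct_def)

context generic
begin

lemma pdim_s_reduct_nonneg: "finite D \<Longrightarrow> D \<subseteq> rpts M \<Longrightarrow> 0 \<le> pdim (s_reduct M) D"
  using pdim_s_reduct_ge[OF empty_rstrong no_triple_in_empty, of D] by simp

lemma age_s_reduct: "(age (s_reduct M) :: 'a sstruct set) = sclass"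
proof (intro equalityI subsetI)
  fix A :: "'a sstruct" assume "A \<in> age (s_reduct M)"
  then obtain f where A: "sstructure A" "finite (spts A)" and f: "inj_on f (spts A)"
    "f ` spts A \<subseteq> rpts M" "siso f A (sinduced (s_reduct M) (f ` spts A))"
    unfolding age_def sembedding_def by auto
  have "0 \<le> pdim A D" if D: "D \<subseteq> spts A" for D
  proof -
    have fD: "finite D" using D A(2) by (rule finite_subset)
    have "pdim (s_reduct M) (f ` D) = pdim A D"
    proof (rule pdim_cong_mult[OF A(1) sstructure_s_reduct D fD inj_on_subset[OF f(1) D]])
      show "f ` D \<subseteq> spts (s_reduct M)" using f(2) D by auto
      fix Z assume "Z \<subseteq> D"
      hence Z: "Z \<subseteq> spts A" using D by blast
      have "mult (sinduced (s_reduct M) (f ` spts A)) (f ` Z) = mult (s_reduct M) (f ` Z)"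
        by (rule mult_sinduced[OF sstructure_s_reduct]) (use A(2) f(2) Z in auto)
      thus "mult (s_reduct M) (f ` Z) = mult A Z" using siso_mult[OF f(3) A(1) Z] by simp
    qed
    moreover have "0 \<le> pdim (s_reduct M) (f ` D)"
      by (rule pdim_s_reduct_nonneg) (use fD f(2) D in auto)
    ultimately show ?thesis by simp
  qed
  thus "A \<in> sclass" using A by (simp add: sclass_def sstrong_iff)
next
  fix A :: "'a sstruct" assume "A \<in> sclass"
  hence A: "sstructure A" "finite (spts A)" "sstrong {} A" by (auto simp: sclass_def)
  obtain h where h: "inj_on h (spts A)" "h ` spts A \<subseteq> rpts M"
    "\<And>X. X \<subseteq> spts A \<Longrightarrow> mult (s_reduct M) (h ` X) = mult A X"
    using s_extension[OF A, of undefined] by auto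
  have "siso h A (sinduced (s_reduct M) (h ` spts A))"
  proof (rule siso_of_mult[OF A(1,2)])
    show "sstructure (sinduced (s_reduct M) (h ` spts A))"
      using A(2) h(2) by (intro sstructure_sinduced sstructure_s_reduct) auto
    show "bij_betw h (spts A) (spts (sinduced (s_reduct M) (h ` spts A)))"
      using h(1) by (simp add: bij_betw_def)
    fix X assume X: "X \<subseteq> spts A"
    have "mult (sinduced (s_reduct M) (h ` spts A)) (h ` X) = mult (s_reduct M) (h ` X)"
      by (rule mult_sinduced[OF sstructure_s_reduct]) (use A(2) h(2) X in auto)
    thus "mult (sinduced (s_reduct M) (h ` spts A)) (h ` X) = mult A X" using h(3)[OF X] by simp
  qed
  thus "A \<in> age (s_reduct M)" using A h by (auto simp: age_def sembedding_def)
qed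

end

text \<open>The generic structure and the models of the theory may have points of different types, so the reduct is
  moved to the type of the models.\<close>

locale generic_copy = generic M for M :: "'m::infinite rstruct" +
  fixes e :: "'m \<Rightarrow> 'a::infinite"
  assumes e: "inj_on e (rpts M)"
begin

definition Ns :: "'a sstruct" where
  "Ns = simage e (s_reduct M)"

lemma Ns: "sstructure Ns" "spts Ns = e ` rpts M"
  using sstructure_simage[OF sstructure_s_reduct] e by (auto simp: Ns_def)

lemma lembedding_e: "lembedding e (lstruct_of (s_reduct M)) (lstruct_of Ns)"
  unfolding Ns_def using e by (intro lembedding_simage sstructure_s_reduct) simp

lemma mult_Ns: "Y \<subseteq> rpts M \<Longrightarrow> finite Y \<Longrightarrow> mult Ns (e ` Y) = mult (s_reduct M) Y"
  by (rule lembedding_mult[OF sstructure_s_reduct lembedding_e]) auto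

lemma pdim_Ns: "Y \<subseteq> rpts M \<Longrightarrow> finite Y \<Longrightarrow> pdim Ns (e ` Y) = pdim (s_reduct M) Y"
  by (rule pdim_lembedding[OF sstructure_s_reduct Ns(1) lembedding_e]) auto

lemma Ns_subset:
  assumes "X \<subseteq> spts Ns" "finite X"
  obtains Y where "Y \<subseteq> rpts M" "finite Y" "X = e ` Y"
proof -
  obtain Y where Y: "Y \<subseteq> rpts M" "X = e ` Y" using assms(1) Ns(2) by (metis subset_imageE)
  moreover have "finite Y"
    using finite_imageD[OF _ inj_on_subset[OF e Y(1)]] assms(2) Y(2) by simp
  ultimately show ?thesis using that by blast
qed

lemma embed_in_Ns:
  assumes B: "sstructure B" "finite (spts B)" and h: "inj_on h (spts B)" "h ` spts B \<subseteq> rpts M"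
    "\<And>X. X \<subseteq> spts B \<Longrightarrow> mult (s_reduct M) (h ` X) = mult B X"
  shows "lembedding (e \<circ> h) (lstruct_of B) (lstruct_of Ns)"
proof (rule lembedding_compose[OF _ lembedding_e])
  show "lembedding h (lstruct_of B) (lstruct_of (s_reduct M))"
    by (rule lembedding_of_mult) (use h in auto)
qed

lemma axiom1_Ns: "axiom1 sclass (lstruct_of Ns)"
  unfolding axiom1_def
proof (intro conjI allI impI ballI)
  fix X assume X: "finite X \<and> X \<subseteq> lpts (lstruct_of Ns)"
  hence X': "finite X" "X \<subseteq> spts Ns" by auto
  have "0 \<le> pdim (sinduced Ns X) D" if D: "D \<subseteq> X" for D
  proof -
    have D': "finite D" "D \<subseteq> spts Ns" using D X' by (auto intro: finite_subset)
    obtain Y where Y: "Y \<subseteq> rpts M" "finite Y" "D = e ` Y" using Ns_subset[OF D'(2,1)] .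
    have "pdim (sinduced Ns X) D = pdim (s_reduct M) Y"
      using pdim_sinduced[OF Ns(1) X' D] pdim_Ns[OF Y(1,2)] Y(3) by simp
    thus ?thesis using pdim_s_reduct_nonneg[OF Y(2,1)] by simp
  qed
  hence "sinduced Ns X \<in> sclass"
    using sstructure_sinduced[OF Ns(1) X'] X'(1) by (simp add: sclass_def sstrong_iff)
  moreover have "liso id (lstruct_of (sinduced Ns X)) (linduced (lstruct_of Ns) X)"
    using lembedding_sinduced[OF Ns(1) X'] X by (simp add: liso_linduced_iff)
  ultimately show "\<exists>B\<in>(sclass :: 'a sstruct set). \<exists>f. liso f (lstruct_of B) (linduced (lstruct_of Ns) X)"
    by blast
next
  fix B :: "'a sstruct" assume "B \<in> sclass"
  hence B: "sstructure B" "finite (spts B)" "sstrong {} B" by (auto simp: sclass_def)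
  obtain h where h: "inj_on h (spts B)" "h ` spts B \<subseteq> rpts M"
    "\<And>X. X \<subseteq> spts B \<Longrightarrow> mult (s_reduct M) (h ` X) = mult B X"
    using s_extension[OF B, of undefined] by auto
  let ?f = "e \<circ> h" and ?X = "(e \<circ> h) ` spts B"
  have f: "lembedding ?f (lstruct_of B) (lstruct_of Ns)" by (rule embed_in_Ns[OF B(1,2) h])
  hence "?X \<subseteq> lpts (lstruct_of Ns)" using lembedding_into by fastforce
  hence "finite ?X \<and> ?X \<subseteq> lpts (lstruct_of Ns) \<and> liso ?f (lstruct_of B) (linduced (lstruct_of Ns) ?X)"
    using f B(2) by (simp add: liso_linduced_iff)
  thus "\<exists>A f. finite A \<and> A \<subseteq> lpts (lstruct_of Ns) \<and> liso f (lstruct_of B) (linduced (lstruct_of Ns) A)"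
    by (intro exI)
qed

lemma axiom2_Ns: "axiom2 sclass (lstruct_of Ns)"
  unfolding axiom2_def
proof (intro allI impI)
  fix A and B :: "'a sstruct"
  assume a: "finite A \<and> A \<subseteq> lpts (lstruct_of Ns) \<and> B \<in> sclass \<and> A \<subseteq> spts B \<and>
    liso id (lstruct_of (sinduced B A)) (linduced (lstruct_of Ns) A) \<and> sstrong A B"
  hence A: "finite A" "A \<subseteq> spts Ns" "A \<subseteq> spts B" and AB: "sstrong A B"
    and B: "sstructure B" "finite (spts B)"
    by (auto simp: sclass_def)
  have id: "lembedding id (lstruct_of (sinduced B A)) (lstruct_of Ns)"
    using a liso_linduced_iff[of A "lstruct_of Ns" id "lstruct_of (sinduced B A)"] by blast
  define g where "g = inv_into (rpts M) e"
  have eg: "e (g a) = a" "g a \<in> rpts M" if "a \<in> A" for a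
  proof -
    have "a \<in> e ` rpts M" using that A(2) Ns(2) by blast
    thus "e (g a) = a" "g a \<in> rpts M" by (simp_all add: g_def f_inv_into_f inv_into_into)
  qed
  have "mult (s_reduct M) (g ` X) = mult B X" if X: "X \<subseteq> A" for X
  proof -
    have fX: "finite X" using X A(1) by (rule finite_subset)
    have "e ` g ` X = X" using eg(1) X by (force simp: image_image)
    moreover have "g ` X \<subseteq> rpts M" using eg(2) X by blast
    ultimately have "mult (s_reduct M) (g ` X) = mult Ns X" using mult_Ns[of "g ` X"] fX by simp
    also have "\<dots> = mult (sinduced B A) X"
      using lembedding_mult[OF sstructure_sinduced[OF B(1) A(1,3)] id, of X] X fX by simp
    also have "\<dots> = mult B X" by (rule mult_sinduced[OF B(1) A(1,3) X])
    finally show ?thesis .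
  qed
  moreover have "inj_on g A" using eg(1) by (metis inj_on_inverseI)
  moreover have "g ` A \<subseteq> rpts M" using eg(2) by blast
  ultimately obtain h where h: "inj_on h (spts B)" "h ` spts B \<subseteq> rpts M" "\<And>a. a \<in> A \<Longrightarrow> h a = g a"
    "\<And>X. X \<subseteq> spts B \<Longrightarrow> mult (s_reduct M) (h ` X) = mult B X"
    using s_extension[OF B AB] by metis
  have "lembedding (e \<circ> h) (lstruct_of B) (lstruct_of Ns)" by (rule embed_in_Ns[OF B h(1,2,4)])
  moreover have "\<forall>a\<in>A. (e \<circ> h) a = a" using h(3) eg(1) by simp
  ultimately show "\<exists>f. lembedding f (lstruct_of B) (lstruct_of Ns) \<and> (\<forall>a\<in>A. f a = a)"
    by (intro exI conjI)
qed

lemma axiom3_Ns: "axiom3 (lstruct_of Ns)"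
  unfolding axiom3_def
proof (intro allI)
  fix n m :: nat
  let ?W = "hypergraph {..<n} {} :: nat rstruct"
  have W: "rstructure ?W" "triples ?W = {}" using hypergraph_rstructure[of "{}" "{..<n}"] by auto
  have rW: "rdim ?W Y = int (card Y)" for Y by (simp add: rdim_def W(2))
  have s0: "rstrong ((undefined :: 'm \<Rightarrow> nat) ` {}) ?W"
    by (simp add: rstrong_iff rW)
  obtain f where f: "inj_on f {..<n}" "f ` {..<n} \<subseteq> rpts M" "rstrong (f ` {..<n}) M"
    "\<And>t. t \<subseteq> {..<n} \<Longrightarrow> f ` t \<notin> triples M"
  proof -
    have "({} :: nat set) \<in> triples ?W \<longleftrightarrow> ({} :: 'm set) \<in> triples M"
      using tripleD(2)[OF rstructure, of "{}"] W(2) by auto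
    thus thesis
      using that embed_strong_extension[OF empty_rstrong W(1) _ _ _ _ _ s0]
      by (simp add: rW W(2)) metis
  qed
  let ?X = "f ` {..<n}"
  have nt: "\<not> t \<subseteq> ?X" if "t \<in> triples M" for t
    using f(4) that by (metis subset_imageE)
  have m0: "mult (s_reduct M) (f ` Z) = 0" if Z: "Z \<subseteq> {..<n}" for Z
  proof (cases "3 \<le> card (f ` Z)")
    case True
    have fZ: "finite (f ` Z)" using Z by (auto intro: finite_subset)
    have none: "{p \<in> pairs M. f ` Z \<subseteq> nb M p} = {}"
    proof (rule ccontr)
      assume "{p \<in> pairs M. f ` Z \<subseteq> nb M p} \<noteq> {}"
      then obtain p where p: "p \<in> pairs M" "f ` Z \<subseteq> nb M p" by blast
      have "card (f ` Z) \<le> card (nb M p \<inter> ?X)" by (rule card_mono) (use p Z in auto)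
      hence "p \<subseteq> ?X" using pair_in_strong[OF rstructure f(3) p(1)] True by linarith
      moreover obtain c where "c \<in> f ` Z" using True by fastforce
      ultimately show False using nt[of "insert c p"] p(2) Z by (auto simp: nb_def)
    qed
    show ?thesis unfolding mult_s_reduct[OF fZ True] none by simp
  next
    case False
    thus ?thesis using Z by (simp add: mult_def at_least_3_def finite_subset)
  qed
  let ?f = "e \<circ> f"
  have lf: "lembedding ?f (lstruct_of (F_struct n)) (lstruct_of Ns)"
    by (rule lembedding_compose[OF _ lembedding_e], rule lembedding_of_mult) (use f m0 in auto)
  have cX: "card ?X = n" using f(1) by (simp add: card_image)
  have "\<exists>E. sstructure E \<and> spts E = D \<and> liso id (lstruct_of E) (linduced (lstruct_of Ns) D) \<and>
      sstrong (?f ` {..<n}) E"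
    if D: "finite D" "?f ` {..<n} \<subseteq> D" "D \<subseteq> spts Ns" for D
  proof (intro exI conjI)
    show "sstructure (sinduced Ns D)" by (rule sstructure_sinduced[OF Ns(1) D(1,3)])
    show "liso id (lstruct_of (sinduced Ns D)) (linduced (lstruct_of Ns) D)"
      using lembedding_sinduced[OF Ns(1) D(1,3)] D(3) by (simp add: liso_linduced_iff)
    show "sstrong (?f ` {..<n}) (sinduced Ns D)"
      unfolding sstrong_iff
    proof (intro conjI allI impI)
      show "finite (?f ` {..<n})" "?f ` {..<n} \<subseteq> spts (sinduced Ns D)" using D(2) by auto
      fix D' assume D': "finite D' \<and> ?f ` {..<n} \<subseteq> D' \<and> D' \<subseteq> spts (sinduced Ns D)"
      hence DD: "D' \<subseteq> D" "D' \<subseteq> spts Ns" using D(3) by auto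
      obtain Y where Y: "Y \<subseteq> rpts M" "finite Y" "D' = e ` Y" using Ns_subset[OF DD(2)] D' by blast
      have XY: "?X \<subseteq> Y"
      proof
        fix x assume x: "x \<in> ?X"
        hence "e x \<in> e ` Y" using D' Y(3) by auto
        thus "x \<in> Y" using inj_on_image_mem_iff[OF e _ Y(1), of x] x f(2) by blast
      qed
      have "pdim Ns (?f ` {..<n}) \<le> int (card (?f ` {..<n}))"
        by (rule pdim_le_card[OF Ns(1)]) (use D in auto)
      also have "\<dots> \<le> int n" using card_image_le[of "{..<n}" ?f] by simp
      also have "\<dots> \<le> pdim (s_reduct M) Y"
        using pdim_s_reduct_ge[OF f(3) nt Y(2) XY Y(1)] cX by simp
      also have "\<dots> = pdim Ns D'" using pdim_Ns[OF Y(1,2)] Y(3) by simp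
      finally show "pdim (sinduced Ns D) (?f ` {..<n}) \<le> pdim (sinduced Ns D) D'"
        using pdim_sinduced[OF Ns(1) D(1,3)] D(2) DD(1) by simp
    qed
  qed simp
  thus "\<exists>f. lembedding f (lstruct_of (F_struct n)) (lstruct_of Ns) \<and>
      (\<forall>D. finite D \<and> card D = m \<and> f ` spts (F_struct n) \<subseteq> D \<and> D \<subseteq> lpts (lstruct_of Ns) \<longrightarrow>
         (\<exists>E. sstructure E \<and> spts E = D \<and> liso id (lstruct_of E) (linduced (lstruct_of Ns) D) \<and>
              sstrong (f ` spts (F_struct n)) E))"
    using lf by (intro exI[of _ ?f]) simp
qed

end

section \<open>Satisfaction is invariant under isomorphism\<close>

lemma sat_liso:
  assumes f: "liso f N N'"
  shows "wf_fm \<phi> \<Longrightarrow> (\<And>x. x \<in> free_vars \<phi> \<Longrightarrow> v x \<in> lpts N \<and> w x = f (v x)) \<Longrightarrow>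
    sat N v \<phi> = sat N' w \<phi>"
proof (induction \<phi> arbitrary: v w)
  case (Eq x y)
  have "inj_on f (lpts N)" using f by (simp add: liso_def lembedding_def)
  thus ?case using Eq.prems(2)[of x] Eq.prems(2)[of y] by (simp add: inj_on_eq_iff)
next
  case (Rel s xs)
  have mw: "map w xs = map f (map v xs)" using Rel.prems(2) by simp
  have "set (map v xs) \<subseteq> lpts N \<and> length (map v xs) = arity s" "s \<in> language"
    using Rel.prems by auto
  hence "linterp N s (map v xs) = linterp N' s (map f (map v xs))"
    using f unfolding liso_def lembedding_def by blast
  thus ?case unfolding sat.simps mw .
next
  case (Ex x \<phi>)
  have step: "sat N (v(x := a)) \<phi> = sat N' (w(x := f a)) \<phi>" if "a \<in> lpts N" for a
    by (rule Ex.IH) (use Ex.prems that in auto)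
  have "lpts N' = f ` lpts N" using f by (simp add: liso_def)
  thus ?case using step by simp
next
  case (Neg \<phi>)
  have "sat N v \<phi> = sat N' w \<phi>" by (rule Neg.IH) (use Neg.prems in auto)
  thus ?case by simp
next
  case (Conj \<phi> \<psi>)
  have "sat N v \<phi> = sat N' w \<phi>" by (rule Conj.IH(1)) (use Conj.prems in auto)
  moreover have "sat N v \<psi> = sat N' w \<psi>" by (rule Conj.IH(2)) (use Conj.prems in auto)
  ultimately show ?case by simp
qed

text \<open>Sentences are insensitive to the assignment, by invariance under the identity.\<close>

lemma holds_iff_sat:
  assumes "sentence \<phi>" "range v \<subseteq> lpts N"
  shows "holds N \<phi> \<longleftrightarrow> sat N v \<phi>"
proof -
  have "liso id N N" by (simp add: liso_def lembedding_def)
  hence "sat N v \<phi> = sat N w \<phi>" for w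
    using assms(1) sat_liso[of id N N \<phi> v w] by (simp add: sentence_def)
  thus ?thesis using assms(2) unfolding holds_def by blast
qed

lemma holds_liso:
  assumes "liso f N N'" "sentence \<phi>" "lpts N \<noteq> {}"
  shows "holds N \<phi> \<longleftrightarrow> holds N' \<phi>"
proof -
  obtain a where a: "a \<in> lpts N" using assms(3) by blast
  have fa: "f a \<in> lpts N'" using a assms(1) by (auto simp: liso_def lembedding_def)
  have "sat N (\<lambda>_. a) \<phi> = sat N' (\<lambda>_. f a) \<phi>"
    by (rule sat_liso[OF assms(1)]) (use assms(2) a in \<open>auto simp: sentence_def\<close>)
  thus ?thesis
    using holds_iff_sat[OF assms(2), of "\<lambda>_. a" N] holds_iff_sat[OF assms(2), of "\<lambda>_. f a" N'] a fa by auto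
qed

section \<open>Definable properties of tuples\<close>

text \<open>Properties of tuples of fixed length \<open>n\<close>, the tuple being the values of the first \<open>n\<close>
  variables. With lists, quantifying the last variable becomes appending an element.\<close>

definition definable :: "nat \<Rightarrow> ('a lstruct \<Rightarrow> 'a list \<Rightarrow> bool) \<Rightarrow> bool" where
  "definable n P \<longleftrightarrow> (\<exists>\<phi>. wf_fm \<phi> \<and> free_vars \<phi> \<subseteq> {..<n} \<and>
     (\<forall>N v. sat N v \<phi> \<longleftrightarrow> P N (map v [0..<n])))"

lemma definable_cong:
  assumes "\<And>N xs. length xs = n \<Longrightarrow> P N xs \<longleftrightarrow> Q N xs"
  shows "definable n P \<longleftrightarrow> definable n Q"
  unfolding definable_def using assms by simp

lemma definable_not: "definable n P \<Longrightarrow> definable n (\<lambda>N xs. \<not> P N xs)"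
  unfolding definable_def
proof (elim exE conjE)
  fix \<phi> assume "wf_fm \<phi>" "free_vars \<phi> \<subseteq> {..<n}" "\<forall>N v. sat N v \<phi> \<longleftrightarrow> P N (map v [0..<n])"
  thus "\<exists>\<phi>. wf_fm \<phi> \<and> free_vars \<phi> \<subseteq> {..<n} \<and> (\<forall>N v. sat N v \<phi> \<longleftrightarrow> \<not> P N (map v [0..<n]))"
    by (intro exI[of _ "Neg \<phi>"]) simp
qed

lemma definable_and:
  assumes "definable n P" "definable n Q"
  shows "definable n (\<lambda>N xs. P N xs \<and> Q N xs)"
proof -
  obtain \<phi> where "wf_fm \<phi>" "free_vars \<phi> \<subseteq> {..<n}" "\<forall>N v. sat N v \<phi> \<longleftrightarrow> P N (map v [0..<n])"
    using assms(1) unfolding definable_def by blast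
  moreover obtain \<psi> where "wf_fm \<psi>" "free_vars \<psi> \<subseteq> {..<n}" "\<forall>N v. sat N v \<psi> \<longleftrightarrow> Q N (map v [0..<n])"
    using assms(2) unfolding definable_def by blast
  ultimately show ?thesis unfolding definable_def by (intro exI[of _ "Conj \<phi> \<psi>"]) simp
qed

lemma definable_imp:
  assumes "definable n P" "definable n Q"
  shows "definable n (\<lambda>N xs. P N xs \<longrightarrow> Q N xs)"
  using definable_not[OF definable_and[OF assms(1) definable_not[OF assms(2)]]] by simp

lemma definable_True: "definable n (\<lambda>N xs. True)"
  unfolding definable_def by (intro exI[of _ "Neg (Ex 0 (Neg (Eq 0 0)))"]) simp

lemma definable_Ball:
  assumes "finite I" "\<And>i. i \<in> I \<Longrightarrow> definable n (P i)"
  shows "definable n (\<lambda>N xs. \<forall>i\<in>I. P i N xs)"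
  using assms
proof (induction I rule: finite_induct)
  case (insert i I)
  hence "definable n (\<lambda>N xs. P i N xs \<and> (\<forall>i\<in>I. P i N xs))" by (intro definable_and) auto
  thus ?case by simp
qed (simp add: definable_True)

lemma definable_Bex:
  assumes "finite I" "\<And>i. i \<in> I \<Longrightarrow> definable n (P i)"
  shows "definable n (\<lambda>N xs. \<exists>i\<in>I. P i N xs)"
  using definable_not[OF definable_Ball[OF assms(1), of n "\<lambda>i N xs. \<not> P i N xs"]] assms(2)
  by (simp add: definable_not)

text \<open>A property that depends only on the truth values of finitely many definable properties is a
  finite disjunction of conjunctions of these and their negations. Hence no formula
  ever has to be written down.\<close>

lemma definable_determined:
  assumes I: "finite I" "\<And>i. i \<in> I \<Longrightarrow> definable n (Q i)"
    and det: "\<And>N xs N' xs'. (\<And>i. i \<in> I \<Longrightarrow> Q i N xs \<longleftrightarrow> Q i N' xs') \<Longrightarrow> P N xs \<Longrightarrow> P N' xs'"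
  shows "definable n P"
proof -
  \<comment> \<open>the truth assignments realised by tuples with the property\<close>
  define \<J> where "\<J> = {J. J \<subseteq> I \<and> (\<exists>N xs. P N xs \<and> J = {i \<in> I. Q i N xs})}"
  have "finite \<J>" by (rule finite_subset[of _ "Pow I"]) (use I(1) in \<open>auto simp: \<J>_def\<close>)
  moreover have "definable n (\<lambda>N xs. \<forall>i\<in>I. Q i N xs \<longleftrightarrow> i \<in> J)" for J
  proof (rule definable_Ball[OF I(1)])
    fix i assume "i \<in> I"
    thus "definable n (\<lambda>N xs. Q i N xs \<longleftrightarrow> i \<in> J)"
      using I(2) by (cases "i \<in> J") (simp_all add: definable_not)
  qed
  ultimately have "definable n (\<lambda>N xs. \<exists>J\<in>\<J>. \<forall>i\<in>I. Q i N xs \<longleftrightarrow> i \<in> J)"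
    by (rule definable_Bex)
  moreover have "(\<exists>J\<in>\<J>. \<forall>i\<in>I. Q i N xs \<longleftrightarrow> i \<in> J) \<longleftrightarrow> P N xs" for N xs
  proof
    assume "\<exists>J\<in>\<J>. \<forall>i\<in>I. Q i N xs \<longleftrightarrow> i \<in> J"
    then obtain N' xs' where "P N' xs'" "\<forall>i\<in>I. Q i N xs \<longleftrightarrow> Q i N' xs'" unfolding \<J>_def by auto
    thus "P N xs" using det by blast
  next
    assume "P N xs"
    hence "{i \<in> I. Q i N xs} \<in> \<J>" unfolding \<J>_def by blast
    thus "\<exists>J\<in>\<J>. \<forall>i\<in>I. Q i N xs \<longleftrightarrow> i \<in> J" by (rule rev_bexI) simp
  qed
  ultimately show ?thesis by simp
qed

lemma definable_Ex1:
  assumes "definable (Suc n) P"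
  shows "definable n (\<lambda>N xs. \<exists>a\<in>lpts N. P N (xs @ [a]))"
proof -
  obtain \<phi> where \<phi>: "wf_fm \<phi>" "free_vars \<phi> \<subseteq> {..<Suc n}" "\<And>N v. sat N v \<phi> \<longleftrightarrow> P N (map v [0..<Suc n])"
    using assms unfolding definable_def by blast
  have "map (v(n := a)) [0..<Suc n] = map v [0..<n] @ [a]" for v :: "nat \<Rightarrow> 'a" and a by simp
  moreover have "free_vars (Ex n \<phi>) \<subseteq> {..<n}" using \<phi>(2) by (auto simp: less_Suc_eq)
  ultimately show ?thesis
    unfolding definable_def using \<phi>(1,3) by (intro exI[of _ "Ex n \<phi>"]) simp
qed

lemma definable_Ex:
  "definable (n + m) P \<Longrightarrow>
    definable n (\<lambda>N xs. \<exists>ys. length ys = m \<and> set ys \<subseteq> lpts N \<and> P N (xs @ ys))"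
proof (induction m arbitrary: P)
  case 0
  thus ?case by simp
next
  case (Suc m)
  have "definable (n + m) (\<lambda>N xs. \<exists>a\<in>lpts N. P N (xs @ [a]))"
    using Suc.prems by (intro definable_Ex1) simp
  from Suc.IH[OF this]
  have "definable n (\<lambda>N xs. \<exists>ys. length ys = m \<and> set ys \<subseteq> lpts N \<and> (\<exists>a\<in>lpts N. P N ((xs @ ys) @ [a])))" .
  moreover have "(\<exists>ys. length ys = m \<and> set ys \<subseteq> lpts N \<and> (\<exists>a\<in>lpts N. P N ((xs @ ys) @ [a]))) \<longleftrightarrow>
      (\<exists>ys. length ys = Suc m \<and> set ys \<subseteq> lpts N \<and> P N (xs @ ys))" for N :: "'a lstruct" and xs
  proof
    assume "\<exists>ys. length ys = m \<and> set ys \<subseteq> lpts N \<and> (\<exists>a\<in>lpts N. P N ((xs @ ys) @ [a]))"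
    then obtain ys a where "length ys = m" "set ys \<subseteq> lpts N" "a \<in> lpts N" "P N ((xs @ ys) @ [a])" by blast
    thus "\<exists>ys. length ys = Suc m \<and> set ys \<subseteq> lpts N \<and> P N (xs @ ys)"
      by (intro exI[of _ "ys @ [a]"]) simp
  next
    assume "\<exists>ys. length ys = Suc m \<and> set ys \<subseteq> lpts N \<and> P N (xs @ ys)"
    then obtain ys where ys: "length ys = Suc m" "set ys \<subseteq> lpts N" "P N (xs @ ys)" by blast
    then obtain zs a where "ys = zs @ [a]" by (metis length_Suc_conv_rev)
    thus "\<exists>ys. length ys = m \<and> set ys \<subseteq> lpts N \<and> (\<exists>a\<in>lpts N. P N ((xs @ ys) @ [a]))"
      using ys by (intro exI[of _ zs]) auto
  qed
  ultimately show ?case by simp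
qed

lemma definable_All:
  assumes "definable (n + m) P"
  shows "definable n (\<lambda>N xs. \<forall>ys. length ys = m \<and> set ys \<subseteq> lpts N \<longrightarrow> P N (xs @ ys))"
  by (rule definable_cong[THEN iffD1, OF _ definable_not[OF definable_Ex[OF definable_not[OF assms]]]])
    blast

lemma definable_Rel:
  assumes "s \<in> language" "length is = arity s" "set is \<subseteq> {..<n}"
  shows "definable n (\<lambda>N xs. linterp N s (map ((!) xs) is))"
proof -
  have eq: "map ((!) (map v [0..<n])) is = map v is" for v :: "nat \<Rightarrow> 'a"
    using assms(3) by (auto simp: subset_iff)
  show ?thesis
    unfolding definable_def eq using assms by (intro exI[of _ "Rel s is"]) simp
qed

lemma definable_distinct: "definable n (\<lambda>N xs. distinct xs)"
proof -
  have eq: "definable n (\<lambda>N (xs :: 'a list). xs ! i = xs ! j)" if "i < n" "j < n" for i j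
    unfolding definable_def using that by (intro exI[of _ "Eq i j"]) simp
  have "definable n (\<lambda>N (xs :: 'a list). \<forall>i\<in>{..<n}. \<forall>j\<in>{..<n} - {i}. \<not> xs ! i = xs ! j)"
    by (intro definable_Ball definable_not eq) auto
  thus ?thesis
    by (rule definable_cong[THEN iffD1, rotated]) (auto simp: distinct_conv_nth)
qed


section \<open>Finite diagrams\<close>

definition atoms :: "nat \<Rightarrow> (sym \<times> nat list) set" where
  "atoms n = {(s, is). s \<in> language \<and> arity s \<le> n \<and> length is = arity s \<and> set is \<subseteq> {..<n}}"

definition matches :: "'b sstruct \<Rightarrow> 'b list \<Rightarrow> 'a lstruct \<Rightarrow> 'a list \<Rightarrow> bool" where
  "matches B bs N xs \<longleftrightarrow> (\<forall>(s, is)\<in>atoms (length bs).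
     linterp (lstruct_of B) s (map ((!) bs) is) \<longleftrightarrow> linterp N s (map ((!) xs) is))"

lemma finite_atoms: "finite (atoms n)"
proof (rule finite_subset)
  show "atoms n \<subseteq> ({S} \<union> (\<lambda>(a, k). Mult a k) ` ({..n} \<times> {..3})) \<times> {is. set is \<subseteq> {..<n} \<and> length is \<le> n}"
    by (auto simp: atoms_def language_def)
  show "finite (({S} \<union> (\<lambda>(a, k). Mult a k) ` ({..n} \<times> {..3})) \<times> {is :: nat list. set is \<subseteq> {..<n} \<and> length is \<le> n})"
    using finite_lists_length_le[of "{..<n}" n] by simp
qed

lemma definable_matches:
  assumes "\<And>B bs. (B, bs) \<in> \<K> \<Longrightarrow> length bs = n"
  shows "definable n (\<lambda>N xs. \<exists>(B, bs)\<in>\<K>. matches B bs N xs)"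
proof (rule definable_determined[OF finite_atoms[of n], of n "\<lambda>a N xs. linterp N (fst a) (map ((!) xs) (snd a))"])
  show "definable n (\<lambda>N xs. linterp N (fst a) (map ((!) xs) (snd a)))" if "a \<in> atoms n" for a
    using that by (intro definable_Rel) (auto simp: atoms_def)
next
  fix N :: "'b lstruct" and xs and N' :: "'b lstruct" and xs'
  assume eq: "\<And>a. a \<in> atoms n \<Longrightarrow> linterp N (fst a) (map ((!) xs) (snd a)) \<longleftrightarrow>
      linterp N' (fst a) (map ((!) xs') (snd a))"
    and "\<exists>(B, bs)\<in>\<K>. matches B bs N xs"
  then obtain B bs where B: "(B, bs) \<in> \<K>" "matches B bs N xs" by blast
  have "matches B bs N' xs'"
    using B(2) eq assms[OF B(1)] unfolding matches_def by fastforce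
  thus "\<exists>(B, bs)\<in>\<K>. matches B bs N' xs'" using B(1) by blast
qed

text \<open>The language is infinite, but the predicates of arity greater than \<open>n\<close> say nothing about
  \<open>n\<close> points once they are known to hold of distinct points only.\<close>

definition proper :: "'a lstruct \<Rightarrow> bool" where
  "proper N \<longleftrightarrow> (\<forall>s\<in>language. \<forall>xs. length xs = arity s \<and> set xs \<subseteq> lpts N \<longrightarrow>
     linterp N s xs \<longrightarrow> distinct xs)"

lemma lembedding_iff_matches:
  assumes N: "proper N" and bs: "distinct bs" "set bs = spts B"
    and f: "inj_on f (spts B)" "f ` spts B \<subseteq> lpts N"
  shows "lembedding f (lstruct_of B) N \<longleftrightarrow> matches B bs N (map f bs)"
proof -
  have mm: "map f (map ((!) bs) is) = map ((!) (map f bs)) is" if "set is \<subseteq> {..<length bs}" for "is"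
    using that by auto
  show ?thesis
  proof
    assume le: "lembedding f (lstruct_of B) N"
    show "matches B bs N (map f bs)"
      unfolding matches_def
    proof safe
      fix s "is" assume "(s, is) \<in> atoms (length bs)"
      hence a: "s \<in> language" "length is = arity s" "set is \<subseteq> {..<length bs}" by (auto simp: atoms_def)
      have "set (map ((!) bs) is) \<subseteq> lpts (lstruct_of B)"
        unfolding lpts_lstruct_of bs(2)[symmetric] using a(3) by auto
      hence "linterp (lstruct_of B) s (map ((!) bs) is) = linterp N s (map f (map ((!) bs) is))"
        using le a(1,2) unfolding lembedding_def by (metis length_map)
      hence eq: "linterp (lstruct_of B) s (map ((!) bs) is) = linterp N s (map ((!) (map f bs)) is)"
        unfolding mm[OF a(3)] .
      { assume "linterp (lstruct_of B) s (map ((!) bs) is)"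
        thus "linterp N s (map ((!) (map f bs)) is)" using eq by simp }
      { assume "linterp N s (map ((!) (map f bs)) is)"
        thus "linterp (lstruct_of B) s (map ((!) bs) is)" using eq by simp }
    qed
  next
    assume m: "matches B bs N (map f bs)"
    show "lembedding f (lstruct_of B) N"
      unfolding lembedding_def
    proof (intro conjI ballI allI impI)
      fix s ys assume s: "s \<in> language" and ys: "set ys \<subseteq> lpts (lstruct_of B) \<and> length ys = arity s"
      have dist: "distinct (map f ys) \<longleftrightarrow> distinct ys"
        using f(1) ys by (auto simp: distinct_map intro: inj_on_subset)
      show "linterp (lstruct_of B) s ys = linterp N s (map f ys)"
      proof (cases "distinct ys")
        case False
        hence "\<not> linterp (lstruct_of B) s ys" by (simp add: lstruct_of_def)
        moreover have "set (map f ys) \<subseteq> lpts N" using f(2) ys by auto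
        hence "\<not> linterp N s (map f ys)"
          using N s ys False dist unfolding proper_def by (metis length_map)
        ultimately show ?thesis by simp
      next
        case True
        have "length ys = card (set ys)" using True by (simp add: distinct_card)
        also have "\<dots> \<le> card (set bs)" 
          by (rule card_mono[OF List.finite_set]) (use ys bs(2) in simp)
        also have "\<dots> = length bs" using bs(1) by (rule distinct_card)
        finally have le: "arity s \<le> length bs" using ys by simp
        have "\<forall>y\<in>set ys. \<exists>i<length bs. bs ! i = y" using ys bs(2) by (auto simp: in_set_conv_nth)
        then obtain k where k: "\<And>y. y \<in> set ys \<Longrightarrow> k y < length bs \<and> bs ! k y = y" by metis
        let ?is = "map k ys"
        have ks: "set ?is \<subseteq> {..<length bs}" "map ((!) bs) ?is = ys"
          using k by (auto intro: map_idI)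
        have "(s, ?is) \<in> atoms (length bs)" using s le ks(1) ys by (simp add: atoms_def)
        hence "linterp (lstruct_of B) s (map ((!) bs) ?is) = linterp N s (map ((!) (map f bs)) ?is)"
          using m unfolding matches_def by blast
        thus ?thesis unfolding mm[OF ks(1), symmetric] ks(2) .
      qed
    qed (use f in auto)
  qed
qed

lemma map_onto_list:
  assumes "distinct bs" "length xs = length bs"
  obtains f where "map f bs = xs" "distinct xs \<Longrightarrow> inj_on f (set bs)"
proof -
  have "map (\<lambda>b. xs ! (THE i. i < length bs \<and> bs ! i = b)) bs = xs"
  proof (rule nth_equalityI)
    fix i assume "i < length (map (\<lambda>b. xs ! (THE i. i < length bs \<and> bs ! i = b)) bs)"
    hence i: "i < length bs" by simp
    have "(THE j. j < length bs \<and> bs ! j = bs ! i) = i"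
      using i assms(1) by (auto simp: nth_eq_iff_index_eq)
    thus "map (\<lambda>b. xs ! (THE i. i < length bs \<and> bs ! i = b)) bs ! i = xs ! i" using i by simp
  qed (simp add: assms)
  thus ?thesis using that by (metis distinct_map)
qed

lemma matches_obtain:
  assumes "proper N" "distinct bs" "set bs = spts B"
    and "length xs = length bs" "distinct xs" "set xs \<subseteq> lpts N" "matches B bs N xs"
  obtains f where "map f bs = xs" "lembedding f (lstruct_of B) N"
proof -
  obtain f where f: "map f bs = xs" "inj_on f (set bs)"
    using map_onto_list[OF assms(2,4)] assms(5) by metis
  have "f ` spts B \<subseteq> lpts N" using f(1) assms(3,6) by (metis list.set_map)
  hence "lembedding f (lstruct_of B) N"
    using lembedding_iff_matches[OF assms(1-3)] f assms(3,7) by metis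
  thus ?thesis using that f(1) by blast
qed

lemma lembedding_matches:
  assumes "proper N" "distinct bs" "set bs = spts B" "lembedding f (lstruct_of B) N"
  shows "matches B bs N (map f bs)" "distinct (map f bs)" "set (map f bs) \<subseteq> lpts N"
proof -
  have f: "inj_on f (spts B)" "f ` spts B \<subseteq> lpts N"
    using lembedding_inj[OF assms(4)] lembedding_into[OF assms(4)] by simp_all
  show "matches B bs N (map f bs)"
    using lembedding_iff_matches[OF assms(1-3) f] assms(4) by simp
  show "distinct (map f bs)" "set (map f bs) \<subseteq> lpts N"
    using f assms(2,3) by (simp_all add: distinct_map)
qed


section \<open>First-order axiomatisability\<close>

lemma theory_of_definable:
  assumes "definable 0 P"
  shows "\<exists>T. theory_stating (\<lambda>N :: 'a::infinite lstruct. P N []) T"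
proof -
  obtain \<phi> where \<phi>: "wf_fm \<phi>" "free_vars \<phi> \<subseteq> {}" "\<And>N v. sat N v \<phi> \<longleftrightarrow> P N []"
    using assms unfolding definable_def by auto
  have "holds N \<phi> \<longleftrightarrow> P N []" if N: "lpts N \<noteq> {}" for N :: "'a lstruct"
  proof -
    obtain a where "a \<in> lpts N" using N by blast
    hence "range (\<lambda>_ :: nat. a) \<subseteq> lpts N" by auto
    thus ?thesis unfolding holds_def \<phi>(3) by blast
  qed
  hence "theory_stating (\<lambda>N. P N []) {\<phi>}"
    using \<phi>(1,2) by (simp add: theory_stating_def sentence_def is_model_def)
  thus ?thesis by blast
qed

lemma theory_All:
  assumes "definable n P"
  shows "\<exists>T. theory_stating (\<lambda>N :: 'a::infinite lstruct. \<forall>xs. length xs = n \<and> set xs \<subseteq> lpts N \<longrightarrow> P N xs) T"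
  using theory_of_definable[OF definable_All[of 0 n P]] assms by simp

lemma theory_Ex:
  assumes "definable n P"
  shows "\<exists>T. theory_stating (\<lambda>N :: 'a::infinite lstruct. \<exists>xs. length xs = n \<and> set xs \<subseteq> lpts N \<and> P N xs) T"
  using theory_of_definable[OF definable_Ex[of 0 n P]] assms by simp

lemma theory_of_all:
  assumes "\<And>i. i \<in> I \<Longrightarrow> \<exists>T. theory_stating (Q i) T"
  shows "\<exists>T. theory_stating (\<lambda>N. \<forall>i\<in>I. Q i N) T"
proof -
  obtain T where T: "\<And>i. i \<in> I \<Longrightarrow> theory_stating (Q i) (T i)" using assms by metis
  have "theory_stating (\<lambda>N. \<forall>i\<in>I. Q i N) (\<Union>i\<in>I. T i)"
    unfolding theory_stating_def
  proof (intro conjI ballI allI impI)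
    fix \<phi> assume "\<phi> \<in> (\<Union>i\<in>I. T i)"
    thus "sentence \<phi>" using T unfolding theory_stating_def by blast
  next
    fix N :: "'b lstruct" assume N: "lpts N \<noteq> {}"
    have "is_model N (\<Union>i\<in>I. T i) \<longleftrightarrow> (\<forall>i\<in>I. is_model N (T i))"
      using N by (auto simp: is_model_def)
    thus "is_model N (\<Union>i\<in>I. T i) \<longleftrightarrow> (\<forall>i\<in>I. Q i N)"
      using T N unfolding theory_stating_def by blast
  qed
  thus ?thesis by blast
qed

lemma theory_of_conj:
  assumes "\<exists>T. theory_stating P T" "\<exists>T. theory_stating Q T"
  shows "\<exists>T. theory_stating (\<lambda>N. P N \<and> Q N) T"
proof -
  have "\<exists>T. theory_stating (\<lambda>N. \<forall>b\<in>UNIV. (if b then P N else Q N)) T"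
  proof (rule theory_of_all)
    fix b :: bool
    show "\<exists>T. theory_stating (\<lambda>N. if b then P N else Q N) T" using assms by (cases b) auto
  qed
  moreover have "(\<forall>b\<in>UNIV. (if b then P N else Q N)) = (P N \<and> Q N)" for N by auto
  ultimately show ?thesis by simp
qed

lemma theory_proper: "\<exists>T. theory_stating (proper :: 'a::infinite lstruct \<Rightarrow> bool) T"
  unfolding proper_def[abs_def]
proof (intro theory_of_all theory_All definable_imp definable_distinct)
  fix s assume s: "s \<in> language"
  have "definable (arity s) (\<lambda>N xs. linterp N s (map ((!) xs) [0..<arity s]))"
    by (rule definable_Rel[OF s]) auto
  thus "definable (arity s) (\<lambda>N xs. linterp N s xs)"
    by (rule definable_cong[THEN iffD1, rotated]) (metis map_nth)
qed

section \<open>Copies inside a model\<close>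

lemma linduced_full: "linduced (lstruct_of A) (spts A) = lstruct_of A"
  by (simp add: linduced_def lstruct_of_def)

lemma lembedding_id_simage:
  assumes E: "sstructure E" and f: "lembedding f (lstruct_of E) N"
  shows "lembedding id (lstruct_of (simage f E)) N"
proof -
  have inj: "inj_on f (spts E)" using lembedding_inj[OF f] by simp
  have "lembedding (inv_into (spts E) f) (lstruct_of (simage f E)) (lstruct_of E)"
    using lembedding_inv[OF lembedding_simage[OF E inj]] linduced_full[of "simage f E"]
    by (simp only: lpts_lstruct_of spts_simage)
  from lembedding_compose[OF this f] show ?thesis
    by (rule lembedding_cong[rotated]) (auto simp: f_inv_into_f)
qed

lemma axiom1_local:
  fixes N :: "'a::infinite lstruct"
  assumes "axiom1 sclass N" "finite A" "A \<subseteq> lpts N"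
  obtains E :: "'a sstruct" where "E \<in> sclass" "spts E = A" "lembedding id (lstruct_of E) N"
proof -
  have "\<exists>B\<in>(sclass :: 'a sstruct set). \<exists>f. liso f (lstruct_of B) (linduced N A)"
    using assms unfolding axiom1_def by (elim conjE allE impE) (intro conjI)
  then obtain B :: "'a sstruct" and f where B: "B \<in> sclass" "liso f (lstruct_of B) (linduced N A)"
    by blast
  hence f: "lembedding f (lstruct_of B) N" "f ` spts B = A"
    using liso_linduced_iff[OF assms(3), of f "lstruct_of B"] by simp_all
  have "inj_on f (spts B)" using lembedding_inj[OF f(1)] by simp
  hence "simage f B \<in> sclass" using B(1) by (intro sclass_simage)
  moreover have "lembedding id (lstruct_of (simage f B)) N"
    using B(1) f(1) by (intro lembedding_id_simage) (auto simp: sclass_def)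
  ultimately show ?thesis using that f(2) by simp
qed

lemma axiom1_proper:
  assumes "axiom1 sclass N"
  shows "proper N"
  unfolding proper_def
proof (intro ballI allI impI)
  fix s xs assume s: "s \<in> language" and xs: "length xs = arity s \<and> set xs \<subseteq> lpts N" "linterp N s xs"
  obtain E where E: "spts E = set xs" "lembedding id (lstruct_of E) N"
    using axiom1_local[OF assms _ conjunct2[OF xs(1)]] by auto
  have "linterp (lstruct_of E) s xs = linterp N s (map id xs)"
    using E(2) s xs(1) E(1) unfolding lembedding_def by (metis lpts_lstruct_of subset_refl)
  thus "distinct xs" using xs(2) by (simp add: lstruct_of_def)
qed

text \<open>The second axiom speaks of structures containing \<open>A\<close> itself. Replacing \<open>B\<close> by a copy over the
  image of \<open>A\<close> gives the version for an embedding of \<open>A\<close>.\<close>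

lemma axiom2_embedding:
  assumes N: "axiom2 sclass N" and B: "B \<in> sclass" "sstrong A B"
    and g: "lembedding g (lstruct_of (sinduced B A)) N"
  obtains f where "lembedding f (lstruct_of B) N" "\<And>a. a \<in> A \<Longrightarrow> f a = g a"
proof -
  have B': "sstructure B" "finite (spts B)" using B(1) by (auto simp: sclass_def)
  have A: "finite A" "A \<subseteq> spts B" using B(2) by (auto simp: sstrong_def)
  have gA: "inj_on g A" "g ` A \<subseteq> lpts N" using lembedding_inj[OF g] lembedding_into[OF g] by simp_all
  obtain e where e: "inj_on e (spts B)" "\<And>a. a \<in> A \<Longrightarrow> e a = g a"
    using extend_injection[OF B'(2) A(2) gA(1)] by metis
  let ?C = "simage e B"
  have C: "?C \<in> sclass" by (rule sclass_simage[OF B(1) e(1)])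
  have C': "sstructure ?C" using C by (simp add: sclass_def)
  have eC: "lembedding e (lstruct_of B) (lstruct_of ?C)" by (rule lembedding_simage[OF B'(1) e(1)])
  have eA: "e ` A = g ` A" using e(2) by auto
  have fgA: "finite (g ` A)" "g ` A \<subseteq> spts ?C" using A unfolding eA[symmetric] by auto
  have strong: "sstrong (g ` A) ?C"
    using sstrong_lembedding[OF B'(1) C' eC _ B(2)] eA by simp
  have "lembedding id (lstruct_of (sinduced ?C (g ` A))) N"
  proof -
    let ?D = "simage g (sinduced B A)"
    have BA: "sstructure (sinduced B A)" by (rule sstructure_sinduced[OF B'(1) A])
    have "lembedding id (lstruct_of ?D) N" by (rule lembedding_id_simage[OF BA g])
    moreover have "lembedding id (lstruct_of (sinduced ?C (g ` A))) (lstruct_of ?D)"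
    proof (rule lembedding_of_mult)
      fix X assume X: "X \<subseteq> spts (sinduced ?C (g ` A))" "finite X"
      then obtain Y where Y: "Y \<subseteq> A" "X = g ` Y" by (metis spts_sinduced subset_imageE)
      have fY: "finite Y" using Y(1) A(1) by (rule finite_subset)
      have XY: "X = e ` Y" unfolding Y(2) using e(2) Y(1) by (intro image_cong) auto
      have "mult (sinduced ?C (g ` A)) X = mult ?C X"
        using X by (intro mult_sinduced[OF C' fgA]) simp
      also have "\<dots> = mult B Y"
        unfolding XY using Y(1) A(2) fY by (intro lembedding_mult[OF B'(1) eC]) auto
      also have "\<dots> = mult (sinduced B A) Y" by (rule mult_sinduced[OF B'(1) A Y(1), symmetric])
      also have "\<dots> = mult ?D (g ` Y)"
        by (rule lembedding_mult[OF BA lembedding_simage[OF BA], symmetric]) (use gA(1) Y(1) fY in simp_all)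
      finally show "mult ?D (id ` X) = mult (sinduced ?C (g ` A)) X" using Y(2) by simp
    qed auto
    ultimately have "lembedding (id \<circ> id) (lstruct_of (sinduced ?C (g ` A))) N"
      by (intro lembedding_compose)
    thus ?thesis by simp
  qed
  hence "liso id (lstruct_of (sinduced ?C (g ` A))) (linduced N (g ` A))"
    unfolding liso_linduced_iff[OF gA(2)] by simp
  hence "\<exists>f. lembedding f (lstruct_of ?C) N \<and> (\<forall>a\<in>g ` A. f a = a)"
    using N[unfolded axiom2_def, THEN spec, THEN spec, THEN mp, of "g ` A" ?C] C strong fgA gA(2)
    by simp
  then obtain f where f: "lembedding f (lstruct_of ?C) N" "\<forall>a\<in>g ` A. f a = a" by blast
  show ?thesis
  proof (rule that)
    show "lembedding (f \<circ> e) (lstruct_of B) N" by (rule lembedding_compose[OF eC f(1)])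
    show "(f \<circ> e) a = g a" if "a \<in> A" for a using that e(2) f(2) by simp
  qed
qed

section \<open>The axioms are first-order\<close>

definition enumerates :: "'b list \<Rightarrow> 'b sstruct \<Rightarrow> bool" where
  "enumerates bs B \<longleftrightarrow> distinct bs \<and> set bs = spts B"

lemma definable_matches1: "length bs = n \<Longrightarrow> definable n (\<lambda>N xs. matches B bs N xs)"
  using definable_matches[of "{(B, bs)}" n] by simp

definition diagrams :: "nat \<Rightarrow> ('a sstruct \<times> 'a list) set" where
  "diagrams n = {(B, bs). B \<in> sclass \<and> enumerates bs B \<and> length bs = n}"

definition strong_diagrams :: "nat \<Rightarrow> nat \<Rightarrow> ('a sstruct \<times> 'a list) set" where
  "strong_diagrams n k = {(E, es). sstructure E \<and> enumerates es E \<and> length es = n + k \<and>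
     sstrong (set (take n es)) E}"

text \<open>The axioms as conditions on tuples instead of finite subsets, in the shape to which the closure
  properties of definability apply.\<close>

definition tuple_axiom1a :: "'a lstruct \<Rightarrow> bool" where
  "tuple_axiom1a N \<longleftrightarrow> (\<forall>n\<in>UNIV. \<forall>xs. length xs = n \<and> set xs \<subseteq> lpts N \<longrightarrow>
     (distinct xs \<longrightarrow> (\<exists>(B, bs)\<in>diagrams n :: ('a sstruct \<times> 'a list) set. matches B bs N xs)))"

definition tuple_axiom1b :: "'a lstruct \<Rightarrow> bool" where
  "tuple_axiom1b N \<longleftrightarrow> (\<forall>(B, bs)\<in>{(B, bs). B \<in> sclass \<and> enumerates bs B} :: ('a sstruct \<times> 'a list) set.
     \<exists>xs. length xs = length bs \<and> set xs \<subseteq> lpts N \<and> distinct xs \<and> matches B bs N xs)"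

definition tuple_axiom2 :: "'a lstruct \<Rightarrow> bool" where
  "tuple_axiom2 N \<longleftrightarrow>
     (\<forall>(B, as, bs)\<in>{(B, as, bs). B \<in> sclass \<and> enumerates (as @ bs) B \<and> sstrong (set as) B}
         :: ('a sstruct \<times> 'a list \<times> 'a list) set.
     \<forall>xs. length xs = length as \<and> set xs \<subseteq> lpts N \<longrightarrow>
       (distinct xs \<and> matches (sinduced B (set as)) as N xs \<longrightarrow>
       (\<exists>ys. length ys = length bs \<and> set ys \<subseteq> lpts N \<and> distinct (xs @ ys) \<and>
         matches B (as @ bs) N (xs @ ys))))"

definition tuple_axiom3 :: "'a lstruct \<Rightarrow> bool" where
  "tuple_axiom3 N \<longleftrightarrow> (\<forall>n\<in>UNIV. \<forall>k\<in>UNIV. \<exists>xs. length xs = n \<and> set xs \<subseteq> lpts N \<and>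
     (distinct xs \<and> matches (F_struct n) [0..<n] N xs) \<and>
     (\<forall>ys. length ys = k \<and> set ys \<subseteq> lpts N \<longrightarrow> (distinct (xs @ ys) \<longrightarrow>
        (\<exists>(E, es)\<in>strong_diagrams n k :: ('a sstruct \<times> 'a list) set. matches E es N (xs @ ys)))))"

lemma theory_tuple_axiom1: "\<exists>T. theory_stating (tuple_axiom1a :: 'a::infinite lstruct \<Rightarrow> bool) T"
  "\<exists>T. theory_stating (tuple_axiom1b :: 'a::infinite lstruct \<Rightarrow> bool) T"
proof -
  show "\<exists>T. theory_stating (tuple_axiom1a :: 'a lstruct \<Rightarrow> bool) T"
    unfolding tuple_axiom1a_def[abs_def]
    by (intro theory_of_all theory_All definable_imp definable_distinct definable_matches)
      (simp add: diagrams_def)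
  show "\<exists>T. theory_stating (tuple_axiom1b :: 'a lstruct \<Rightarrow> bool) T"
    unfolding tuple_axiom1b_def[abs_def] case_prod_beta
    by (intro theory_of_all theory_Ex definable_and definable_distinct definable_matches1 refl)
qed

lemma theory_tuple_axiom2: "\<exists>T. theory_stating (tuple_axiom2 :: 'a::infinite lstruct \<Rightarrow> bool) T"
  unfolding tuple_axiom2_def[abs_def]
proof (rule theory_of_all)
  fix p :: "'a sstruct \<times> 'a list \<times> 'a list"
  obtain B as bs where p: "p = (B, as, bs)" by (metis prod_cases3)
  have "definable (length as + length bs) (\<lambda>N (xs :: 'a list). distinct xs \<and> matches B (as @ bs) N xs)"
    by (intro definable_and definable_distinct definable_matches1) simp
  note ext = definable_Ex[OF this]
  show "\<exists>T. theory_stating (\<lambda>N :: 'a lstruct. case p of (B, as, bs) \<Rightarrow>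
     \<forall>xs. length xs = length as \<and> set xs \<subseteq> lpts N \<longrightarrow>
       (distinct xs \<and> matches (sinduced B (set as)) as N xs \<longrightarrow>
       (\<exists>ys. length ys = length bs \<and> set ys \<subseteq> lpts N \<and> distinct (xs @ ys) \<and>
         matches B (as @ bs) N (xs @ ys)))) T"
    unfolding p prod.case
    by (intro theory_All definable_imp definable_and definable_distinct definable_matches1 refl ext)
qed

lemma theory_tuple_axiom3: "\<exists>T. theory_stating (tuple_axiom3 :: 'a::infinite lstruct \<Rightarrow> bool) T"
  unfolding tuple_axiom3_def[abs_def]
proof (intro theory_of_all theory_Ex)
  fix n k :: nat
  have "definable (n + k) (\<lambda>N xs. distinct xs \<longrightarrow>
      (\<exists>(E, es)\<in>strong_diagrams n k :: ('a sstruct \<times> 'a list) set. matches E es N xs))"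
    by (intro definable_imp definable_distinct definable_matches) (simp add: strong_diagrams_def)
  note ext = definable_All[OF this]
  show "definable n (\<lambda>N (xs :: 'a list). (distinct xs \<and> matches (F_struct n) [0..<n] N xs) \<and>
     (\<forall>ys. length ys = k \<and> set ys \<subseteq> lpts N \<longrightarrow> (distinct (xs @ ys) \<longrightarrow>
        (\<exists>(E, es)\<in>strong_diagrams n k :: ('a sstruct \<times> 'a list) set. matches E es N (xs @ ys)))))"
    by (intro definable_and definable_distinct definable_matches1 ext) simp
qed

context
  fixes N :: "'a::infinite lstruct"
  assumes N: "proper N"
begin

lemma tuple_axiom1_iff: "tuple_axiom1a N \<and> tuple_axiom1b N \<longleftrightarrow> axiom1 sclass N"
proof
  assume t: "tuple_axiom1a N \<and> tuple_axiom1b N"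
  show "axiom1 sclass N"
    unfolding axiom1_def
  proof (intro conjI allI impI ballI)
    fix A assume A: "finite A \<and> A \<subseteq> lpts N"
    then obtain xs where xs: "set xs = A" "distinct xs" using finite_distinct_list by blast
    then obtain B bs where B: "(B, bs) \<in> (diagrams (length xs) :: ('a sstruct \<times> 'a list) set)"
      "matches B bs N xs"
      using t A unfolding tuple_axiom1a_def by auto
    hence B': "B \<in> sclass" "distinct bs" "set bs = spts B" "length bs = length xs"
      by (auto simp: diagrams_def enumerates_def)
    obtain f where f: "map f bs = xs" "lembedding f (lstruct_of B) N"
      using matches_obtain[OF N B'(2,3) _ xs(2) _ B(2)] B'(4) xs(1) A by auto
    have "f ` spts B = A" using f(1) B'(3) xs(1) by (metis list.set_map)
    hence "liso f (lstruct_of B) (linduced N A)"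
      using f(2) A liso_linduced_iff[of A N f "lstruct_of B"] by simp
    thus "\<exists>B\<in>(sclass :: 'a sstruct set). \<exists>f. liso f (lstruct_of B) (linduced N A)"
      using B'(1) by blast
  next
    fix B :: "'a sstruct" assume B: "B \<in> sclass"
    then obtain bs where bs: "set bs = spts B" "distinct bs"
      using finite_distinct_list by (auto simp: sclass_def)
    have "\<exists>xs. length xs = length bs \<and> set xs \<subseteq> lpts N \<and> distinct xs \<and> matches B bs N xs"
      using t B bs unfolding tuple_axiom1b_def enumerates_def by fastforce
    then obtain xs where xs: "length xs = length bs" "set xs \<subseteq> lpts N" "distinct xs" "matches B bs N xs"
      by blast
    obtain f where f: "map f bs = xs" "lembedding f (lstruct_of B) N"
      using matches_obtain[OF N bs(2,1) xs(1,3,2,4)] .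
    have "f ` spts B = set xs" using f(1) bs(1) by (metis list.set_map)
    hence "finite (set xs) \<and> set xs \<subseteq> lpts N \<and> liso f (lstruct_of B) (linduced N (set xs))"
      using f(2) xs(2) liso_linduced_iff[of "set xs" N f "lstruct_of B"] by simp
    thus "\<exists>A f. finite A \<and> A \<subseteq> lpts N \<and> liso f (lstruct_of B) (linduced N A)" by blast
  qed
next
  assume a: "axiom1 sclass N"
  have "tuple_axiom1a N"
    unfolding tuple_axiom1a_def
  proof (intro ballI allI impI)
    fix n xs assume xs: "length xs = n \<and> set xs \<subseteq> lpts N" "distinct xs"
    obtain E where E: "E \<in> sclass" "spts E = set xs" "lembedding id (lstruct_of E) N"
      using axiom1_local[OF a _ conjunct2[OF xs(1)]] by auto
    have "(E, xs) \<in> diagrams n" using E(1,2) xs by (simp add: diagrams_def enumerates_def)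
    moreover have "matches E xs N xs"
      using lembedding_matches(1)[OF N _ _ E(3), of xs] xs(2) E(2) by simp
    ultimately show "\<exists>(B, bs)\<in>diagrams n :: ('a sstruct \<times> 'a list) set. matches B bs N xs" by auto
  qed
  moreover have "tuple_axiom1b N"
    unfolding tuple_axiom1b_def
  proof safe
    fix B :: "'a sstruct" and bs assume "B \<in> sclass" "enumerates bs B"
    hence p: "B \<in> sclass" "distinct bs" "set bs = spts B" by (simp_all add: enumerates_def)
    then obtain A f where f: "A \<subseteq> lpts N" "liso f (lstruct_of B) (linduced N A)"
      using a unfolding axiom1_def by blast
    hence "lembedding f (lstruct_of B) N" using liso_linduced_iff[OF f(1)] by blast
    from lembedding_matches[OF N p(2,3) this]
    show "\<exists>xs. length xs = length bs \<and> set xs \<subseteq> lpts N \<and> distinct xs \<and> matches B bs N xs"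
      by (intro exI[of _ "map f bs"]) simp
  qed
  ultimately show "tuple_axiom1a N \<and> tuple_axiom1b N" ..
qed

lemma tuple_axiom2_iff: "tuple_axiom2 N \<longleftrightarrow> axiom2 sclass N"
proof
  assume t: "tuple_axiom2 N"
  show "axiom2 sclass N"
    unfolding axiom2_def
  proof (intro allI impI)
    fix A and B :: "'a sstruct"
    assume a: "finite A \<and> A \<subseteq> lpts N \<and> B \<in> sclass \<and> A \<subseteq> spts B \<and>
      liso id (lstruct_of (sinduced B A)) (linduced N A) \<and> sstrong A B"
    hence B: "finite (spts B)" by (simp add: sclass_def)
    have id: "lembedding id (lstruct_of (sinduced B A)) N"
      using a liso_linduced_iff[of A N id "lstruct_of (sinduced B A)"] by blast
    obtain as where as: "set as = A" "distinct as" using a finite_distinct_list by blast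
    obtain bs where bs: "set bs = spts B - A" "distinct bs"
      using finite_distinct_list[of "spts B - A"] B by auto
    have en: "enumerates (as @ bs) B" using as bs a by (auto simp: enumerates_def)
    have "matches (sinduced B A) as N as"
      using lembedding_matches(1)[OF N as(2) _ id] as(1) by simp
    then obtain ys where ys: "length ys = length bs" "set ys \<subseteq> lpts N" "distinct (as @ ys)"
      "matches B (as @ bs) N (as @ ys)"
      using t[unfolded tuple_axiom2_def, THEN bspec, of "(B, as, bs)"] a en as by auto
    obtain f where f: "map f (as @ bs) = as @ ys" "lembedding f (lstruct_of B) N"
    proof (rule matches_obtain[OF N _ _ _ ys(3) _ ys(4)])
      show "distinct (as @ bs)" "set (as @ bs) = spts B" using en by (auto simp: enumerates_def)
      show "length (as @ ys) = length (as @ bs)" using ys(1) by simp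
      show "set (as @ ys) \<subseteq> lpts N" using as(1) a ys(2) by simp
    qed
    have "map f as = as" using f(1) by simp
    hence "\<forall>a\<in>A. f a = a" using as(1) by (metis map_eq_conv map_ident)
    thus "\<exists>f. lembedding f (lstruct_of B) N \<and> (\<forall>a\<in>A. f a = a)" using f(2) by blast
  qed
next
  assume a: "axiom2 sclass N"
  show "tuple_axiom2 N"
    unfolding tuple_axiom2_def
  proof safe
    fix B :: "'a sstruct" and as bs xs
    assume p: "B \<in> sclass" "enumerates (as @ bs) B" "sstrong (set as) B"
      and xs: "length xs = length as" "set xs \<subseteq> lpts N"
      and m: "distinct xs" "matches (sinduced B (set as)) as N xs"
    have B: "B \<in> sclass" "distinct (as @ bs)" "set (as @ bs) = spts B" "sstrong (set as) B"
      using p by (simp_all add: enumerates_def)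
    obtain g where g: "map g as = xs" "lembedding g (lstruct_of (sinduced B (set as))) N"
      by (rule matches_obtain[OF N, of as "sinduced B (set as)" xs]) (use xs m B(2) in simp_all)
    obtain f where f: "lembedding f (lstruct_of B) N" "\<And>a. a \<in> set as \<Longrightarrow> f a = g a"
      using axiom2_embedding[OF a B(1,4) g(2)] by metis
    have fx: "map f as = xs" using f(2) g(1) by auto
    note lm = lembedding_matches[OF N B(2,3) f(1)]
    show "\<exists>ys. length ys = length bs \<and> set ys \<subseteq> lpts N \<and> distinct (xs @ ys) \<and>
        matches B (as @ bs) N (xs @ ys)"
      by (rule exI[of _ "map f bs"]) (use lm fx in simp)
  qed
qed

lemma tuple_axiom3_iff: "tuple_axiom3 N \<longleftrightarrow> axiom3 N"
proof
  assume t: "tuple_axiom3 N"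
  show "axiom3 N"
    unfolding axiom3_def
  proof (intro allI)
    fix n m :: nat
    obtain xs where xs: "length xs = n" "set xs \<subseteq> lpts N" "distinct xs"
      "matches (F_struct n) [0..<n] N xs"
      and st: "\<And>ys. length ys = m - n \<Longrightarrow> set ys \<subseteq> lpts N \<Longrightarrow> distinct (xs @ ys) \<Longrightarrow>
        \<exists>(E, es)\<in>strong_diagrams n (m - n) :: ('a sstruct \<times> 'a list) set. matches E es N (xs @ ys)"
      using t[unfolded tuple_axiom3_def, THEN bspec, THEN bspec, of n "m - n"] by auto
    obtain f where f: "map f [0..<n] = xs" "lembedding f (lstruct_of (F_struct n)) N"
      by (rule matches_obtain[OF N _ _ _ xs(3,2,4)]) (auto simp: xs(1) F_struct_def)
    have fx: "f ` spts (F_struct n) = set xs" using f(1) by (auto simp: F_struct_def)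
    have "\<exists>E. sstructure E \<and> spts E = D \<and> liso id (lstruct_of E) (linduced N D) \<and> sstrong (set xs) E"
      if D: "finite D" "card D = m" "set xs \<subseteq> D" "D \<subseteq> lpts N" for D
    proof -
      obtain ys where ys: "set ys = D - set xs" "distinct ys"
        using finite_distinct_list[of "D - set xs"] D(1) by auto
      have "length ys = card (D - set xs)" using ys distinct_card by metis
      also have "\<dots> = m - n" using D xs by (simp add: card_Diff_subset distinct_card)
      finally have ly: "length ys = m - n" .
      have dx: "distinct (xs @ ys)" "set (xs @ ys) = D" using xs(3) ys D(3) by auto
      obtain E es where E: "(E, es) \<in> (strong_diagrams n (m - n) :: ('a sstruct \<times> 'a list) set)"
        "matches E es N (xs @ ys)"
        using st[OF ly _ dx(1)] ys(1) D(4) by auto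
      hence E': "sstructure E" "distinct es" "set es = spts E" "length es = n + (m - n)"
        "sstrong (set (take n es)) E"
        by (auto simp: strong_diagrams_def enumerates_def)
      obtain h where h: "map h es = xs @ ys" "lembedding h (lstruct_of E) N"
        by (rule matches_obtain[OF N E'(2,3) _ dx(1) _ E(2)]) (use E'(4) xs(1) ly dx(2) D(4) in simp_all)
      have inj: "inj_on h (spts E)" using lembedding_inj[OF h(2)] by simp
      have hD: "h ` spts E = D" using h(1) E'(3) dx(2) by (metis list.set_map)
      have hx: "h ` set (take n es) = set xs"
        using h(1) xs(1) by (metis append_eq_conv_conj list.set_map take_map)
      have "sstructure (simage h E)" by (rule sstructure_simage[OF E'(1) inj])
      moreover have "liso id (lstruct_of (simage h E)) (linduced N D)"
        using lembedding_id_simage[OF E'(1) h(2)] hD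
          liso_linduced_iff[OF D(4), of id "lstruct_of (simage h E)"] by simp
      moreover have "sstrong (set xs) (simage h E)"
        using sstrong_lembedding[OF E'(1) _ lembedding_simage[OF E'(1) inj] _ E'(5)]
          sstructure_simage[OF E'(1) inj] hx by simp
      ultimately show ?thesis using hD by (intro exI[of _ "simage h E"]) simp
    qed
    thus "\<exists>f. lembedding f (lstruct_of (F_struct n)) N \<and>
        (\<forall>D. finite D \<and> card D = m \<and> f ` spts (F_struct n) \<subseteq> D \<and> D \<subseteq> lpts N \<longrightarrow>
           (\<exists>E. sstructure E \<and> spts E = D \<and> liso id (lstruct_of E) (linduced N D) \<and>
                sstrong (f ` spts (F_struct n)) E))"
      using f(2) by (intro exI[of _ f]) (simp only: fx, blast)
  qed
next
  assume a: "axiom3 N"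
  show "tuple_axiom3 N"
    unfolding tuple_axiom3_def
  proof (intro ballI)
    fix n k :: nat
    obtain f where f: "lembedding f (lstruct_of (F_struct n)) N"
      and st: "\<And>D. finite D \<Longrightarrow> card D = n + k \<Longrightarrow> f ` {..<n} \<subseteq> D \<Longrightarrow> D \<subseteq> lpts N \<Longrightarrow>
           (\<exists>E. sstructure E \<and> spts E = D \<and> liso id (lstruct_of E) (linduced N D) \<and> sstrong (f ` {..<n}) E)"
      using a[unfolded axiom3_def, THEN spec, THEN spec, of n "n + k"] by auto
    let ?xs = "map f [0..<n]"
    note lm = lembedding_matches[OF N _ _ f, of "[0..<n]"]
    have xs: "matches (F_struct n) [0..<n] N ?xs" "distinct ?xs" "set ?xs \<subseteq> lpts N" "set ?xs = f ` {..<n}"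
      using lm by (auto simp: atLeast0LessThan)
    have "\<exists>(E, es)\<in>strong_diagrams n k :: ('a sstruct \<times> 'a list) set. matches E es N (?xs @ ys)"
      if ys: "length ys = k" "set ys \<subseteq> lpts N" "distinct (?xs @ ys)" for ys
    proof -
      let ?D = "set (?xs @ ys)"
      have "card ?D = n + k" using distinct_card[OF ys(3)] ys(1) by simp
      moreover have "f ` {..<n} \<subseteq> ?D" "?D \<subseteq> lpts N" using xs(3,4) ys(2) by auto
      ultimately obtain E where E: "sstructure E" "spts E = ?D" "liso id (lstruct_of E) (linduced N ?D)"
        "sstrong (f ` {..<n}) E"
        using st[of ?D] by blast
      have id: "lembedding id (lstruct_of E) N"
        using E(3) liso_linduced_iff[OF \<open>?D \<subseteq> lpts N\<close>] by blast
      have "matches E (?xs @ ys) N (map id (?xs @ ys))"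
        by (rule lembedding_matches(1)[OF N ys(3) E(2)[symmetric] id])
      moreover have "(E, ?xs @ ys) \<in> strong_diagrams n k"
        using E(1,2,4) ys(1,3) xs(4) by (simp add: strong_diagrams_def enumerates_def)
      ultimately show ?thesis by auto
    qed
    thus "\<exists>xs. length xs = n \<and> set xs \<subseteq> lpts N \<and>
     (distinct xs \<and> matches (F_struct n) [0..<n] N xs) \<and>
      (\<forall>ys. length ys = k \<and> set ys \<subseteq> lpts N \<longrightarrow> (distinct (xs @ ys) \<longrightarrow>
         (\<exists>(E, es)\<in>strong_diagrams n k :: ('a sstruct \<times> 'a list) set. matches E es N (xs @ ys))))"
      using xs(1-3) by (intro exI[of _ ?xs]) simp
  qed
qed

end

theorem theory_axioms:
  "\<exists>T. theory_stating (\<lambda>N :: 'a::infinite lstruct. axiom1 sclass N \<and> axiom2 sclass N \<and> axiom3 N) T"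
proof -
  have "(proper N \<and> (tuple_axiom1a N \<and> tuple_axiom1b N) \<and> tuple_axiom2 N \<and> tuple_axiom3 N) \<longleftrightarrow>
      (axiom1 sclass N \<and> axiom2 sclass N \<and> axiom3 N)" for N :: "'a lstruct"
    using tuple_axiom1_iff tuple_axiom2_iff tuple_axiom3_iff axiom1_proper by blast
  moreover have "\<exists>T. theory_stating (\<lambda>N :: 'a lstruct. proper N \<and>
      (tuple_axiom1a N \<and> tuple_axiom1b N) \<and> tuple_axiom2 N \<and> tuple_axiom3 N) T"
    by (intro theory_of_conj theory_proper theory_tuple_axiom1
        theory_tuple_axiom2 theory_tuple_axiom3)
  ultimately show ?thesis by simp
qed

section \<open>A gadget\<close>

text \<open>Three points with one clique of pre-multiplicity two: every nonempty subset has predimension at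
  least one, and the whole has predimension one. Attached to \<open>x\<close>, it makes the new
  point \<open>p\<close> interdependent with \<open>x\<close>.\<close>

definition gadget :: "'a \<Rightarrow> 'a \<Rightarrow> 'a \<Rightarrow> 'a sstruct \<Rightarrow> 'a sstruct" where
  "gadget x p q B = \<lparr>spts = insert p (insert q (spts B)), cliques = insert {x, p, q} (cliques B),
     premult = (premult B)({x, p, q} := 2)\<rparr>"

lemma pdim_eq_finite:
  assumes B: "sstructure B" "finite (spts B)" and X: "X \<subseteq> spts B"
  shows "pdim B X = int (card X) - (\<Sum>C\<in>cliques B. int (premult B C * (card (C \<inter> X) - 2)))"
proof -
  have "3 \<le> card (C \<inter> spts B)" if "C \<in> cliques B" for C
    using sstructure_cliqueD(1,2)[OF B(1) that] finite_subset[OF _ B(2)]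
    by (simp add: Int_absorb2 at_least_3_finite)
  hence "{C. C \<in> cliques B \<and> 3 \<le> card (C \<inter> spts B)} = cliques B" by blast
  thus ?thesis using pdim_eq[OF B subset_refl X] by simp
qed

context
  fixes B :: "'a sstruct" and x p q :: 'a
  assumes B: "sstructure B" "finite (spts B)" and x: "x \<in> spts B"
    and pq: "p \<notin> spts B" "q \<notin> spts B" "p \<noteq> q"
begin

lemma gadget_simps: "spts (gadget x p q B) = insert p (insert q (spts B))"
  "cliques (gadget x p q B) = insert {x, p, q} (cliques B)"
  by (simp_all add: gadget_def)

lemma gadget_new_clique: "{x, p, q} \<notin> cliques B" "card {x, p, q} = 3"
proof -
  show "{x, p, q} \<notin> cliques B" using sstructure_cliqueD(1)[OF B(1)] pq by blast
  have "x \<noteq> p" "x \<noteq> q" using x pq by auto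
  thus "card {x, p, q} = 3" using pq(3) by simp
qed

lemma premult_gadget: "premult (gadget x p q B) {x, p, q} = 2"
  "K \<in> cliques B \<Longrightarrow> premult (gadget x p q B) K = premult B K"
  using gadget_new_clique by (auto simp: gadget_def)

lemma mult_gadget_old:
  assumes X: "X \<subseteq> spts B"
  shows "mult (gadget x p q B) X = mult B X"
proof (cases "3 \<le> card X")
  case True
  have fX: "finite X" using X B(2) by (rule finite_subset)
  have "\<not> X \<subseteq> {x, p, q}"
  proof
    assume "X \<subseteq> {x, p, q}"
    hence "X \<subseteq> {x}" using X pq by blast
    hence "card X \<le> card {x}" by (intro card_mono) auto
    thus False using True by simp
  qed
  hence "{C. C \<in> cliques (gadget x p q B) \<and> X \<subseteq> C} = {C. C \<in> cliques B \<and> X \<subseteq> C}"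
    unfolding gadget_simps by blast
  hence "(\<Sum>C | C \<in> cliques (gadget x p q B) \<and> X \<subseteq> C. premult (gadget x p q B) C) =
      (\<Sum>C | C \<in> cliques B \<and> X \<subseteq> C. premult B C)"
    using premult_gadget(2) by (intro sum.cong) auto
  thus ?thesis by (simp add: mult_def)
next
  case False
  have "finite X" using X B(2) by (rule finite_subset)
  thus ?thesis using False by (simp add: mult_def at_least_3_finite)
qed

lemma mult_gadget_new:
  assumes X: "X \<subseteq> spts (gadget x p q B)" "\<not> X \<subseteq> spts B"
  shows "mult (gadget x p q B) X = (if X = {x, p, q} then 2 else 0)"
proof (cases "3 \<le> card X")
  case True
  have fX: "finite X" using X(1) B(2) by (auto simp: gadget_simps intro: finite_subset)
  have "X \<subseteq> {x, p, q} \<longleftrightarrow> X = {x, p, q}"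
    using card_subset_eq[of "{x, p, q}" X] card_mono[of "{x, p, q}" X] True gadget_new_clique(2) by auto
  hence "{C. C \<in> cliques (gadget x p q B) \<and> X \<subseteq> C} = (if X = {x, p, q} then {{x, p, q}} else {})"
    using sstructure_cliqueD(1)[OF B(1)] X(2) unfolding gadget_simps by auto
  thus ?thesis using True fX premult_gadget(1) by (simp add: mult_def at_least_3_finite)
next
  case False
  have "finite X" using X(1) B(2) by (auto simp: gadget_simps intro: finite_subset)
  thus ?thesis using False gadget_new_clique(2) by (auto simp: mult_def at_least_3_finite)
qed

lemma sstructure_gadget: "sstructure (gadget x p q B)"
  unfolding sstructure_def
proof (intro conjI ballI allI impI)
  fix C assume C: "C \<in> cliques (gadget x p q B)"
  have "C \<subseteq> spts (gadget x p q B) \<and> at_least_3 C \<and> premult (gadget x p q B) C \<in> {1,2,3}"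
  proof (cases "C = {x, p, q}")
    case True
    have "at_least_3 C" unfolding True using gadget_new_clique(2) by (simp add: at_least_3_def)
    moreover have "C \<subseteq> spts (gadget x p q B)" unfolding True gadget_simps using x by auto
    moreover have "premult (gadget x p q B) C = 2" unfolding True by (rule premult_gadget)
    ultimately show ?thesis by simp
  next
    case False
    hence "C \<in> cliques B" using C by (simp add: gadget_simps)
    from sstructure_cliqueD[OF B(1) this] premult_gadget(2)[OF this]
    show ?thesis by (auto simp: gadget_simps)
  qed
  thus "C \<subseteq> spts (gadget x p q B)" "at_least_3 C" "premult (gadget x p q B) C \<in> {1,2,3}" by blast+
next
  fix X assume X: "X \<subseteq> spts (gadget x p q B) \<and> finite X \<and> 3 \<le> card X"
  show "finite {C \<in> cliques (gadget x p q B). X \<subseteq> C}"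
    using finite_cliques[OF B] by (simp add: gadget_simps)
  show "real (mult (gadget x p q B) X) \<le> 1 + 2 / (real (card X) - 2)"
  proof (cases "X \<subseteq> spts B")
    case True
    thus ?thesis using mult_gadget_old[OF True] B(1) X unfolding sstructure_def by auto
  next
    case False
    have "real (mult (gadget x p q B) X) \<le> (if card X = 3 then 2 else 0)"
      using mult_gadget_new[OF _ False] X gadget_new_clique(2) by auto
    also have "\<dots> \<le> 1 + 2 / (real (card X) - 2)" using X by auto
    finally show ?thesis .
  qed
qed

lemma pdim_gadget:
  assumes Y: "Y \<subseteq> spts (gadget x p q B)"
  shows "pdim (gadget x p q B) Y = pdim B (Y \<inter> spts B) + int (card (Y \<inter> {p, q})) -
    (if {x, p, q} \<subseteq> Y then 2 else 0)"
proof -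
  let ?C = "gadget x p q B"
  have fC: "finite (spts ?C)" using B(2) by (simp add: gadget_simps)
  have fY: "finite Y" using Y fC by (rule finite_subset)
  have "pdim ?C Y = int (card Y) - (\<Sum>K\<in>insert {x, p, q} (cliques B). int (premult ?C K * (card (K \<inter> Y) - 2)))"
    using pdim_eq_finite[OF sstructure_gadget fC Y] by (simp only: gadget_simps)
  also have "(\<Sum>K\<in>insert {x, p, q} (cliques B). int (premult ?C K * (card (K \<inter> Y) - 2))) =
      int (2 * (card ({x, p, q} \<inter> Y) - 2)) + (\<Sum>K\<in>cliques B. int (premult ?C K * (card (K \<inter> Y) - 2)))"
    by (simp only: sum.insert[OF finite_cliques[OF B] gadget_new_clique(1)] premult_gadget(1))
  also have "(\<Sum>K\<in>cliques B. int (premult ?C K * (card (K \<inter> Y) - 2))) =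
      (\<Sum>K\<in>cliques B. int (premult B K * (card (K \<inter> (Y \<inter> spts B)) - 2)))"
  proof (rule sum.cong[OF refl])
    fix K assume K: "K \<in> cliques B"
    have "K \<inter> Y = K \<inter> (Y \<inter> spts B)" using sstructure_cliqueD(1)[OF B(1) K] by blast
    thus "int (premult ?C K * (card (K \<inter> Y) - 2)) = int (premult B K * (card (K \<inter> (Y \<inter> spts B)) - 2))"
      using premult_gadget(2)[OF K] by simp
  qed
  also have "(\<Sum>K\<in>cliques B. int (premult B K * (card (K \<inter> (Y \<inter> spts B)) - 2))) =
      int (card (Y \<inter> spts B)) - pdim B (Y \<inter> spts B)"
    using pdim_eq_finite[OF B, of "Y \<inter> spts B"] by simp
  finally have "pdim ?C Y = int (card Y) - int (card (Y \<inter> spts B)) + pdim B (Y \<inter> spts B) -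
      int (2 * (card ({x, p, q} \<inter> Y) - 2))" by simp
  moreover have "card Y = card (Y \<inter> spts B) + card (Y \<inter> {p, q})"
  proof -
    have "Y = (Y \<inter> spts B) \<union> (Y \<inter> {p, q})" using Y by (auto simp: gadget_simps)
    moreover have "(Y \<inter> spts B) \<inter> (Y \<inter> {p, q}) = {}" using pq by auto
    ultimately show ?thesis using fY by (metis card_Un_disjoint finite_Int)
  qed
  moreover have "2 * (card ({x, p, q} \<inter> Y) - 2) = (if {x, p, q} \<subseteq> Y then 2 else 0)"
  proof (cases "{x, p, q} \<subseteq> Y")
    case True
    hence "{x, p, q} \<inter> Y = {x, p, q}" by blast
    thus ?thesis using True gadget_new_clique(2) by simp
  next
    case False
    have "card ({x, p, q} \<inter> Y) < card {x, p, q}" by (rule psubset_card_mono) (use False in auto)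
    thus ?thesis using False gadget_new_clique(2) by simp
  qed
  ultimately show ?thesis by simp
qed

lemma pdim_gadget_with:
  assumes "Y \<subseteq> spts (gadget x p q B)" "{x, p, q} \<subseteq> Y"
  shows "pdim (gadget x p q B) Y = pdim B (Y \<inter> spts B)"
proof -
  have "Y \<inter> {p, q} = {p, q}" using assms(2) by blast
  hence "card (Y \<inter> {p, q}) = 2" using pq(3) by simp
  thus ?thesis using pdim_gadget[OF assms(1)] assms(2) by simp
qed

lemma pdim_gadget_without:
  assumes "Y \<subseteq> spts (gadget x p q B)" "\<not> {x, p, q} \<subseteq> Y"
  shows "pdim (gadget x p q B) Y = pdim B (Y \<inter> spts B) + int (card (Y \<inter> {p, q}))"
  unfolding pdim_gadget[OF assms(1)] if_not_P[OF assms(2)] by simp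

lemma pdim_gadget_old:
  assumes Y: "Y \<subseteq> spts B"
  shows "pdim (gadget x p q B) Y = pdim B Y"
proof -
  have "Y \<inter> spts B = Y" "Y \<inter> {p, q} = {}" "\<not> {x, p, q} \<subseteq> Y" "Y \<subseteq> spts (gadget x p q B)"
    using Y pq by (auto simp: gadget_simps)
  thus ?thesis using pdim_gadget_without[of Y] by simp
qed

lemma pdim_gadget_full: "pdim (gadget x p q B) (spts (gadget x p q B)) = pdim B (spts B)"
proof -
  have "spts (gadget x p q B) \<inter> spts B = spts B" "{x, p, q} \<subseteq> spts (gadget x p q B)"
    using x by (auto simp: gadget_simps)
  thus ?thesis using pdim_gadget_with[OF subset_refl] by simp
qed

lemma gadget_strong:
  assumes Y: "spts B \<subseteq> Y" "Y \<subseteq> spts (gadget x p q B)"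
  shows "pdim B (spts B) \<le> pdim (gadget x p q B) Y"
proof -
  have YB: "Y \<inter> spts B = spts B" using Y(1) by blast
  show ?thesis
  proof (cases "{x, p, q} \<subseteq> Y")
    case True
    thus ?thesis using pdim_gadget_with[OF Y(2) True] YB by simp
  next
    case False
    thus ?thesis using pdim_gadget_without[OF Y(2) False] YB by simp
  qed
qed

lemma gadget_sclass:
  assumes "sstrong {} B"
  shows "gadget x p q B \<in> sclass"
proof -
  have "0 \<le> pdim (gadget x p q B) Y" if Y: "Y \<subseteq> spts (gadget x p q B)" for Y
  proof -
    have "finite (Y \<inter> spts B)" using B(2) by simp
    hence "pdim B {} \<le> pdim B (Y \<inter> spts B)"
      using assms unfolding sstrong_iff by blast
    hence "0 \<le> pdim B (Y \<inter> spts B)" by simp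
    thus ?thesis
      using pdim_gadget_with[OF Y] pdim_gadget_without[OF Y] by (cases "{x, p, q} \<subseteq> Y") auto
  qed
  thus ?thesis using sstructure_gadget B(2) by (simp add: sclass_def sstrong_iff gadget_simps)
qed

text \<open>A set over \<open>insert p A\<close> that contains the whole clique contains \<open>x\<close>, which lies outside the
  closure of \<open>A\<close>, and gains one from it; any other set gains one from \<open>p\<close>. So the base remains strong
  while its codimension drops by one.\<close>

lemma gadget_base:
  assumes A: "sstrong A B"
    and x_free: "\<And>Y. A \<subseteq> Y \<Longrightarrow> x \<in> Y \<Longrightarrow> Y \<subseteq> spts B \<Longrightarrow> pdim B A + 1 \<le> pdim B Y"
  shows "sstrong (insert p A) (gadget x p q B)" "pdim (gadget x p q B) (insert p A) = pdim B A + 1"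
proof -
  have A': "finite A" "A \<subseteq> spts B" using A by (auto simp: sstrong_def)
  have sub: "insert p A \<subseteq> spts (gadget x p q B)" using A'(2) by (auto simp: gadget_simps)
  have base: "insert p A \<inter> spts B = A" "insert p A \<inter> {p, q} = {p}" and no: "\<not> {x, p, q} \<subseteq> insert p A"
    using A'(2) pq by auto
  show eq: "pdim (gadget x p q B) (insert p A) = pdim B A + 1"
    unfolding pdim_gadget_without[OF sub no] base by simp
  show "sstrong (insert p A) (gadget x p q B)"
    unfolding sstrong_iff eq
  proof (intro conjI allI impI sub)
    show "finite (insert p A)" using A'(1) by simp
    fix Y assume Y: "finite Y \<and> insert p A \<subseteq> Y \<and> Y \<subseteq> spts (gadget x p q B)"
    hence Y': "Y \<subseteq> spts (gadget x p q B)" "A \<subseteq> Y \<inter> spts B" "p \<in> Y" "finite (Y \<inter> spts B)"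
      using A'(2) by auto
    show "pdim B A + 1 \<le> pdim (gadget x p q B) Y"
    proof (cases "{x, p, q} \<subseteq> Y")
      case True
      have "pdim B A + 1 \<le> pdim B (Y \<inter> spts B)"
        by (rule x_free) (use True x Y'(2) in auto)
      thus ?thesis using pdim_gadget_with[OF Y'(1) True] by simp
    next
      case False
      have "card {p} \<le> card (Y \<inter> {p, q})" using Y'(3) by (intro card_mono) auto
      moreover have "pdim B A \<le> pdim B (Y \<inter> spts B)"
        using A Y'(2,4) unfolding sstrong_iff by blast
      ultimately show ?thesis using pdim_gadget_without[OF Y'(1) False] by simp
    qed
  qed
qed

end

text \<open>Otherwise every point of \<open>B - A\<close> lies in some set over \<open>A\<close> of the same dimension as \<open>A\<close>; the union
  of these sets is \<open>B\<close>.\<close>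

lemma point_outside_closure:
  assumes B: "sstructure B" "finite (spts B)" and A: "sstrong A B"
    and lt: "pdim B A < pdim B (spts B)"
  obtains x where "x \<in> spts B" "x \<notin> A"
    "\<And>Y. A \<subseteq> Y \<Longrightarrow> x \<in> Y \<Longrightarrow> Y \<subseteq> spts B \<Longrightarrow> pdim B A + 1 \<le> pdim B Y"
proof (rule ccontr)
  have A': "A \<subseteq> spts B" using A by (auto simp: sstrong_def)
  have fin: "finite Y" if "Y \<subseteq> spts B" for Y using that B(2) by (rule finite_subset)
  assume nt: "\<not> thesis"
  note found = that
  have "\<exists>Y. A \<subseteq> Y \<and> x \<in> Y \<and> Y \<subseteq> spts B \<and> pdim B Y \<le> pdim B A" if x: "x \<in> spts B - A" for x
  proof (rule ccontr)
    assume "\<nexists>Y. A \<subseteq> Y \<and> x \<in> Y \<and> Y \<subseteq> spts B \<and> pdim B Y \<le> pdim B A"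
    hence "pdim B A + 1 \<le> pdim B Y" if "A \<subseteq> Y" "x \<in> Y" "Y \<subseteq> spts B" for Y
      using that by (metis add1_zle_eq linorder_not_less)
    thus False using found[of x] x nt by blast
  qed
  then obtain D where D: "\<And>x. x \<in> spts B - A \<Longrightarrow> A \<subseteq> D x \<and> x \<in> D x \<and> D x \<subseteq> spts B \<and> pdim B (D x) \<le> pdim B A"
    by metis
  have "pdim B (A \<union> \<Union>(D ` (spts B - A))) \<le> pdim B A"
  proof (rule submodular_union_le[of _ "spts B"])
    show "pdim B (X \<union> Y) + pdim B (X \<inter> Y) \<le> pdim B X + pdim B Y"
      if "X \<subseteq> spts B" "Y \<subseteq> spts B" for X Y
      by (rule pdim_submodular[OF B(1) fin[OF that(1)] fin[OF that(2)] that])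
    fix Z assume "A \<subseteq> Z" "Z \<subseteq> A \<union> \<Union>(D ` (spts B - A))"
    moreover have "A \<union> \<Union>(D ` (spts B - A)) \<subseteq> spts B" using A' D by blast
    ultimately show "pdim B A \<le> pdim B Z"
      using A fin[of Z] unfolding sstrong_iff by blast
  qed (use A' D B(2) in auto)
  moreover have "A \<union> \<Union>(D ` (spts B - A)) = spts B" using A' D by blast
  ultimately show False using lt by simp
qed

text \<open>A clique through \<open>b\<close> and two points of \<open>Y\<close> would cost at least one and cancel the gain from
  adding \<open>b\<close>.\<close>

lemma free_point_mult:
  assumes E: "sstructure E" "finite Y" "insert b Y \<subseteq> spts E" "b \<notin> Y"
    and free: "pdim E (insert b Y) = pdim E Y + 1"
    and Z: "Z \<subseteq> insert b Y" "b \<in> Z"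
  shows "mult E Z = 0"
proof (cases "3 \<le> card Z")
  case False
  have "finite Z" using Z(1) E(2) by (meson finite_insert finite_subset)
  thus ?thesis using False by (simp add: mult_def at_least_3_finite)
next
  case True
  let ?V = "insert b Y"
  let ?S = "{C. C \<in> cliques E \<and> 3 \<le> card (C \<inter> ?V)}"
  have fV: "finite ?V" using E(2) by simp
  have le: "premult E C * (card (C \<inter> Y) - 2) \<le> premult E C * (card (C \<inter> ?V) - 2)" for C
    using fV by (intro mult_le_mono2 diff_le_mono card_mono) auto
  have "(\<Sum>C\<in>?S. int (premult E C * (card (C \<inter> Y) - 2))) = (\<Sum>C\<in>?S. int (premult E C * (card (C \<inter> ?V) - 2)))"
  proof -
    have "card ?V = card Y + 1" using E(2,4) by simp
    thus ?thesis
      using pdim_eq[OF E(1) fV E(3) subset_refl] pdim_eq[OF E(1) fV E(3) subset_insertI] free by linarith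
  qed
  hence eq: "premult E C * (card (C \<inter> Y) - 2) = premult E C * (card (C \<inter> ?V) - 2)" if "C \<in> ?S" for C
    using sum_mono_inv[of "\<lambda>C. int (premult E C * (card (C \<inter> Y) - 2))" ?S
        "\<lambda>C. int (premult E C * (card (C \<inter> ?V) - 2))" C] that le finite_cliques_meeting[OF E(1) fV E(3)]
    by (simp only: of_nat_le_iff of_nat_eq_iff)
  have "\<not> Z \<subseteq> C" if C: "C \<in> cliques E" for C
  proof
    assume ZC: "Z \<subseteq> C"
    have "card Z \<le> card (C \<inter> ?V)" using ZC Z(1) fV by (intro card_mono) auto
    hence 3: "3 \<le> card (C \<inter> ?V)" using True by simp
    have "b \<in> C" using ZC Z(2) by blast
    hence "C \<inter> ?V = insert b (C \<inter> Y)" by blast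
    hence c: "card (C \<inter> ?V) = Suc (card (C \<inter> Y))" using E(2,4) by simp
    have "premult E C * (card (C \<inter> Y) - 2) < premult E C * (card (C \<inter> ?V) - 2)"
      using 3 c sstructure_cliqueD(3)[OF E(1) C] by simp
    thus False using eq[of C] C 3 by simp
  qed
  hence none: "{C. C \<in> cliques E \<and> Z \<subseteq> C} = {}" by blast
  show ?thesis unfolding mult_def none by simp
qed

section \<open>Local structure of a model\<close>

definition ts_model :: "'a::infinite lstruct \<Rightarrow> bool" where
  "ts_model N \<longleftrightarrow> axiom1 sclass N \<and> axiom2 sclass N \<and> axiom3 N"

text \<open>The \<open>S\<close>-structure on a finite subset is unique up to the values of its pre-multiplicity outside
  the cliques, so the choice does not affect predimensions (\<open>ldim_image\<close>).\<close>

definition local_sstruct :: "'a::infinite lstruct \<Rightarrow> 'a set \<Rightarrow> 'a sstruct" where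
  "local_sstruct N X = (SOME E. E \<in> sclass \<and> spts E = X \<and> lembedding id (lstruct_of E) N)"

definition ldim :: "'a::infinite lstruct \<Rightarrow> 'a set \<Rightarrow> int" where
  "ldim N X = pdim (local_sstruct N X) X"

lemma lembedding_local:
  assumes A: "lembedding f A N" and E: "lembedding id (lstruct_of E) N" and sub: "f ` lpts A \<subseteq> spts E"
  shows "lembedding f A (lstruct_of E)"
  unfolding lembedding_def
proof (intro conjI ballI allI impI)
  show "inj_on f (lpts A)" by (rule lembedding_inj[OF A])
  show "f ` lpts A \<subseteq> lpts (lstruct_of E)" using sub by simp
  fix s xs assume s: "s \<in> language" and xs: "set xs \<subseteq> lpts A \<and> length xs = arity s"
  have "linterp A s xs = linterp N s (map f xs)" using A s xs unfolding lembedding_def by blast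
  moreover have "set (map f xs) \<subseteq> lpts (lstruct_of E)" using xs sub by auto
  hence "linterp (lstruct_of E) s (map f xs) = linterp N s (map id (map f xs))"
    using E s xs unfolding lembedding_def by (metis length_map)
  ultimately show "linterp A s xs = linterp (lstruct_of E) s (map f xs)" by simp
qed

context
  fixes N :: "'a::infinite lstruct"
  assumes N1: "axiom1 sclass N"
begin

lemma local_sstruct:
  assumes "finite X" "X \<subseteq> lpts N"
  shows "local_sstruct N X \<in> sclass" "spts (local_sstruct N X) = X"
    "lembedding id (lstruct_of (local_sstruct N X)) N" "sstructure (local_sstruct N X)"
proof -
  have "\<exists>E. E \<in> sclass \<and> spts E = X \<and> lembedding id (lstruct_of E) N"
    using axiom1_local[OF N1 assms] by metis
  from someI_ex[OF this]
  show "local_sstruct N X \<in> sclass" "spts (local_sstruct N X) = X"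
    "lembedding id (lstruct_of (local_sstruct N X)) N"
    unfolding local_sstruct_def by blast+
  thus "sstructure (local_sstruct N X)" by (simp add: sclass_def)
qed

lemma ldim_image:
  assumes A: "sstructure A" "finite (spts A)" and f: "lembedding f (lstruct_of A) N" and Z: "Z \<subseteq> spts A"
  shows "ldim N (f ` Z) = pdim A Z"
proof -
  let ?X = "f ` spts A"
  have fX: "finite ?X" "?X \<subseteq> lpts N" using A(2) lembedding_into[OF f] by auto
  have fZ: "finite (f ` Z)" "f ` Z \<subseteq> lpts N" "f ` Z \<subseteq> ?X"
    using finite_subset[OF Z A(2)] fX(2) Z by auto
  note E = local_sstruct[OF fX] and E' = local_sstruct[OF fZ(1,2)]
  have "lembedding f (lstruct_of A) (lstruct_of (local_sstruct N ?X))"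
    by (rule lembedding_local[OF f E(3)]) (simp add: E(2))
  hence "pdim (local_sstruct N ?X) (f ` Z) = pdim A Z"
    by (rule pdim_lembedding[OF A(1) E(4) _ Z finite_subset[OF Z A(2)]])
  moreover have "lembedding id (lstruct_of (local_sstruct N (f ` Z))) (lstruct_of (local_sstruct N ?X))"
    by (rule lembedding_local[OF E'(3) E(3)]) (use fZ(3) in \<open>simp add: E(2) E'(2)\<close>)
  hence "pdim (local_sstruct N ?X) (id ` (f ` Z)) = pdim (local_sstruct N (f ` Z)) (f ` Z)"
    by (rule pdim_lembedding[OF E'(4) E(4)]) (use fZ(1) in \<open>simp_all add: E'(2)\<close>)
  ultimately show ?thesis by (simp add: ldim_def)
qed

lemma ldim_local:
  assumes "finite Y" "Y \<subseteq> lpts N" "X \<subseteq> Y"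
  shows "ldim N X = pdim (local_sstruct N Y) X"
  using ldim_image[of "local_sstruct N Y" id X] local_sstruct[OF assms(1,2)] assms by simp

lemma ldim_empty: "ldim N {} = 0"
  by (simp add: ldim_def)

lemma ldim_nonneg: "finite X \<Longrightarrow> X \<subseteq> lpts N \<Longrightarrow> 0 \<le> ldim N X"
  using local_sstruct(1,2)[of X] unfolding ldim_def sclass_def sstrong_iff by auto

lemma ldim_le_card: "finite X \<Longrightarrow> X \<subseteq> lpts N \<Longrightarrow> ldim N X \<le> int (card X)"
  unfolding ldim_def by (rule pdim_le_card) (simp_all add: local_sstruct)

lemma ldim_submodular:
  assumes "finite X" "finite Y" "X \<subseteq> lpts N" "Y \<subseteq> lpts N"
  shows "ldim N (X \<union> Y) + ldim N (X \<inter> Y) \<le> ldim N X + ldim N Y"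
proof -
  have U: "finite (X \<union> Y)" "X \<union> Y \<subseteq> lpts N" using assms by auto
  have "X \<inter> Y \<subseteq> X \<union> Y" by blast
  thus ?thesis
    using pdim_submodular[OF local_sstruct(4)[OF U] assms(1,2)] local_sstruct(2)[OF U]
    by (simp add: ldim_local[OF U])
qed

end

text \<open>Strongness against supersets of bounded size. In an arbitrary model the third axiom provides
  nothing better.\<close>

definition mstrong :: "nat \<Rightarrow> 'a::infinite lstruct \<Rightarrow> 'a set \<Rightarrow> bool" where
  "mstrong m N A \<longleftrightarrow>
     (\<forall>D. finite D \<and> A \<subseteq> D \<and> D \<subseteq> lpts N \<and> card D \<le> m \<longrightarrow> ldim N A \<le> ldim N D)"

lemma mstrongD:
  "mstrong m N A \<Longrightarrow> finite D \<Longrightarrow> A \<subseteq> D \<Longrightarrow> D \<subseteq> lpts N \<Longrightarrow> card D \<le> m \<Longrightarrow> ldim N A \<le> ldim N D"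
  by (simp add: mstrong_def)

lemma mstrong_antimono: "mstrong m N A \<Longrightarrow> k \<le> m \<Longrightarrow> mstrong k N A"
  unfolding mstrong_def by (meson le_trans)

text \<open>Closures with respect to a degree of strongness that may depend on the size of the closure:
  each failure of strongness lowers the dimension, which is a natural number.\<close>

lemma closure_bounded:
  fixes g :: "nat \<Rightarrow> nat"
  shows "\<exists>s'. \<forall>(N :: 'a::infinite lstruct) A. axiom1 sclass N \<longrightarrow> finite A \<longrightarrow> A \<subseteq> lpts N \<longrightarrow> card A \<le> s \<longrightarrow>
    (\<exists>A'. finite A' \<and> A \<subseteq> A' \<and> A' \<subseteq> lpts N \<and> card A' \<le> s' \<and> mstrong (g (card A')) N A')"
proof -
  have "\<exists>s'. \<forall>(N :: 'a lstruct) A. axiom1 sclass N \<longrightarrow> finite A \<longrightarrow> A \<subseteq> lpts N \<longrightarrow> card A \<le> s \<longrightarrow>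
      ldim N A \<le> int d \<longrightarrow>
    (\<exists>A'. finite A' \<and> A \<subseteq> A' \<and> A' \<subseteq> lpts N \<and> card A' \<le> s' \<and> mstrong (g (card A')) N A')" for d
  proof (induction d arbitrary: s)
    case 0
    show ?case
    proof (intro exI[of _ s] allI impI)
      fix N :: "'a lstruct" and A
      assume a: "axiom1 sclass N" "finite A" "A \<subseteq> lpts N" "card A \<le> s" "ldim N A \<le> int 0"
      have "ldim N A \<le> ldim N D" if "finite D" "D \<subseteq> lpts N" for D
        using ldim_nonneg[OF a(1) that] a(5) by simp
      hence "mstrong (g (card A)) N A" by (simp add: mstrong_def)
      thus "\<exists>A'. finite A' \<and> A \<subseteq> A' \<and> A' \<subseteq> lpts N \<and> card A' \<le> s \<and> mstrong (g (card A')) N A'"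
        using a by blast
    qed
  next
    case (Suc d)
    \<comment> \<open>A witness against strongness has at most \<open>G\<close> points; its closure is found by induction.\<close>
    define G where "G = Max (g ` {..s})"
    have G: "g i \<le> G" if "i \<le> s" for i unfolding G_def using that by (intro Max_ge) auto
    obtain s1 where s1: "\<And>(N :: 'a lstruct) A. axiom1 sclass N \<Longrightarrow> finite A \<Longrightarrow> A \<subseteq> lpts N \<Longrightarrow> card A \<le> G \<Longrightarrow>
        ldim N A \<le> int d \<Longrightarrow>
      (\<exists>A'. finite A' \<and> A \<subseteq> A' \<and> A' \<subseteq> lpts N \<and> card A' \<le> s1 \<and> mstrong (g (card A')) N A')"
      using Suc.IH[of G] by blast
    show ?case
    proof (intro exI[of _ "max s s1"] allI impI)
      fix N :: "'a lstruct" and A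
      assume a: "axiom1 sclass N" "finite A" "A \<subseteq> lpts N" "card A \<le> s" "ldim N A \<le> int (Suc d)"
      show "\<exists>A'. finite A' \<and> A \<subseteq> A' \<and> A' \<subseteq> lpts N \<and> card A' \<le> max s s1 \<and> mstrong (g (card A')) N A'"
      proof (cases "mstrong (g (card A)) N A")
        case True
        thus ?thesis using a by (intro exI[of _ A]) simp
      next
        case False
        then obtain D where D: "finite D" "A \<subseteq> D" "D \<subseteq> lpts N" "card D \<le> g (card A)" "ldim N D < ldim N A"
          unfolding mstrong_def by (auto simp: not_le)
        have "card D \<le> G" using D(4) G[OF a(4)] by simp
        moreover have "ldim N D \<le> int d" using D(5) a(5) by simp
        ultimately obtain A' where A': "finite A'" "D \<subseteq> A'" "A' \<subseteq> lpts N" "card A' \<le> s1"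
            "mstrong (g (card A')) N A'"
          using s1[OF a(1) D(1,3)] by blast
        have "A \<subseteq> A'" using D(2) A'(2) by blast
        thus ?thesis using A' by (intro exI[of _ A']) simp
      qed
    qed
  qed
  from this[of s] obtain s' where s': "\<And>(N :: 'a lstruct) A. axiom1 sclass N \<Longrightarrow> finite A \<Longrightarrow> A \<subseteq> lpts N \<Longrightarrow>
      card A \<le> s \<Longrightarrow> ldim N A \<le> int s \<Longrightarrow>
      (\<exists>A'. finite A' \<and> A \<subseteq> A' \<and> A' \<subseteq> lpts N \<and> card A' \<le> s' \<and> mstrong (g (card A')) N A')"
    by blast
  show ?thesis
  proof (intro exI[of _ s'] allI impI)
    fix N :: "'a lstruct" and A
    assume a: "axiom1 sclass N" "finite A" "A \<subseteq> lpts N" "card A \<le> s"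
    have "ldim N A \<le> int s" using ldim_le_card[OF a(1-3)] a(4) by simp
    thus "\<exists>A'. finite A' \<and> A \<subseteq> A' \<and> A' \<subseteq> lpts N \<and> card A' \<le> s' \<and> mstrong (g (card A')) N A'"
      using s'[OF a] by blast
  qed
qed

lemma sstructure_F_struct: "sstructure (F_struct n)"
  by (simp add: sstructure_def) (simp add: F_struct_def)

lemma pdim_F_struct: "Z \<subseteq> {..<n} \<Longrightarrow> pdim (F_struct n) Z = int (card Z)"
  by (simp add: d0s_def sinduced_def F_struct_def)

lemma infinite_model:
  assumes "axiom3 N"
  shows "infinite (lpts N)"
proof
  assume fin: "finite (lpts N)"
  obtain f where "lembedding f (lstruct_of (F_struct (Suc (card (lpts N))))) N"
    using assms unfolding axiom3_def by meson
  from lembedding_inj[OF this] lembedding_into[OF this]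
  have "card {..<Suc (card (lpts N))} \<le> card (lpts N)" using fin by (intro card_inj_on_le) simp_all
  thus False by simp
qed

lemma mstrong_independent_set:
  fixes N :: "'a::infinite lstruct"
  assumes N: "axiom1 sclass N" "axiom3 N"
  obtains F where "finite F" "F \<subseteq> lpts N" "card F = n" "ldim N F = int n" "mstrong m N F"
proof -
  \<comment> \<open>The axiom concerns sets of one exact size, so smaller sets are enlarged to this size below.\<close>
  let ?m = "max m n"
  obtain f where f: "lembedding f (lstruct_of (F_struct n)) N"
    and st: "\<forall>D. finite D \<and> card D = ?m \<and> f ` {..<n} \<subseteq> D \<and> D \<subseteq> lpts N \<longrightarrow>
      (\<exists>E. sstructure E \<and> spts E = D \<and> liso id (lstruct_of E) (linduced N D) \<and> sstrong (f ` {..<n}) E)"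
    using N(2)[unfolded axiom3_def, THEN spec, THEN spec, of n ?m] unfolding spts_F_struct
    by (elim exE conjE) (rule that)
  let ?F = "f ` {..<n}"
  have F: "finite ?F" "?F \<subseteq> lpts N" "card ?F = n"
    using lembedding_inj[OF f] lembedding_into[OF f] by (auto simp: card_image)
  have dF: "ldim N ?F = int n"
    using ldim_image[OF N(1) sstructure_F_struct _ f, of "{..<n}"] by (simp add: pdim_F_struct)
  have "mstrong m N ?F"
    unfolding mstrong_def
  proof (intro allI impI)
    fix D assume D: "finite D \<and> ?F \<subseteq> D \<and> D \<subseteq> lpts N \<and> card D \<le> m"
    have "infinite (lpts N - D)" using infinite_model[OF N(2)] D by simp
    then obtain X where X: "finite X" "card X = ?m - card D" "X \<subseteq> lpts N - D"
      using infinite_arbitrarily_large[of "lpts N - D" "?m - card D"] by blast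
    let ?D = "D \<union> X"
    have "card ?D = card D + card X" using D X by (intro card_Un_disjoint) auto
    moreover have "card D \<le> ?m" using D by linarith
    ultimately have "card ?D = ?m" using X(2) by linarith
    moreover have "finite ?D" "?F \<subseteq> ?D" "?D \<subseteq> lpts N" using D X by auto
    ultimately obtain E where E: "sstructure E" "spts E = ?D" "liso id (lstruct_of E) (linduced N ?D)"
        "sstrong ?F E"
      using st[THEN spec, THEN mp, of ?D] by blast
    have id: "lembedding id (lstruct_of E) N"
      using E(3) liso_linduced_iff[OF \<open>?D \<subseteq> lpts N\<close>] by blast
    have fE: "finite (spts E)" using E(2) \<open>finite ?D\<close> by simp
    have "ldim N Z = pdim E Z" if "Z \<subseteq> ?D" for Z
      using ldim_image[OF N(1) E(1) fE id, of Z] that E(2) by simp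
    moreover have "pdim E ?F \<le> pdim E D" using E(2,4) D unfolding sstrong_iff by blast
    ultimately show "ldim N ?F \<le> ldim N D" using \<open>?F \<subseteq> ?D\<close> by simp
  qed
  thus ?thesis using that F dF by blast
qed

text \<open>A point that is free over \<open>B\<close> and with which \<open>B\<close> stays strong is found in a strong
  independent set with more than \<open>|B|\<close> points: otherwise every one of these points has a witness
  of dimension at most \<open>d(B)\<close>, and so has the union of the witnesses.\<close>

lemma free_point_exists:
  "\<exists>m0. \<forall>(N :: 'a::infinite lstruct) B. ts_model N \<longrightarrow> finite B \<longrightarrow> B \<subseteq> lpts N \<longrightarrow> card B \<le> s \<longrightarrow>
    mstrong m0 N B \<longrightarrow>
    (\<exists>b\<in>lpts N - B. ldim N (insert b B) = ldim N B + 1 \<and> mstrong m N (insert b B))"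
proof -
  \<comment> \<open>The witnesses have at most \<open>k\<close> points; one for each of \<open>Suc s\<close> points is united with \<open>B\<close>.\<close>
  define k where "k = max m (Suc s)"
  define m0 where "m0 = s + Suc s * k"
  show ?thesis
  proof (intro exI[of _ m0] allI impI)
    fix N :: "'a lstruct" and B
    assume "ts_model N" and B: "finite B" "B \<subseteq> lpts N" "card B \<le> s" "mstrong m0 N B"
    hence N: "axiom1 sclass N" "axiom3 N" by (auto simp: ts_model_def)
    obtain F where F: "finite F" "F \<subseteq> lpts N" "card F = Suc s" "ldim N F = int (Suc s)" "mstrong m0 N F"
      using mstrong_independent_set[OF N] .
    show "\<exists>b\<in>lpts N - B. ldim N (insert b B) = ldim N B + 1 \<and> mstrong m N (insert b B)"
    proof (rule ccontr)
      assume no: "\<not> ?thesis"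
      have "\<exists>D. finite D \<and> B \<subseteq> D \<and> b \<in> D \<and> D \<subseteq> lpts N \<and> card D \<le> k \<and> ldim N D \<le> ldim N B"
        if b: "b \<in> F" for b
      proof -
        have bN: "b \<in> lpts N" using b F(2) by blast
        have ins: "finite (insert b B)" "insert b B \<subseteq> lpts N" using B bN by auto
        have ci: "card (insert b B) \<le> k" 
        proof -
          have "card (insert b B) \<le> Suc (card B)" using B(1) by (simp add: card_insert_if)
          thus ?thesis using B(3) by (simp add: k_def)
        qed
        have "ldim N (B \<union> {b}) + ldim N (B \<inter> {b}) \<le> ldim N B + ldim N {b}"
          by (rule ldim_submodular[OF N(1)]) (use B bN in auto)
        moreover have "0 \<le> ldim N (B \<inter> {b})" by (rule ldim_nonneg[OF N(1)]) (use B in auto)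
        moreover have "ldim N {b} \<le> 1" using ldim_le_card[OF N(1), of "{b}"] bN by simp
        ultimately have le: "ldim N (insert b B) \<le> ldim N B + 1" by simp
        show ?thesis
        proof (cases "ldim N (insert b B) \<le> ldim N B")
          case True
          thus ?thesis using ins ci by (intro exI[of _ "insert b B"]) auto
        next
          case False
          hence eq: "ldim N (insert b B) = ldim N B + 1" using le by simp
          have "b \<notin> B" using False by (auto simp: insert_absorb)
          hence "\<not> mstrong m N (insert b B)" using no eq bN by blast
          then obtain D where D: "finite D" "insert b B \<subseteq> D" "D \<subseteq> lpts N" "card D \<le> m"
              "ldim N D < ldim N (insert b B)"
            unfolding mstrong_def by (auto simp: not_le)
          thus ?thesis using eq by (intro exI[of _ D]) (auto simp: k_def)
        qed
      qed
      then obtain D where D: "\<And>b. b \<in> F \<Longrightarrow> finite (D b) \<and> B \<subseteq> D b \<and> b \<in> D b \<and> D b \<subseteq> lpts N \<and>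
          card (D b) \<le> k \<and> ldim N (D b) \<le> ldim N B"
        by metis
      let ?U = "B \<union> \<Union>(D ` F)"
      have U: "finite ?U" "?U \<subseteq> lpts N" "F \<subseteq> ?U" using B(1,2) D F(1) by blast+
      have "card ?U \<le> card B + card (\<Union>(D ` F))" by (rule card_Un_le)
      also have "card (\<Union>(D ` F)) \<le> (\<Sum>b\<in>F. card (D b))" using F(1) by (rule card_UN_le)
      also have "(\<Sum>b\<in>F. card (D b)) \<le> (\<Sum>b\<in>F. k)" using D by (intro sum_mono) blast
      finally have cU: "card ?U \<le> m0" using B(3) F(3) by (simp add: m0_def)
      have "ldim N ?U \<le> ldim N B"
      proof (rule submodular_union_le[OF F(1), of ?U])
        show "ldim N (X \<union> Y) + ldim N (X \<inter> Y) \<le> ldim N X + ldim N Y" if "X \<subseteq> ?U" "Y \<subseteq> ?U" for X Y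
          by (rule ldim_submodular[OF N(1) finite_subset[OF that(1) U(1)] finite_subset[OF that(2) U(1)]
                subset_trans[OF that(1) U(2)] subset_trans[OF that(2) U(2)]])
        show "B \<subseteq> D b \<and> D b \<subseteq> ?U \<and> ldim N (D b) \<le> ldim N B" if "b \<in> F" for b
          using D[OF that] that by blast
        fix Z assume Z: "B \<subseteq> Z" "Z \<subseteq> ?U"
        show "ldim N B \<le> ldim N Z"
        proof (rule mstrongD[OF B(4) _ Z(1)])
          show "finite Z" using Z(2) U(1) by (rule finite_subset)
          show "Z \<subseteq> lpts N" using Z(2) U(2) by (rule subset_trans)
          show "card Z \<le> m0" using card_mono[OF U(1) Z(2)] cU by simp
        qed
      qed blast
      moreover have "ldim N F \<le> ldim N ?U" by (rule mstrongD[OF F(5) U(1,3,2) cU])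
      moreover have "ldim N B \<le> int s" using ldim_le_card[OF N(1) B(1,2)] B(3) by simp
      ultimately show False using F(4) by simp
    qed
  qed
qed


section \<open>Approximate richness\<close>

text \<open>Extensions of codimension at most \<open>k\<close> of sets of size at most \<open>s\<close> to structures of size at most
  \<open>s'\<close> have \<open>m\<close>-strong realisations over every \<open>m0\<close>-strong set. The bound \<open>m0\<close> must not depend on
  the model.\<close>

definition rich_bound :: "'a::infinite itself \<Rightarrow> nat \<Rightarrow> nat \<Rightarrow> nat \<Rightarrow> nat \<Rightarrow> nat \<Rightarrow> bool" where
  "rich_bound _ k s s' m m0 \<longleftrightarrow> (\<forall>(N :: 'a lstruct) (B :: 'a sstruct) A g. ts_model N \<longrightarrow> B \<in> sclass \<longrightarrow> sstrong A B \<longrightarrow>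
     pdim B (spts B) \<le> pdim B A + int k \<longrightarrow> card A \<le> s \<longrightarrow> card (spts B) \<le> s' \<longrightarrow>
     lembedding g (lstruct_of (sinduced B A)) N \<longrightarrow> mstrong m0 N (g ` A) \<longrightarrow>
     (\<exists>f. lembedding f (lstruct_of B) N \<and> (\<forall>a\<in>A. f a = g a) \<and> mstrong m N (f ` spts B)))"

text \<open>In codimension zero the image has the dimension of its base, so it inherits the strongness of the
  base.\<close>

lemma rich_bound_0: "rich_bound TYPE('a::infinite) 0 s s' m m"
  unfolding rich_bound_def
proof (intro allI impI)
  fix N :: "'a lstruct" and B :: "'a sstruct" and A g
  assume N: "ts_model N" and B: "B \<in> sclass" "sstrong A B" "pdim B (spts B) \<le> pdim B A + int 0"
    and g: "lembedding g (lstruct_of (sinduced B A)) N" "mstrong m N (g ` A)"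
  have N1: "axiom1 sclass N" "axiom2 sclass N" using N by (auto simp: ts_model_def)
  have B': "sstructure B" "finite (spts B)" "A \<subseteq> spts B"
    using B(1,2) by (auto simp: sclass_def sstrong_def)
  obtain f where f: "lembedding f (lstruct_of B) N" "\<And>a. a \<in> A \<Longrightarrow> f a = g a"
    using axiom2_embedding[OF N1(2) B(1,2) g(1)] by metis
  have fA: "f ` A = g ` A" using f(2) by auto
  have "mstrong m N (f ` spts B)"
    unfolding mstrong_def
  proof (intro allI impI)
    fix D assume D: "finite D \<and> f ` spts B \<subseteq> D \<and> D \<subseteq> lpts N \<and> card D \<le> m"
    have "ldim N (f ` spts B) = pdim B (spts B)" by (rule ldim_image[OF N1(1) B'(1,2) f(1) subset_refl])
    also have "\<dots> \<le> pdim B A" using B(3) by simp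
    also have "\<dots> = ldim N (g ` A)" using ldim_image[OF N1(1) B'(1,2) f(1) B'(3)] fA by simp
    also have "g ` A \<subseteq> D" using D B'(3) fA by blast
    hence "ldim N (g ` A) \<le> ldim N D" using g(2) D by (intro mstrongD[of m]) auto
    finally show "ldim N (f ` spts B) \<le> ldim N D" .
  qed
  thus "\<exists>f. lembedding f (lstruct_of B) N \<and> (\<forall>a\<in>A. f a = g a) \<and> mstrong m N (f ` spts B)"
    using f by blast
qed

text \<open>A set \<open>D\<close> over the image of \<open>B\<close> is compared with its union and intersection with the image of
  \<open>C\<close>; the union has at most \<open>card (spts C)\<close> further points, which determines the strongness required of
  \<open>C\<close>.\<close>

lemma mstrong_substructure:
  assumes N: "axiom1 sclass N" and C: "sstructure C" "finite (spts C)" and f: "lembedding f (lstruct_of C) N"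
    and B: "B \<subseteq> spts C" "\<And>Y. B \<subseteq> Y \<Longrightarrow> Y \<subseteq> spts C \<Longrightarrow> pdim C B \<le> pdim C Y"
    and m: "mstrong (m + card (spts C)) N (f ` spts C)"
  shows "mstrong m N (f ` B)"
  unfolding mstrong_def
proof (intro allI impI)
  fix D assume D: "finite D \<and> f ` B \<subseteq> D \<and> D \<subseteq> lpts N \<and> card D \<le> m"
  let ?X = "f ` spts C"
  have X: "finite ?X" "?X \<subseteq> lpts N" using C(2) lembedding_into[OF f] by auto
  have "card ?X \<le> card (spts C)" using C(2) by (rule card_image_le)
  hence "card (D \<union> ?X) \<le> m + card (spts C)" using card_Un_le[of D ?X] D by linarith
  hence "ldim N ?X \<le> ldim N (D \<union> ?X)" using D X by (intro mstrongD[OF m]) auto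
  moreover have "ldim N (D \<union> ?X) + ldim N (D \<inter> ?X) \<le> ldim N D + ldim N ?X"
    using D X by (intro ldim_submodular[OF N]) auto
  moreover have "ldim N (f ` B) \<le> ldim N (D \<inter> ?X)"
  proof -
    define Y where "Y = {y \<in> spts C. f y \<in> D}"
    have Y: "D \<inter> ?X = f ` Y" "Y \<subseteq> spts C" "B \<subseteq> Y" using D B(1) unfolding Y_def by auto
    show ?thesis
      unfolding Y(1) ldim_image[OF N C f Y(2)] ldim_image[OF N C f B(1)] by (rule B(2)[OF Y(3,2)])
  qed
  ultimately show "ldim N (f ` B) \<le> ldim N D" by linarith
qed

text \<open>The free point \<open>b\<close> is added to the base and the gadget to the extension. The gadget adds two points,
  which explains the sizes in the first instance of the induction hypothesis; the second covers
  extensions of smaller codimension.\<close>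

lemma rich_bound_Suc:
  assumes free: "\<forall>(N :: 'a::infinite lstruct) B. ts_model N \<longrightarrow> finite B \<longrightarrow> B \<subseteq> lpts N \<longrightarrow> card B \<le> s \<longrightarrow>
      mstrong m0 N B \<longrightarrow>
      (\<exists>b\<in>lpts N - B. ldim N (insert b B) = ldim N B + 1 \<and> mstrong m1 N (insert b B))"
    and IH1: "rich_bound TYPE('a) k (Suc s) (s' + 2) (m + (s' + 2)) m1"
    and IH2: "rich_bound TYPE('a) k s s' m m2"
  shows "rich_bound TYPE('a) (Suc k) s s' m (max m0 m2)"
  unfolding rich_bound_def
proof (intro allI impI)
  fix N :: "'a lstruct" and B :: "'a sstruct" and A g
  assume N: "ts_model N" and B: "B \<in> sclass" "sstrong A B" "pdim B (spts B) \<le> pdim B A + int (Suc k)"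
    and card: "card A \<le> s" "card (spts B) \<le> s'"
    and g: "lembedding g (lstruct_of (sinduced B A)) N" "mstrong (max m0 m2) N (g ` A)"
  have N1: "axiom1 sclass N" "axiom2 sclass N" using N by (auto simp: ts_model_def)
  have B': "sstructure B" "finite (spts B)" "A \<subseteq> spts B" "finite A" "sstrong {} B"
    using B(1,2) by (auto simp: sclass_def sstrong_def)
  show "\<exists>f. lembedding f (lstruct_of B) N \<and> (\<forall>a\<in>A. f a = g a) \<and> mstrong m N (f ` spts B)"
  proof (cases "pdim B (spts B) \<le> pdim B A + int k")
    case True
    moreover have "mstrong m2 N (g ` A)" using g(2) by (rule mstrong_antimono) simp
    ultimately show ?thesis
      using IH2[unfolded rich_bound_def, rule_format, OF N B(1,2) _ card g(1)] by simp
  next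
    case False
    hence "pdim B A < pdim B (spts B)" by simp
    then obtain x where x: "x \<in> spts B" "x \<notin> A"
      "\<And>Y. A \<subseteq> Y \<Longrightarrow> x \<in> Y \<Longrightarrow> Y \<subseteq> spts B \<Longrightarrow> pdim B A + 1 \<le> pdim B Y"
      using point_outside_closure[OF B'(1,2) B(2)] by metis
    have "infinite (UNIV - spts B)" using B'(2) by (simp add: infinite_UNIV)
    then obtain P where P: "finite P" "card P = 2" "P \<subseteq> UNIV - spts B"
      using infinite_arbitrarily_large[of "UNIV - spts B" 2] by blast
    then obtain p q where "P = {p, q}" "p \<noteq> q" by (auto simp: card_2_iff)
    hence pq: "p \<notin> spts B" "q \<notin> spts B" "p \<noteq> q" using P(3) by auto
    note gadget = B'(1,2) x(1) pq
    let ?C = "gadget x p q B" and ?A = "insert p A"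
    have C: "?C \<in> sclass" by (rule gadget_sclass[OF gadget B'(5)])
    have C': "sstructure ?C" "finite (spts ?C)" "spts B \<subseteq> spts ?C"
      using C by (auto simp: sclass_def gadget_simps[OF gadget])
    note base = gadget_base[OF gadget B(2) x(3)]
    have A: "finite ?A" "?A \<subseteq> spts ?C" using base(1) by (auto simp: sstrong_def)
    have gA: "inj_on g A" "g ` A \<subseteq> lpts N" "finite (g ` A)"
      using lembedding_inj[OF g(1)] lembedding_into[OF g(1)] B'(4) by simp_all
    have "card (g ` A) \<le> s" using card_image_le[OF B'(4), of g] card(1) by simp
    moreover have "mstrong m0 N (g ` A)" using g(2) by (rule mstrong_antimono) simp
    ultimately obtain b where b: "b \<in> lpts N - g ` A" "ldim N (insert b (g ` A)) = ldim N (g ` A) + 1"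
        "mstrong m1 N (insert b (g ` A))"
      using free N gA(2,3) by blast
    let ?E = "local_sstruct N (insert b (g ` A))"
    have fin: "finite (insert b (g ` A))" "insert b (g ` A) \<subseteq> lpts N" using gA b(1) by auto
    note E = local_sstruct[OF N1(1) fin]
    let ?g = "g(p := b)"
    have pA: "p \<notin> A" using pq(1) B'(3) by blast
    have g_A: "?g ` X = g ` X" if "X \<subseteq> A" for X using that pA by (intro image_cong) auto
    have gpA: "?g ` ?A = insert b (g ` A)" using g_A[OF subset_refl] by (simp only: image_insert fun_upd_same)
    have gE: "lembedding g (lstruct_of (sinduced B A)) (lstruct_of ?E)"
      by (rule lembedding_local[OF g(1) E(3)]) (auto simp: E(2))
    have "lembedding ?g (lstruct_of (sinduced ?C ?A)) (lstruct_of ?E)"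
    proof (rule lembedding_of_mult)
      have "inj_on ?g A" using gA(1) pA by (auto simp: inj_on_def)
      moreover have "?g p \<notin> ?g ` (A - {p})" using b(1) by auto
      ultimately show "inj_on ?g (spts (sinduced ?C ?A))" by simp
      show "?g ` spts (sinduced ?C ?A) \<subseteq> spts ?E" using gpA E(2) by simp
      fix X assume X: "X \<subseteq> spts (sinduced ?C ?A)" "finite X"
      hence X': "X \<subseteq> ?A" by simp
      have mC: "mult (sinduced ?C ?A) X = mult ?C X" by (rule mult_sinduced[OF C'(1) A X'])
      show "mult ?E (?g ` X) = mult (sinduced ?C ?A) X"
      proof (cases "p \<in> X")
        case False
        hence XA: "X \<subseteq> A" using X' by blast
        have "mult ?E (g ` X) = mult (sinduced B A) X"
          by (rule lembedding_mult[OF sstructure_sinduced[OF B'(1,4,3)] gE]) (use XA X(2) in simp_all)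
        also have "\<dots> = mult B X" by (rule mult_sinduced[OF B'(1,4,3) XA])
        also have "\<dots> = mult ?C X"
          by (rule mult_gadget_old[OF gadget, symmetric]) (use XA B'(3) in blast)
        finally show ?thesis using mC g_A[OF XA] by simp
      next
        case True
        have "mult ?C X = 0"
        proof -
          have "X \<noteq> {x, p, q}" using X' pq B'(3) by blast
          moreover have "\<not> X \<subseteq> spts B" using True pq(1) by blast
          moreover have "X \<subseteq> spts ?C" using X' A(2) by blast
          ultimately show ?thesis using mult_gadget_new[OF gadget] by simp
        qed
        moreover have "mult ?E (?g ` X) = 0"
        proof (rule free_point_mult[OF E(4) gA(3)])
          show "insert b (g ` A) \<subseteq> spts ?E" using E(2) by simp
          show "b \<notin> g ` A" using b(1) by blast
          show "pdim ?E (insert b (g ` A)) = pdim ?E (g ` A) + 1"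
            using b(2) ldim_local[OF N1(1) fin] by (metis subset_insertI subset_refl)
          show "?g ` X \<subseteq> insert b (g ` A)" using X' gpA by (metis image_mono)
          show "b \<in> ?g ` X" using True by (intro image_eqI[of _ _ p]) simp_all
        qed
        ultimately show ?thesis using mC by simp
      qed
    qed
    from lembedding_compose[OF this E(3)]
    have gN: "lembedding ?g (lstruct_of (sinduced ?C ?A)) N" by simp
    have "pdim ?C (spts ?C) \<le> pdim ?C ?A + int k"
      using pdim_gadget_full[OF gadget] base(2) B(3) by simp
    moreover have "card ?A \<le> Suc s" using card(1) B'(4) by (simp add: card_insert_if)
    moreover have cC: "card (spts ?C) \<le> s' + 2"
      using card(2) B'(2) by (simp add: gadget_simps[OF gadget] card_insert_if)
    moreover have "mstrong m1 N (?g ` ?A)" using b(3) unfolding gpA .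
    ultimately obtain f where f: "lembedding f (lstruct_of ?C) N" "\<forall>a\<in>?A. f a = ?g a"
        "mstrong (m + (s' + 2)) N (f ` spts ?C)"
      using IH1[unfolded rich_bound_def, THEN spec, THEN spec, THEN spec, THEN spec, of N ?C ?A ?g]
        N C base(1) gN by blast
    have BC: "lembedding id (lstruct_of B) (lstruct_of ?C)"
      by (rule lembedding_of_mult) (use C'(3) mult_gadget_old[OF gadget] in auto)
    have "lembedding f (lstruct_of B) N" using lembedding_compose[OF BC f(1)] by simp
    moreover have "\<forall>a\<in>A. f a = g a" using f(2) pA by auto
    moreover have "mstrong m N (f ` spts B)"
    proof (rule mstrong_substructure[OF N1(1) C'(1,2) f(1) C'(3)])
      show "pdim ?C (spts B) \<le> pdim ?C Y" if "spts B \<subseteq> Y" "Y \<subseteq> spts ?C" for Y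
        using gadget_strong[OF gadget that] pdim_gadget_old[OF gadget subset_refl] by simp
      show "mstrong (m + card (spts ?C)) N (f ` spts ?C)"
        using f(3) by (rule mstrong_antimono) (use cC in simp)
    qed
    ultimately show ?thesis by blast
  qed
qed

lemma rich_bound_exists: "\<exists>m0. rich_bound TYPE('a::infinite) k s s' m m0"
proof (induction k arbitrary: s s' m)
  case 0
  show ?case using rich_bound_0 by blast
next
  case (Suc k)
  obtain m1 where m1: "rich_bound TYPE('a) k (Suc s) (s' + 2) (m + (s' + 2)) m1" using Suc.IH by blast
  obtain m2 where m2: "rich_bound TYPE('a) k s s' m m2" using Suc.IH by blast
  obtain m0 where "\<forall>(N :: 'a lstruct) B. ts_model N \<longrightarrow> finite B \<longrightarrow> B \<subseteq> lpts N \<longrightarrow> card B \<le> s \<longrightarrow>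
      mstrong m0 N B \<longrightarrow>
      (\<exists>b\<in>lpts N - B. ldim N (insert b B) = ldim N B + 1 \<and> mstrong m1 N (insert b B))"
    using free_point_exists[of s m1] by blast
  thus ?case using rich_bound_Suc m1 m2 by blast
qed


section \<open>Back and forth\<close>

definition position :: "nat \<Rightarrow> nat \<Rightarrow> 'a::infinite lstruct \<Rightarrow> 'a lstruct \<Rightarrow> 'a set \<Rightarrow> ('a \<Rightarrow> 'a) \<Rightarrow> bool" where
  "position s m N N' A f \<longleftrightarrow> ts_model N \<and> ts_model N' \<and> finite A \<and> card A \<le> s \<and> A \<subseteq> lpts N \<and>
     lembedding f (linduced N A) N' \<and> mstrong m N A \<and> mstrong m N' (f ` A)"

text \<open>Only one direction is required; the other one follows by inverting the position
  (\<open>transfers_iff\<close>).\<close>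

definition transfers :: "'a::infinite itself \<Rightarrow> fm \<Rightarrow> nat \<Rightarrow> nat \<Rightarrow> bool" where
  "transfers _ \<phi> s m \<longleftrightarrow> (\<forall>(N :: 'a lstruct) N' A f v w. position s m N N' A f \<longrightarrow>
     (\<forall>x\<in>free_vars \<phi>. v x \<in> A \<and> w x = f (v x)) \<longrightarrow> sat N v \<phi> \<longrightarrow> sat N' w \<phi>)"

lemma position_inverse:
  assumes p: "position s m N N' A f"
  shows "position s m N' N (f ` A) (inv_into A f)" "a \<in> A \<Longrightarrow> inv_into A f (f a) = a"
proof -
  have f: "lembedding f (linduced N A) N'" and A: "A \<subseteq> lpts N" "finite A"
    using p by (auto simp: position_def)
  have inj: "inj_on f A" using lembedding_inj[OF f] by simp
  show "a \<in> A \<Longrightarrow> inv_into A f (f a) = a" using inj by simp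
  have "lembedding (inv_into A f) (linduced N' (f ` A)) (linduced N A)"
    using lembedding_inv[OF f] by simp
  hence "lembedding (inv_into A f) (linduced N' (f ` A)) N"
    using lembedding_linduced_iff[OF A(1)] by blast
  moreover have "inv_into A f ` f ` A = A" using inj by (rule inv_into_image_cancel) simp
  moreover have "f ` A \<subseteq> lpts N'" using lembedding_into[OF f] by simp
  ultimately show "position s m N' N (f ` A) (inv_into A f)"
    using p card_image[OF inj] by (simp add: position_def)
qed

lemma transfers_iff:
  assumes t: "transfers TYPE('a::infinite) \<phi> s m" and p: "position s m (N :: 'a lstruct) N' A f"
    and vw: "\<forall>x\<in>free_vars \<phi>. v x \<in> A \<and> w x = f (v x)"
  shows "sat N v \<phi> \<longleftrightarrow> sat N' w \<phi>"
proof
  assume "sat N v \<phi>"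
  thus "sat N' w \<phi>" using t p vw unfolding transfers_def by blast
next
  assume "sat N' w \<phi>"
  moreover have "\<forall>x\<in>free_vars \<phi>. w x \<in> f ` A \<and> v x = inv_into A f (w x)"
    using vw position_inverse(2)[OF p] by auto
  ultimately show "sat N v \<phi>" using t position_inverse(1)[OF p] unfolding transfers_def by blast
qed

lemma transfers_antimono:
  assumes "transfers t \<phi> s m" "m \<le> m'"
  shows "transfers t \<phi> s m'"
proof -
  have "position s m N N' A f" if "position s m' N N' A f" for N N' :: "'a lstruct" and A f
    using that assms(2) mstrong_antimono unfolding position_def by blast
  thus ?thesis using assms(1) unfolding transfers_def by blast
qed

text \<open>The witness is absorbed into a closure \<open>A'\<close> that is \<open>g (card A')\<close>-strong, as the hypothesis for
  \<open>\<phi>\<close> demands a strongness depending on the size of the position. The size of \<open>A'\<close> is bounded by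
  some \<open>s'\<close> beforehand, so \<open>A\<close> is strong in \<open>A'\<close> as soon as it is \<open>s'\<close>-strong, and the extension can
  be answered in the other model with strongness \<open>G\<close>, the maximum of the relevant values of \<open>g\<close>.\<close>

lemma transfers_Ex:
  assumes IH: "\<And>s. transfers TYPE('a::infinite) \<phi> s (g s)"
  shows "\<exists>m. transfers TYPE('a) (Ex x \<phi>) s m"
proof -
  obtain s' where s': "\<And>(N :: 'a lstruct) A. axiom1 sclass N \<Longrightarrow> finite A \<Longrightarrow> A \<subseteq> lpts N \<Longrightarrow> card A \<le> Suc s \<Longrightarrow>
    (\<exists>A'. finite A' \<and> A \<subseteq> A' \<and> A' \<subseteq> lpts N \<and> card A' \<le> s' \<and> mstrong (g (card A')) N A')"
    using closure_bounded[of "Suc s" g] by blast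
  define G where "G = Max (g ` {..s'})"
  have G: "g i \<le> G" if "i \<le> s'" for i unfolding G_def using that by (intro Max_ge) auto
  obtain m0 where m0: "rich_bound TYPE('a) s' s s' G m0" using rich_bound_exists by blast
  have "transfers TYPE('a) (Ex x \<phi>) s (max m0 s')"
    unfolding transfers_def
  proof (intro allI impI)
    fix N N' :: "'a lstruct" and A f v w
    assume p: "position s (max m0 s') N N' A f"
      and vw: "\<forall>y\<in>free_vars (Ex x \<phi>). v y \<in> A \<and> w y = f (v y)" and sat: "sat N v (Ex x \<phi>)"
    have N: "ts_model N" "ts_model N'" "axiom1 sclass N" using p by (auto simp: position_def ts_model_def)
    have A: "finite A" "card A \<le> s" "A \<subseteq> lpts N" and f: "lembedding f (linduced N A) N'"
      and st0: "mstrong (max m0 s') N A" "mstrong (max m0 s') N' (f ` A)"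
      using p by (auto simp: position_def)
    have st: "mstrong s' N A" "mstrong m0 N' (f ` A)"
      by (rule mstrong_antimono[OF st0(1)], simp, rule mstrong_antimono[OF st0(2)], simp)
    obtain a where a: "a \<in> lpts N" "sat N (v(x := a)) \<phi>" using sat by auto
    have "finite (insert a A)" "insert a A \<subseteq> lpts N" "card (insert a A) \<le> Suc s"
      using A a(1) by (simp_all add: card_insert_if)
    from s'[OF N(3) this] obtain A' where A': "finite A'" "insert a A \<subseteq> A'" "A' \<subseteq> lpts N" "card A' \<le> s'"
      "mstrong (g (card A')) N A'" by blast
    have AA: "A \<subseteq> A'" using A'(2) by blast
    let ?B = "local_sstruct N A'"
    note B = local_sstruct[OF N(3) A'(1,3)]
    \<comment> \<open>Subsets of \<open>A'\<close> have at most \<open>s'\<close> points.\<close>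
    have sA: "sstrong A ?B"
      unfolding sstrong_iff B(2)
    proof (intro conjI allI impI A(1) AA)
      fix D assume D: "finite D \<and> A \<subseteq> D \<and> D \<subseteq> A'"
      have "card D \<le> s'" using card_mono[OF A'(1), of D] D A'(4) by simp
      hence "ldim N A \<le> ldim N D" using D A'(3) by (intro mstrongD[OF st(1)]) auto
      thus "pdim ?B A \<le> pdim ?B D" using ldim_local[OF N(3) A'(1,3)] D AA by simp
    qed
    have "lembedding id (lstruct_of (sinduced ?B A)) (lstruct_of ?B)"
      using B(2,4) A(1) AA by (intro lembedding_sinduced) simp_all
    from lembedding_compose[OF this B(3)]
    have "lembedding id (lstruct_of (sinduced ?B A)) (linduced N A)"
      by (simp add: lembedding_linduced_iff[OF A(3)])
    from lembedding_compose[OF this f]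
    have fB: "lembedding f (lstruct_of (sinduced ?B A)) N'" by simp
    have "pdim ?B (spts ?B) \<le> int (card A')"
      using pdim_le_card[OF B(4) A'(1)] B(2) by simp
    moreover have "0 \<le> pdim ?B A"
      using ldim_nonneg[OF N(3) A(1,3)] ldim_local[OF N(3) A'(1,3) AA] by simp
    ultimately have "pdim ?B (spts ?B) \<le> pdim ?B A + int s'" using A'(4) by simp
    moreover have "card (spts ?B) \<le> s'" using A'(4) B(2) by simp
    ultimately obtain h where h: "lembedding h (lstruct_of ?B) N'" "\<forall>a\<in>A. h a = f a" "mstrong G N' (h ` A')"
      using m0[unfolded rich_bound_def, THEN spec, THEN spec, THEN spec, THEN spec, of N' ?B A f]
        N(2) B(1) sA A(2) fB st(2) unfolding B(2) by blast
    have hN: "lembedding h (linduced N A') N'"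
    proof -
      have "lembedding (inv_into A' id) (linduced N A') (lstruct_of ?B)"
        using lembedding_inv[OF B(3)] B(2) by simp
      hence "lembedding id (linduced N A') (lstruct_of ?B)"
        by (rule lembedding_cong[rotated]) (metis lpts_linduced id_apply image_id f_inv_into_f)
      from lembedding_compose[OF this h(1)] show ?thesis by simp
    qed
    have "position (card A') (g (card A')) N N' A' h"
      unfolding position_def using N(1,2) A' hN mstrong_antimono[OF h(3) G[OF A'(4)]] by simp
    moreover have "\<forall>y\<in>free_vars \<phi>. (v(x := a)) y \<in> A' \<and> (w(x := h a)) y = h ((v(x := a)) y)"
      using vw h(2) A'(2) by auto
    ultimately have "sat N' (w(x := h a)) \<phi>"
      using transfers_iff[OF IH] a(2) by blast
    moreover have "h a \<in> lpts N'" using lembedding_into[OF hN] A'(2) by auto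
    ultimately show "sat N' w (Ex x \<phi>)" by auto
  qed
  thus ?thesis by blast
qed

lemma transfers_exists: "wf_fm \<phi> \<Longrightarrow> \<exists>m. transfers TYPE('a::infinite) \<phi> s m"
proof (induction \<phi> arbitrary: s)
  case (Eq x y)
  show ?case unfolding transfers_def by (intro exI[of _ 0]) auto
next
  case (Rel r xs)
  have "transfers TYPE('a) (Rel r xs) s 0"
    unfolding transfers_def
  proof (intro allI impI)
    fix N N' :: "'a lstruct" and A f v w
    assume p: "position s 0 N N' A f" and vw: "\<forall>x\<in>free_vars (Rel r xs). v x \<in> A \<and> w x = f (v x)"
      and sat: "sat N v (Rel r xs)"
    have f: "lembedding f (linduced N A) N'" using p by (simp add: position_def)
    have mw: "map w xs = map f (map v xs)" using vw by simp
    have "set (map v xs) \<subseteq> lpts (linduced N A) \<and> length (map v xs) = arity r" "r \<in> language"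
      using vw Rel.prems by auto
    hence "linterp (linduced N A) r (map v xs) = linterp N' r (map f (map v xs))"
      using f unfolding lembedding_def by blast
    thus "sat N' w (Rel r xs)" using sat unfolding sat.simps mw linterp_linduced by blast
  qed
  thus ?case by blast
next
  case (Neg \<phi>)
  then obtain m where m: "transfers TYPE('a) \<phi> s m" by auto
  have "transfers TYPE('a) (Neg \<phi>) s m"
    unfolding transfers_def using transfers_iff[OF m] by simp blast
  thus ?case by blast
next
  case (Conj \<phi> \<psi>)
  then obtain m m' where "transfers TYPE('a) \<phi> s m" "transfers TYPE('a) \<psi> s m'" by (meson wf_fm.simps(4))
  hence m: "transfers TYPE('a) \<phi> s (max m m')" "transfers TYPE('a) \<psi> s (max m m')"
    by (auto intro: transfers_antimono)
  have "transfers TYPE('a) (Conj \<phi> \<psi>) s (max m m')"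
    unfolding transfers_def
  proof (intro allI impI)
    fix N N' :: "'a lstruct" and A f v w
    assume "position s (max m m') N N' A f" "\<forall>x\<in>free_vars (Conj \<phi> \<psi>). v x \<in> A \<and> w x = f (v x)"
      "sat N v (Conj \<phi> \<psi>)"
    thus "sat N' w (Conj \<phi> \<psi>)"
      using transfers_iff[OF m(1), of N N' A f v w] transfers_iff[OF m(2), of N N' A f v w] by simp
  qed
  thus ?case by blast
next
  case (Ex x \<phi>)
  hence "\<exists>m. transfers TYPE('a) \<phi> s m" for s by simp
  then obtain g where "\<And>s. transfers TYPE('a) \<phi> s (g s)" by metis
  thus ?case by (rule transfers_Ex)
qed

lemma elementarily_equivalent:
  fixes N N' :: "'a::infinite lstruct"
  assumes N: "ts_model N" "ts_model N'" and \<phi>: "sentence \<phi>"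
  shows "holds N \<phi> \<longleftrightarrow> holds N' \<phi>"
proof -
  obtain m where m: "transfers TYPE('a) \<phi> 0 m"
    using transfers_exists[where 'a = 'a, of \<phi> 0] \<phi> unfolding sentence_def by blast
  have ax: "axiom1 sclass N" "axiom1 sclass N'" "axiom3 N" "axiom3 N'"
    using N by (auto simp: ts_model_def)
  have "lpts N \<noteq> {}" "lpts N' \<noteq> {}" using infinite_model[OF ax(3)] infinite_model[OF ax(4)] by auto
  then obtain a b where ab: "a \<in> lpts N" "b \<in> lpts N'" by blast
  have "mstrong m K {}" if "axiom1 sclass K" for K :: "'a lstruct"
    unfolding mstrong_def using ldim_nonneg[OF that] ldim_empty[OF that] by simp
  moreover have "lembedding id (linduced N {}) N'"
    unfolding lembedding_def
  proof (intro conjI ballI allI impI)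
    fix r xs assume "r \<in> language" "set xs \<subseteq> lpts (linduced N {}) \<and> length xs = arity r"
    hence "arity r = 0" "3 \<le> arity r" by (auto simp: language_def)
    thus "linterp (linduced N {}) r xs = linterp N' r (map id xs)" by simp
  qed simp_all
  ultimately have p: "position 0 m N N' {} id" using N ax by (simp add: position_def)
  have "sat N (\<lambda>_. a) \<phi> \<longleftrightarrow> sat N' (\<lambda>_. b) \<phi>"
    by (rule transfers_iff[OF m p]) (use \<phi> in \<open>simp add: sentence_def\<close>)
  thus ?thesis
    using holds_iff_sat[OF \<phi>, of "\<lambda>_. a" N] holds_iff_sat[OF \<phi>, of "\<lambda>_. b" N'] ab by auto
qed


section \<open>Completeness\<close>

theorem theorem6p9:
  fixes M :: "'m::infinite rstruct"
  defines "Ms \<equiv> s_reduct M"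
  defines "Ts_axioms \<equiv> (\<lambda>N :: 'a::infinite lstruct.
             axiom1 (age Ms) N \<and> axiom2 (age Ms) N \<and> axiom3 N)"
  assumes "generic_rstructure M"
  shows "(\<exists>T. theory_stating Ts_axioms T) \<and>
         (\<forall>T. theory_stating Ts_axioms T \<longrightarrow>
            complete_theory TYPE('a) T \<and> consequences TYPE('a) T = Th (lstruct_of Ms))"
proof -
  interpret generic M by unfold_locales fact
  have Ts: "Ts_axioms = ts_model"
    by (rule ext) (simp add: Ts_axioms_def Ms_def ts_model_def age_s_reduct)
  have "countable (rpts M)" using generic by (simp add: generic_rstructure_def)
  then obtain i :: "'m \<Rightarrow> nat" where i: "inj_on i (rpts M)" by (rule countableE)
  obtain j :: "nat \<Rightarrow> 'a" where j: "inj j" using infinite_countable_subset[OF infinite_UNIV] by blast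
  have "inj_on (j \<circ> i) (rpts M)" using i j by (intro comp_inj_on) (auto intro: inj_on_subset)
  then interpret generic_copy M "j \<circ> i" by unfold_locales
  let ?N = "lstruct_of Ns"
  have model: "ts_model ?N" using axiom1_Ns axiom2_Ns axiom3_Ns by (simp add: ts_model_def)
  have ne: "lpts K \<noteq> {}" if "ts_model K" for K :: "'a lstruct"
    using infinite_model[of K] that by (auto simp: ts_model_def)
  have iso: "liso (j \<circ> i) (lstruct_of Ms) ?N"
    using lembedding_e Ns(2) by (simp add: liso_def Ms_def)
  have neM: "lpts (lstruct_of Ms) \<noteq> {}" using ne[OF model] Ns(2) by (simp add: Ms_def)
  have Th: "holds (lstruct_of Ms) \<phi> \<longleftrightarrow> holds K \<phi>" if "sentence \<phi>" "ts_model K" for \<phi> and K :: "'a lstruct"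
    using holds_liso[OF iso that(1) neM] elementarily_equivalent[OF model that(2,1)] by simp
  have "complete_theory TYPE('a) T \<and> consequences TYPE('a) T = Th (lstruct_of Ms)"
    if T: "theory_stating Ts_axioms T" for T
  proof
    have sT: "sentence \<phi>" if "\<phi> \<in> T" for \<phi> using T that by (simp add: theory_stating_def)
    have iff: "is_model K T \<longleftrightarrow> ts_model K" for K :: "'a lstruct"
      using T ne unfolding theory_stating_def Ts is_model_def by blast
    have cons: "\<phi> \<in> consequences TYPE('a) T \<longleftrightarrow> sentence \<phi> \<and> holds (lstruct_of Ms) \<phi>" for \<phi>
      using Th model by (auto simp: consequences_def iff)
    show "consequences TYPE('a) T = Th (lstruct_of Ms)"
      using cons by (auto simp: Th_def)
    have "holds (lstruct_of Ms) \<phi> \<or> holds (lstruct_of Ms) (Neg \<phi>)" if \<phi>: "sentence \<phi>" for \<phi>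
    proof -
      obtain a where a: "a \<in> lpts (lstruct_of Ms)" using neM by blast
      have "sentence (Neg \<phi>)" using \<phi> by (simp add: sentence_def)
      thus ?thesis
        using holds_iff_sat[OF \<phi>, of "\<lambda>_. a" "lstruct_of Ms"] holds_iff_sat[of "Neg \<phi>" "\<lambda>_. a" "lstruct_of Ms"] a
        by auto
    qed
    hence "\<phi> \<in> consequences TYPE('a) T \<or> Neg \<phi> \<in> consequences TYPE('a) T" if "sentence \<phi>" for \<phi>
      unfolding cons using that by (auto simp: sentence_def)
    moreover have "\<exists>N :: 'a lstruct. is_model N T" using iff model by blast
    ultimately show "complete_theory TYPE('a) T"
      using sT by (simp add: complete_theory_def)
  qed
  moreover have "\<exists>T. theory_stating Ts_axioms T"
    using theory_axioms[where 'a = 'a] unfolding Ts ts_model_def .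
  ultimately show ?thesis by blast
qed

end
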